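(* Let $L_0>0$ be a fixed radius, let $\beta_2\ge\beta_1>1/2$ and $m\ge2$. For $\beta\in[\beta_1,\beta_2]$ let $$\epsilon_n(\beta)=\epsilon_0\Big(\frac{\log n}{n}\Big)^{\frac{\beta}{2\beta+1}},$$ and let $j_n,k_n$ be the integers associated with $\epsilon_n=\epsilon_n(\beta)$. Suppose that, for $n$ large enough, there exists a positive constant $C_0$ such that, for all $\beta\in[\beta_1,\beta_2]$ and all $\boldsymbol\theta_0\in\Theta_\beta(L_0)$, $$K\big(p_0^{(n)},p_{0j_n}^{(n)}\big)\le C_0\,n\,\|\boldsymbol\theta_0-\boldsymbol\theta_{0j_n}\|_2^2\quad\text{and}\quad V_{m,0}\big(p_0^{(n)},p_{0j_n}^{(n)}\big)\le C_0^m\,n^{m/2}\,\|\boldsymbol\theta_0-\boldsymbol\theta_{0j_n}\|_2^m .$$ Suppose also that the following conditions hold with constants independent of $n$ and of $\boldsymbol\theta_0$ in the set $\bigcup_{\beta_1\le\beta\le\beta_2}\Theta_\beta(L_0)$. (A2) There exists $H_1>0$ such that $\mathcal{A}_n(H_1)\subset\widetilde{\mathcal{B}}_n(m)$. (A3) There exist non-negative constants $D_0,D_1,D_2$ such that for any $\boldsymbol\theta,\boldsymbol\theta'\in\Theta_{k_n}(Q)$, $d_n(\boldsymbol\theta,\boldsymbol\theta')\le D_0k_n^{D_1}\|\boldsymbol\theta-\boldsymbol\theta'\|_{2,k_n}^{D_2}$. (A4) There exist positive constants $c_1$ and $\zeta<1$ such that, for every $\boldsymbol\theta_1\in\Theta_{k_n}(Q)$,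 there exists a test $\phi_n(\boldsymbol\theta_1)\in[0,1]$ (a measurable function of $X^n$) with $$\mathbb{E}_0^{(n)}(\phi_n(\boldsymbol\theta_1))\le e^{-c_1nd_n^2(\boldsymbol\theta_0,\boldsymbol\theta_1)}\quad\text{and}\quad \sup_{d_n(\boldsymbol\theta,\boldsymbol\theta_1)<\zeta d_n(\boldsymbol\theta_0,\boldsymbol\theta_1)}\mathbb{E}_{\boldsymbol\theta}^{(n)}(1-\phi_n(\boldsymbol\theta_1))\le e^{-c_1nd_n^2(\boldsymbol\theta_0,\boldsymbol\theta_1)}.$$ (A5) There exist positive constants $a,b,C,G_1,G_2,G_3,G_4,H_2,\alpha,\tau_0$ such that $e^{-akL(k)}\le\pi(k)\le e^{-bkL(k)}$ for all $k=1,2,\ldots$; $G_1e^{-G_2|\theta|^\alpha}\le g(\theta)\le G_3e^{-G_4|\theta|^\alpha}$ for all $\theta\in\mathbb{R}$; $\max_{j\ge1}\tau_j\le\tau_0$; $\min_{j\le k_n}\tau_j\ge n^{-H_2}$; and $\sum_{j=1}^{j_n}|\theta_{0j}|^\alpha/\tau_j^\alpha\le Cj_n\log n$. Then, for a suitable constant $\epsilon_0>0$ depending on $L_0$, $C_0$ and the constants involved in the assumptions but not depending on $\beta$, and for $M$ sufficiently large, $$\sup_{\beta_1\le\beta\le\beta_2}\ \sup_{\boldsymbol\theta_0\in\Theta_\beta(L_0)}\mathbb{E}_0^{(n)}\,\Pi\Big(\boldsymbol\theta:\ d_n^2(\boldsymbol\theta,\boldsymbol\theta_0)\ge M\frac{\log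 n}{L(n)}\epsilon_n^2(\beta)\ \Big|\ X^n\Big)\underset{n\to\infty}{\longrightarrow}0 .$$
   Context: Model. For each $n\ge1$, $(\mathcal{X}^{(n)},A^{(n)},P_{\boldsymbol\theta}^{(n)}:\boldsymbol\theta\in\Theta)$ is a statistical model with $\Theta\subseteq\mathbb{R}^{\mathbb{N}}$ (sequences $\boldsymbol\theta=(\theta_j)_{j\ge1}$, with a $\sigma$-field), dominated by a measure $\mu$, with densities $p_{\boldsymbol\theta}^{(n)}$; the observation is $X^n$. The true parameter is $\boldsymbol\theta_0\in\Theta$; $p_0^{(n)}=p_{\boldsymbol\theta_0}^{(n)}$, and $\mathbb{E}_0^{(n)},\mathbb{E}_{\boldsymbol\theta}^{(n)}$ are expectations under $P_{\boldsymbol\theta_0}^{(n)},P_{\boldsymbol\theta}^{(n)}$. $d_n$ is a semimetric on $\Theta$; $\|\cdot\|_2$ is the $l^2$ norm. Sobolev classes. $\Theta_\beta(L_0)=\{\boldsymbol\theta:\sum_{j\ge1}\theta_j^2j^{2\beta}<L_0\}$, $\beta>1/2$, $L_0>0$. Sieves. $\Theta_k=\mathbb{R}^k$ is identified with the set of sequences in $\Theta$ whose entries vanish beyond index $k$. $\boldsymbol\theta_{0k}$ is the projection of $\boldsymbol\theta_0$ on its first $k$ coordinates, $p_{0k}^{(n)}$ is the density of the model at $\boldsymbol\theta_{0k}$, and $\|\cdot\|_{2,k}$ is the $l^2$ norm restricted to the first $k$ coordinates. Associated integers. $L$ is a positive slowly varying function with $L\le\log$ (for large arguments). For constants $j_0>0$,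 $M_0>1$ and a sequence $\epsilon_n$, $j_n=\lfloor j_0n\epsilon_n^2/\log n\rfloor$ and $k_n=\lfloor M_0j_n\log(n)/L(n)\rfloor$. For $Q>0$, $\Theta_{k_n}(Q)=\{\boldsymbol\theta\in\Theta_{k_n}:\|\boldsymbol\theta\|_{2,k_n}\le n^Q\}$. The tuning constants $M_0$ and $Q$ are taken sufficiently large (depending on $j_0$ and the constants of the conditions). Divergences. $K(f,g)=\int f\log(f/g)\,d\mu$; $V_{m,0}(f,g)=\int f|\log(f/g)-K(f,g)|^m d\mu$; $\widetilde K(f,g)=\int p_0^{(n)}|\log(f/g)|\,d\mu$; $\widetilde V_{m,0}(f,g)=\int p_0^{(n)}|\log(f/g)-K(f,g)|^md\mu$. Neighbourhoods (with $\epsilon_n=\epsilon_n(\beta)$). $\widetilde{\mathcal{B}}_n(m)=\{\boldsymbol\theta\in\Theta_{j_n}:\widetilde K(p_{0j_n}^{(n)},p_{\boldsymbol\theta}^{(n)})\le n\epsilon_n^2,\ \widetilde V_{m,0}(p_{0j_n}^{(n)},p_{\boldsymbol\theta}^{(n)})\le(n\epsilon_n^2)^{m/2}\}$ and $\mathcal{A}_n(H_1)=\{\boldsymbol\theta\in\Theta_{j_n}:\|\boldsymbol\theta_{0j_n}-\boldsymbol\theta\|_{2,j_n}\le n^{-H_1}\}$. Sieve prior. $\Pi=\sum_{k\ge1}\pi(k)\Pi_k$ with $\pi(k)\ge0$, $\sum_k\pi(k)=1$, where $\Pi_k$ is supported on $\Theta_k$ with Lebesgue density $\prod_{j=1}^k\tau_j^{-1}g(\theta_j/\tau_j)$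 on $\mathbb{R}^k$, for a probability density $g$ on $\mathbb{R}$ and positive scales $\boldsymbol\tau=(\tau_j)_{j\ge1}$ ($\pi,g,\boldsymbol\tau$ may depend on $n$). The truncated version $\Pi_k(\boldsymbol\theta_k)\propto\prod_{j=1}^k\tau_j^{-1}g(\theta_j/\tau_j)\,\mathbb{I}(\sum_{j=1}^k|\theta_j|\le r_1)$ is also allowed, with a constant $r_1>2\sum_{j}|\theta_{0j}|$ for all $\boldsymbol\theta_0$ in the classes considered. Posterior. $\Pi(B|X^n)=\int_Bp_{\boldsymbol\theta}^{(n)}(X^n)d\Pi(\boldsymbol\theta)/\int_\Theta p_{\boldsymbol\theta}^{(n)}(X^n)d\Pi(\boldsymbol\theta)$.
   Formalization: Two conditions are added, as the claim fails without them: in (A3) the exponent D_2 is strictly positive, and the slowly varying L also satisfies, for each γ in (0,1) and some c>0, L(y) ≥ c L(x) for all y in [x^γ, x] and x large. *)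

theory Defs
  imports "HOL-Probability.Probability"
begin

text \<open>
  A parameter \<open>(\<theta>\<^sub>j)\<close> with \<open>j = 1, 2, \<dots>\<close> is represented by a function of type \<open>nat \<Rightarrow> real\<close> whose
  value at \<open>j\<close> is \<open>\<theta>\<close> with index \<open>j + 1\<close>; thus the first \<open>k\<close> coordinates are those in \<open>{..<k}\<close>, and
  \<open>L2_set \<theta> {..<k}\<close> is the norm restricted to them.
\<close>

type_synonym param = "nat \<Rightarrow> real"


section \<open>Slowly varying functions\<close>

definition slowly_varying :: "(real \<Rightarrow> real) \<Rightarrow> bool" where
  "slowly_varying L \<longleftrightarrow>
     L \<in> borel_measurable (restrict_space borel {1..}) \<and>
     (\<forall>x\<ge>1. 0 < L x) \<and>
     (\<forall>c>0. ((\<lambda>x. L (c * x) / L x) \<longlongrightarrow> 1) at_top)"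

text \<open>
  Slow variation alone does not compare \<open>L (x powr \<gamma>)\<close> with \<open>L x\<close>: for
  \<open>L x = exp (sqrt (ln (ln x)) * sin (ln (ln x)))\<close> (for large \<open>x\<close>) and \<open>\<gamma> = 1 / 2\<close> the
  quotient of the two comes arbitrarily close to 0.  Constants and powers of the logarithm satisfy the following condition.
\<close>

definition power_scale_stable :: "(real \<Rightarrow> real) \<Rightarrow> bool" where
  "power_scale_stable L \<longleftrightarrow>
     (\<forall>\<gamma>\<in>{0<..<1}. \<exists>c>0. \<forall>\<^sub>F x in at_top. \<forall>y\<in>{x powr \<gamma>..x}. c * L x \<le> L y)"


section \<open>Parameters, sieves and the associated integers\<close>

definition trunc :: "nat \<Rightarrow> param \<Rightarrow> param" where
  "trunc k \<theta> = (\<lambda>j. if j < k then \<theta> j else 0)"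

definition sieve :: "nat \<Rightarrow> param set" where
  "sieve k = {\<theta>. \<forall>j\<ge>k. \<theta> j = 0}"

definition sieve_ball :: "nat \<Rightarrow> real \<Rightarrow> nat \<Rightarrow> param set" where
  "sieve_ball k Q n = {\<theta> \<in> sieve k. L2_set \<theta> {..<k} \<le> real n powr Q}"

definition l2_norm :: "param \<Rightarrow> real" where
  "l2_norm \<theta> = sqrt (\<Sum>j. (\<theta> j)\<^sup>2)"

definition sobolev :: "param set \<Rightarrow> real \<Rightarrow> real \<Rightarrow> param set" where
  "sobolev \<Theta> \<beta> L0 =
     {\<theta> \<in> \<Theta>. summable (\<lambda>j. (\<theta> j)\<^sup>2 * real (j + 1) powr (2 * \<beta>)) \<and>
              (\<Sum>j. (\<theta> j)\<^sup>2 * real (j + 1) powr (2 * \<beta>)) < L0}"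

definition rate :: "real \<Rightarrow> real \<Rightarrow> nat \<Rightarrow> real" where
  "rate \<epsilon>0 \<beta> n = \<epsilon>0 * (ln (real n) / real n) powr (\<beta> / (2 * \<beta> + 1))"

definition j_int :: "real \<Rightarrow> real \<Rightarrow> nat \<Rightarrow> nat" where
  "j_int j0 \<epsilon> n = nat \<lfloor>j0 * real n * \<epsilon>\<^sup>2 / ln (real n)\<rfloor>"

definition k_int :: "real \<Rightarrow> (real \<Rightarrow> real) \<Rightarrow> nat \<Rightarrow> nat \<Rightarrow> nat" where
  "k_int M0 L j n = nat \<lfloor>M0 * real j * ln (real n) / L (real n)\<rfloor>"


section \<open>Divergences\<close>

text \<open>
  Divergences take extended values: the Bochner integral of a non-integrable function is 0 and
  \<open>ln 0 = 0\<close>, so real-valued integrals would make infinite divergences small.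
\<close>

definition log_ratio :: "real \<Rightarrow> real \<Rightarrow> ereal" where
  "log_ratio u v =
     (if v = 0 then (if u = 0 then 0 else \<infinity>)
      else if u = 0 then - \<infinity> else ereal (ln (u / v)))"

definition abs_powr :: "ereal \<Rightarrow> real \<Rightarrow> ennreal" where
  "abs_powr z m = (if \<bar>z\<bar> = \<infinity> then \<infinity> else ennreal (\<bar>real_of_ereal z\<bar> powr m))"

text \<open>
  The integral is positive part minus negative part.  For probability densities the
  negative part is finite, since \<open>f ln (f / g) \<ge> f - g\<close>.
\<close>

definition KL :: "'x measure \<Rightarrow> ('x \<Rightarrow> real) \<Rightarrow> ('x \<Rightarrow> real) \<Rightarrow> ereal" where
  "KL \<mu> f g =
     enn2ereal (\<integral>\<^sup>+x. ennreal (f x) * e2ennreal (log_ratio (f x) (g x)) \<partial>\<mu>) -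
     enn2ereal (\<integral>\<^sup>+x. ennreal (f x) * e2ennreal (- log_ratio (f x) (g x)) \<partial>\<mu>)"

definition KL_tilde :: "'x measure \<Rightarrow> ('x \<Rightarrow> real) \<Rightarrow> ('x \<Rightarrow> real) \<Rightarrow> ('x \<Rightarrow> real) \<Rightarrow> ennreal" where
  "KL_tilde \<mu> p0 f g = (\<integral>\<^sup>+x. ennreal (p0 x) * e2ennreal \<bar>log_ratio (f x) (g x)\<bar> \<partial>\<mu>)"

text \<open>The centring is \<open>KL \<mu> f g\<close> even though the integral is taken against \<open>p0\<close>.\<close>

definition V_tilde ::
  "'x measure \<Rightarrow> real \<Rightarrow> ('x \<Rightarrow> real) \<Rightarrow> ('x \<Rightarrow> real) \<Rightarrow> ('x \<Rightarrow> real) \<Rightarrow> ennreal" where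
  "V_tilde \<mu> m p0 f g =
     (\<integral>\<^sup>+x. ennreal (p0 x) * abs_powr (log_ratio (f x) (g x) - KL \<mu> f g) m \<partial>\<mu>)"

definition V :: "'x measure \<Rightarrow> real \<Rightarrow> ('x \<Rightarrow> real) \<Rightarrow> ('x \<Rightarrow> real) \<Rightarrow> ennreal" where
  "V \<mu> m f g =
     (\<integral>\<^sup>+x. ennreal (f x) * abs_powr (log_ratio (f x) (g x) - KL \<mu> f g) m \<partial>\<mu>)"


section \<open>Statistical model\<close>

definition semimetric_on :: "'a set \<Rightarrow> ('a \<Rightarrow> 'a \<Rightarrow> real) \<Rightarrow> bool" where
  "semimetric_on S d \<longleftrightarrow>
     (\<forall>x\<in>S. \<forall>y\<in>S. 0 \<le> d x y \<and> d x y = d y x) \<and>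
     (\<forall>x\<in>S. d x x = 0) \<and>
     (\<forall>x\<in>S. \<forall>y\<in>S. \<forall>z\<in>S. d x z \<le> d x y + d y z)"

definition law :: "'x measure \<Rightarrow> (param \<Rightarrow> 'x \<Rightarrow> real) \<Rightarrow> param \<Rightarrow> 'x measure" where
  "law \<mu> p \<theta> = density \<mu> (\<lambda>x. ennreal (p \<theta> x))"

text \<open>
  \<open>T\<close> is the parameter set \<open>\<Theta> = space T\<close> with its \<open>\<sigma>\<close>-field (the values of the measure \<open>T\<close>
  are irrelevant), \<open>\<mu> n\<close> is the dominating measure on the \<open>n\<close>-th sample space, and \<open>p n\<close> are the
  densities.  Measurability of \<open>trunc k\<close> includes that all of \<open>\<real>\<^sup>k\<close> is embedded in \<open>\<Theta>\<close>.
\<close>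

definition statistical_model ::
  "param measure \<Rightarrow> (nat \<Rightarrow> 'x measure) \<Rightarrow> (nat \<Rightarrow> param \<Rightarrow> 'x \<Rightarrow> real) \<Rightarrow>
   (nat \<Rightarrow> param \<Rightarrow> param \<Rightarrow> real) \<Rightarrow> bool" where
  "statistical_model T \<mu> p d \<longleftrightarrow>
     (\<forall>k. trunc k \<in> PiM {..<k} (\<lambda>_. lborel) \<rightarrow>\<^sub>M T) \<and>
     (\<forall>n. sigma_finite_measure (\<mu> n)) \<and>
     (\<forall>n. (\<lambda>(\<theta>, x). p n \<theta> x) \<in> borel_measurable (T \<Otimes>\<^sub>M \<mu> n)) \<and>
     (\<forall>n. \<forall>\<theta>\<in>space T. (\<forall>x\<in>space (\<mu> n). 0 \<le> p n \<theta> x) \<and> prob_space (law (\<mu> n) (p n) \<theta>)) \<and>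
     (\<forall>n. semimetric_on (space T) (d n)) \<and>
     (\<forall>n. \<forall>\<theta>'\<in>space T. (\<lambda>\<theta>. d n \<theta> \<theta>') \<in> borel_measurable T)"


section \<open>Sieve prior and posterior\<close>

text \<open>
  \<open>r\<close> is the truncation level for the sum of the absolute values of the coordinates; \<open>r = \<infinity>\<close> is the
  prior without truncation, in which case the normalising factor is 1.
\<close>

definition prior_component ::
  "param measure \<Rightarrow> (real \<Rightarrow> real) \<Rightarrow> (nat \<Rightarrow> real) \<Rightarrow> ereal \<Rightarrow> nat \<Rightarrow> param measure" where
  "prior_component T g \<tau> r k =
     (let D = density (PiM {..<k} (\<lambda>_. lborel))
                (\<lambda>x. ennreal (\<Prod>j<k. g (x j / \<tau> j) / \<tau> j) *
                     indicator {x. ereal (\<Sum>j<k. \<bar>x j\<bar>) \<le> r} x)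
      in distr (scale_measure (inverse (emeasure D (space D))) D) T (trunc k))"

definition sieve_prior ::
  "param measure \<Rightarrow> nat pmf \<Rightarrow> (real \<Rightarrow> real) \<Rightarrow> (nat \<Rightarrow> real) \<Rightarrow> ereal \<Rightarrow> param measure" where
  "sieve_prior T \<pi> g \<tau> r = measure_pmf \<pi> \<bind> prior_component T g \<tau> r"

definition prior_data ::
  "(nat \<Rightarrow> nat pmf) \<Rightarrow> (nat \<Rightarrow> real \<Rightarrow> real) \<Rightarrow> (nat \<Rightarrow> nat \<Rightarrow> real) \<Rightarrow> bool" where
  "prior_data \<pi> g \<tau> \<longleftrightarrow>
     (\<forall>n. pmf (\<pi> n) 0 = 0) \<and>
     (\<forall>n. g n \<in> borel_measurable borel \<and> (\<forall>t. 0 \<le> g n t) \<and>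
          (\<integral>\<^sup>+t. ennreal (g n t) \<partial>lborel) = 1) \<and>
     (\<forall>n j. 0 < \<tau> n j)"

text \<open>In \<open>ennreal\<close>, the quotient is 0 where the denominator is 0 or \<open>\<infinity>\<close>.\<close>

definition posterior ::
  "param measure \<Rightarrow> (param \<Rightarrow> 'x \<Rightarrow> real) \<Rightarrow> param set \<Rightarrow> 'x \<Rightarrow> ennreal" where
  "posterior Pr p B x =
     (\<integral>\<^sup>+\<theta>\<in>B. ennreal (p \<theta> x) \<partial>Pr) / (\<integral>\<^sup>+\<theta>. ennreal (p \<theta> x) \<partial>Pr)"


section \<open>The conditions at a fixed sample size and true parameter\<close>

definition approximation_condition ::
  "'x measure \<Rightarrow> (param \<Rightarrow> 'x \<Rightarrow> real) \<Rightarrow> real \<Rightarrow> real \<Rightarrow> nat \<Rightarrow> nat \<Rightarrow> param \<Rightarrow> bool" where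
  "approximation_condition \<mu> p m C0 n j \<theta>0 \<longleftrightarrow>
     KL \<mu> (p \<theta>0) (p (trunc j \<theta>0))
       \<le> ereal (C0 * real n * (l2_norm (\<theta>0 - trunc j \<theta>0))\<^sup>2) \<and>
     V \<mu> m (p \<theta>0) (p (trunc j \<theta>0))
       \<le> ennreal (C0 powr m * real n powr (m / 2) * l2_norm (\<theta>0 - trunc j \<theta>0) powr m)"

definition nbhd_B ::
  "'x measure \<Rightarrow> (param \<Rightarrow> 'x \<Rightarrow> real) \<Rightarrow> real \<Rightarrow> nat \<Rightarrow> real \<Rightarrow> nat \<Rightarrow> param \<Rightarrow> param set" where
  "nbhd_B \<mu> p m n \<epsilon> j \<theta>0 =
     {\<theta> \<in> sieve j.
        KL_tilde \<mu> (p \<theta>0) (p (trunc j \<theta>0)) (p \<theta>) \<le> ennreal (real n * \<epsilon>\<^sup>2) \<and>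
        V_tilde \<mu> m (p \<theta>0) (p (trunc j \<theta>0)) (p \<theta>) \<le> ennreal ((real n * \<epsilon>\<^sup>2) powr (m / 2))}"

definition nbhd_A :: "real \<Rightarrow> nat \<Rightarrow> nat \<Rightarrow> param \<Rightarrow> param set" where
  "nbhd_A H1 n j \<theta>0 = {\<theta> \<in> sieve j. L2_set (trunc j \<theta>0 - \<theta>) {..<j} \<le> real n powr (- H1)}"

definition condition_A2 ::
  "'x measure \<Rightarrow> (param \<Rightarrow> 'x \<Rightarrow> real) \<Rightarrow> real \<Rightarrow> real \<Rightarrow> nat \<Rightarrow> real \<Rightarrow> nat \<Rightarrow> param \<Rightarrow> bool" where
  "condition_A2 \<mu> p m H1 n \<epsilon> j \<theta>0 \<longleftrightarrow> nbhd_A H1 n j \<theta>0 \<subseteq> nbhd_B \<mu> p m n \<epsilon> j \<theta>0"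

definition condition_A3 ::
  "(param \<Rightarrow> param \<Rightarrow> real) \<Rightarrow> real \<Rightarrow> real \<Rightarrow> real \<Rightarrow> real \<Rightarrow> nat \<Rightarrow> nat \<Rightarrow> bool" where
  "condition_A3 d D0 D1 D2 Q n k \<longleftrightarrow>
     (\<forall>\<theta>\<in>sieve_ball k Q n. \<forall>\<theta>'\<in>sieve_ball k Q n.
        d \<theta> \<theta>' \<le> D0 * real k powr D1 * L2_set (\<theta> - \<theta>') {..<k} powr D2)"

definition condition_A4 ::
  "param set \<Rightarrow> 'x measure \<Rightarrow> (param \<Rightarrow> 'x \<Rightarrow> real) \<Rightarrow> (param \<Rightarrow> param \<Rightarrow> real) \<Rightarrow>
   real \<Rightarrow> real \<Rightarrow> real \<Rightarrow> nat \<Rightarrow> nat \<Rightarrow> param \<Rightarrow> bool" where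
  "condition_A4 \<Theta> \<mu> p d c1 \<zeta> Q n k \<theta>0 \<longleftrightarrow>
     (\<forall>\<theta>1\<in>sieve_ball k Q n. \<exists>\<phi>\<in>borel_measurable \<mu>.
        (\<forall>x\<in>space \<mu>. \<phi> x \<in> {0..1}) \<and>
        (\<integral>x. \<phi> x \<partial>law \<mu> p \<theta>0) \<le> exp (- c1 * real n * (d \<theta>0 \<theta>1)\<^sup>2) \<and>
        (\<forall>\<theta>\<in>\<Theta>. d \<theta> \<theta>1 < \<zeta> * d \<theta>0 \<theta>1 \<longrightarrow>
           (\<integral>x. 1 - \<phi> x \<partial>law \<mu> p \<theta>) \<le> exp (- c1 * real n * (d \<theta>0 \<theta>1)\<^sup>2)))"

definition condition_A5 ::
  "(real \<Rightarrow> real) \<Rightarrow> nat pmf \<Rightarrow> (real \<Rightarrow> real) \<Rightarrow> (nat \<Rightarrow> real) \<Rightarrow>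
   real \<Rightarrow> real \<Rightarrow> real \<Rightarrow> real \<Rightarrow> real \<Rightarrow> real \<Rightarrow> real \<Rightarrow> real \<Rightarrow> real \<Rightarrow> real \<Rightarrow>
   nat \<Rightarrow> nat \<Rightarrow> nat \<Rightarrow> param \<Rightarrow> bool" where
  "condition_A5 L \<pi> g \<tau> a b C G1 G2 G3 G4 H2 \<alpha> \<tau>0 n j k \<theta>0 \<longleftrightarrow>
     (\<forall>i\<ge>1. exp (- a * real i * L (real i)) \<le> pmf \<pi> i \<and>
            pmf \<pi> i \<le> exp (- b * real i * L (real i))) \<and>
     (\<forall>t. G1 * exp (- G2 * \<bar>t\<bar> powr \<alpha>) \<le> g t \<and> g t \<le> G3 * exp (- G4 * \<bar>t\<bar> powr \<alpha>)) \<and>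
     (\<forall>i. \<tau> i \<le> \<tau>0) \<and>
     (\<forall>i<k. real n powr (- H2) \<le> \<tau> i) \<and>
     (\<Sum>i<j. \<bar>\<theta>0 i\<bar> powr \<alpha> / \<tau> i powr \<alpha>) \<le> C * real j * ln (real n)"

end

theory Submission
  imports Defs "HOL-Real_Asymp.Real_Asymp"
begin

text \<open>
  Write \<open>R = n \<epsilon>\<^sup>2\<close>. The integer \<open>j\<close> is chosen so that \<open>j ln n\<close> and \<open>R\<close> agree up to constants, and every
  exponent below is measured in units of \<open>j ln n\<close>. The expected posterior mass of a set \<open>B\<close> is controlled by a test \<open>\<Phi>\<close>, a
  lower bound for the evidence (the integral of the likelihood over the prior, in units of the true density)
  and the prior mass of the parameters that the test does not reach (lemma \<open>expected_posterior_le\<close>):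
  it is at most the error of the first kind of \<open>\<Phi>\<close>, plus the probability that the evidence is small, plus the average
  error of the second kind over \<open>B\<close> divided by the evidence.

  Evidence. On a Sobolev class the bias of the projection on \<open>j\<close> coordinates is at most \<open>\<epsilon>\<close> once \<open>\<epsilon>0\<close> is
  large, uniformly in the smoothness. Hence parameters close to this projection have likelihood at
  least \<open>exp (- 6 R)\<close> times that of the truth, outside an event of probability of order \<open>R powr (- m / 2)\<close>
  (lemma \<open>small_likelihood_ratio_prob\<close>). The prior charges a box of side \<open>2 n powr (- H)\<close> around the projection with mass
  \<open>exp (- cA j ln n)\<close> (lemma \<open>coordinate_prior_box_exp\<close>). Together the evidence is at least
  \<open>exp (- cB j ln n)\<close> up to a factor.

  Sieve. Each index \<open>i\<close> from \<open>k + 1\<close> to \<open>n\<close> has prior probability at most \<open>exp (- (cB + 2) j ln n)\<close> when \<open>M0\<close> is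
  large, because \<open>i L n\<close> exceeds \<open>M0 j ln n\<close> and \<open>L\<close> at any index between \<open>n powr \<gamma>\<close> and \<open>n\<close> is at least
  a multiple of \<open>L n\<close>; indices beyond \<open>n\<close> are negligible since \<open>L\<close> decays more slowly than any negative power
  (lemma \<open>slowly_varying_lower_bound\<close>). Inside the first \<open>k\<close> sieves, the complement of the ball of radius
  \<open>n powr Q\<close> has exponentially small prior mass in \<open>n\<close>.

  Tests. The part of the ball of radius \<open>n powr Q\<close> in \<open>\<real>\<^sup>k\<close> that is at distance at least \<open>u\<close> from the truth is
  covered by at most \<open>exp (cN k ln n)\<close> cells of polynomially small diameter. The local tests at one point of each
  cell combine into \<open>\<Phi>\<close> (lemma \<open>global_test\<close>). The error bound of a local test only decreases with the distance
  from the truth, so \<open>exp (- c1 n u\<^sup>2)\<close> serves for all of them. Here \<open>k ln n\<close> is of order \<open>(ln n / L n) j ln n\<close>, which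
  is where the factor \<open>ln n / L n\<close> in \<open>u\<^sup>2 = M (ln n / L n) \<epsilon>\<^sup>2\<close> comes from: with \<open>M\<close> large, the exponent
  \<open>c1 n u\<^sup>2\<close> dominates both the entropy and the evidence.

  All these bounds combine to \<open>13 / n + 4 j0 / ln n\<close>, which depends neither on the smoothness nor on the
  true parameter (lemma \<open>posterior_bound_at_sample_size\<close>).
\<close>

section \<open>Slowly varying functions and the associated integers\<close>

text \<open>
  Slow variation at \<open>c = 2\<close> bounds the loss along a dyadic sequence by a factor \<open>q\<close> close to 1 in each step,
  which is a small negative power of the argument. Between two dyadic points, stability under powers
  replaces the uniform convergence theorem for slowly varying functions.
\<close>

lemma slowly_varying_lower_bound:
  assumes "slowly_varying L" "power_scale_stable L" "0 < \<delta>"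
  shows "\<forall>\<^sub>F x in at_top. x powr (- \<delta>) \<le> L x"
proof -
  define q where "q = (2::real) powr (- \<delta> / 2)"
  have q: "0 < q" "q < 1" using assms(3) by (auto simp: q_def powr_less_one)
  have pos: "0 < L x" if "1 \<le> x" for x using assms(1) that by (auto simp: slowly_varying_def)
  have "((\<lambda>x. L (2 * x) / L x) \<longlongrightarrow> 1) at_top"
    using assms(1) by (auto simp: slowly_varying_def)
  hence "\<forall>\<^sub>F x in at_top. q < L (2 * x) / L x"
    using q(2) by (rule order_tendstoD)
  then obtain X0 where X0: "\<And>x. X0 \<le> x \<Longrightarrow> q < L (2 * x) / L x"
    by (auto simp: eventually_at_top_linorder)
  have "\<exists>c>0. \<forall>\<^sub>F x in at_top. \<forall>y\<in>{x powr (1/2)..x}. c * L x \<le> L y"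
    using assms(2) unfolding power_scale_stable_def by auto
  then obtain c X1 where c: "0 < c"
    and X1: "\<And>x y. \<lbrakk>X1 \<le> x; x powr (1/2) \<le> y; y \<le> x\<rbrakk> \<Longrightarrow> c * L x \<le> L y"
    unfolding eventually_at_top_linorder by (metis atLeastAtMost_iff)
  define x1 where "x1 = max 4 (max X0 X1)"
  have x1: "4 \<le> x1" "X0 \<le> x1" "X1 \<le> x1" by (auto simp: x1_def)
  have dyadic: "q ^ i * L x1 \<le> L (2 ^ i * x1)" for i
  proof (induction i)
    case (Suc i)
    have ge: "x1 \<le> 2 ^ i * x1" using x1 by simp
    have "q < L (2 * (2 ^ i * x1)) / L (2 ^ i * x1)" using X0 ge x1 by (meson order.trans)
    moreover have "0 < L (2 ^ i * x1)" using ge x1 by (intro pos) linarith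
    ultimately have "q * L (2 ^ i * x1) \<le> L (2 ^ Suc i * x1)"
      by (simp add: field_simps)
    moreover have "q * (q ^ i * L x1) \<le> q * L (2 ^ i * x1)"
      using Suc q by (intro mult_left_mono) auto
    ultimately show ?case by (simp add: mult.assoc)
  qed simp
  have bound: "c * L x1 * (2 * x) powr (- \<delta> / 2) \<le> L x" if x: "x1 \<le> x" for x
  proof -
    define i where "i = nat \<lceil>log 2 (x / x1)\<rceil>"
    have l0: "0 \<le> log 2 (x / x1)" using x x1 by simp
    have ri: "real i = of_int \<lceil>log 2 (x / x1)\<rceil>" using l0 by (simp add: i_def)
    have i1: "log 2 (x / x1) \<le> real i" and i2: "real i \<le> log 2 (x / x1) + 1"
      unfolding ri by linarith+
    have p: "(2::real) ^ i = 2 powr real i" by (simp add: powr_realpow)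
    have e: "2 powr (log 2 (x / x1)) = x / x1" using x x1 by simp
    have up: "x \<le> 2 ^ i * x1"
    proof -
      have "2 powr (log 2 (x / x1)) \<le> 2 powr real i" using i1 by simp
      hence "x / x1 \<le> 2 ^ i" unfolding e p[symmetric] .
      thus ?thesis using x1 by (simp add: field_simps)
    qed
    have two: "(2::real) ^ i \<le> 2 * (x / x1)"
    proof -
      have "(2::real) ^ i \<le> 2 powr (log 2 (x / x1) + 1)" unfolding p using i2 by simp
      also have "\<dots> = 2 * (x / x1)" unfolding powr_add e by simp
      finally show ?thesis .
    qed
    have lo: "2 ^ i * x1 \<le> 2 * x" using two x1 by (simp add: field_simps)
    have "(2 ^ i * x1) powr (1/2) \<le> x"
    proof -
      have "2 ^ i * x1 \<le> x * x"
        using lo x x1 mult_right_mono[of 2 x x] by linarith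
      hence "sqrt (2 ^ i * x1) \<le> sqrt (x * x)" by (rule real_sqrt_le_mono)
      thus ?thesis using x x1 by (simp add: powr_half_sqrt)
    qed
    moreover have "X1 \<le> 2 ^ i * x1" using up x x1 by linarith
    ultimately have a: "c * L (2 ^ i * x1) \<le> L x" using X1 up by blast
    have "(2 * x) powr (- \<delta> / 2) \<le> q ^ i"
    proof -
      have "2 ^ i \<le> 2 * x"
      proof -
        have "2 * (x / x1) \<le> 2 * x" using x x1 by (simp add: field_simps)
        thus ?thesis using two by linarith
      qed
      hence "(2 * x) powr (- \<delta> / 2) \<le> (2 ^ i) powr (- \<delta> / 2)"
        using assms(3) by (intro powr_mono2') auto
      also have "\<dots> = q ^ i" unfolding q_def p
        by (simp add: powr_powr mult.commute flip: powr_realpow)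
      finally show ?thesis .
    qed
    hence "(2 * x) powr (- \<delta> / 2) * L x1 \<le> q ^ i * L x1"
      using pos[of x1] x1 by (intro mult_right_mono) auto
    with dyadic[of i] have "(2 * x) powr (- \<delta> / 2) * L x1 \<le> L (2 ^ i * x1)" by linarith
    hence "c * ((2 * x) powr (- \<delta> / 2) * L x1) \<le> c * L (2 ^ i * x1)"
      using c by simp
    with a show ?thesis by (simp add: mult_ac)
  qed
  have K: "0 < c * L x1" using c pos x1 by auto
  have "\<forall>\<^sub>F x in at_top. x powr (- \<delta>) \<le> c * L x1 * (2 * x) powr (- \<delta> / 2)"
    using K assms(3) by real_asymp
  moreover have "\<forall>\<^sub>F x in at_top. x1 \<le> x" by (rule eventually_ge_at_top)
  ultimately show ?thesis by eventually_elim (use bound in force)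
qed

text \<open>
  With \<open>X = n / ln n\<close>, the squared rate is a negative power of \<open>X\<close>, and \<open>n \<epsilon>\<^sup>2 / ln n\<close>, which is \<open>j\<close> up to
  constants, is a positive one.
\<close>

lemma rate_squared:
  assumes "2 \<le> n" "0 \<le> \<beta>"
  shows "real n * (rate \<epsilon>0 \<beta> n)\<^sup>2
    = \<epsilon>0\<^sup>2 * (real n / ln (real n)) powr (1 / (2 * \<beta> + 1)) * ln (real n)"
    and "(rate \<epsilon>0 \<beta> n)\<^sup>2 = \<epsilon>0\<^sup>2 * (real n / ln (real n)) powr (- (2 * \<beta> / (2 * \<beta> + 1)))"
proof -
  have l: "0 < ln (real n)" "0 < real n" using assms by auto
  define X where "X = real n / ln (real n)"
  have X: "0 < X" using l by (simp add: X_def)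
  have "(ln (real n) / real n) = X powr (-1)" using l by (simp add: X_def powr_minus)
  hence "((ln (real n) / real n) powr (\<beta> / (2 * \<beta> + 1)))\<^sup>2 = X powr (- (2 * \<beta> / (2 * \<beta> + 1)))"
    using X by (simp only: powr_powr power2_eq_square flip: powr_add) (simp add: field_simps)
  thus e: "(rate \<epsilon>0 \<beta> n)\<^sup>2 = \<epsilon>0\<^sup>2 * (real n / ln (real n)) powr (- (2 * \<beta> / (2 * \<beta> + 1)))"
    by (simp add: rate_def power_mult_distrib X_def)
  have nX: "real n = X powr 1 * ln (real n)" using l X by (simp add: X_def)
  have "1 + - (2 * \<beta> / (2 * \<beta> + 1)) = 1 / (2 * \<beta> + 1)" using assms by (simp add: field_simps)
  hence "X powr 1 * X powr (- (2 * \<beta> / (2 * \<beta> + 1))) = X powr (1 / (2 * \<beta> + 1))"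
    by (metis powr_add)
  thus "real n * (rate \<epsilon>0 \<beta> n)\<^sup>2
    = \<epsilon>0\<^sup>2 * (real n / ln (real n)) powr (1 / (2 * \<beta> + 1)) * ln (real n)"
    unfolding e by (subst nX) (simp add: X_def[symmetric] mult_ac)
qed

text \<open>
  The exponent of \<open>n / ln n\<close> in the real number whose floor is \<open>j\<close> lies between the values at the two end
  points of the range of smoothness, so one threshold for \<open>n\<close> serves all \<open>\<beta>\<close>. Its largest value, at \<open>\<beta>1\<close>,
  is below \<open>1 / 2\<close>, which leaves room below \<open>sqrt n\<close>.
\<close>

lemma eventually_j_int_bounds:
  assumes "1 / 2 < \<beta>1" "\<beta>1 \<le> \<beta>2" "0 < j0" "0 < \<epsilon>0"
  shows "\<forall>\<^sub>F n in sequentially. \<forall>\<beta>\<in>{\<beta>1..\<beta>2}.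
    let R = real n * (rate \<epsilon>0 \<beta> n)\<^sup>2; j = j_int j0 (rate \<epsilon>0 \<beta> n) n in
    real n powr (1 / (2 * (2 * \<beta>2 + 1))) \<le> real j \<and> real j \<le> sqrt (real n) \<and>
    real j * ln (real n) \<le> j0 * R \<and> j0 * R \<le> 2 * real j * ln (real n) \<and>
    j0 * R < (real j + 1) * ln (real n)"
proof -
  define p2 where "p2 = 1 / (2 * \<beta>2 + 1)"
  define p1 where "p1 = 1 / (2 * \<beta>1 + 1)"
  define K where "K = j0 * \<epsilon>0\<^sup>2"
  have par: "0 < p2" "p1 < 1/2" "0 < p1" "0 < K" using assms by (auto simp: p1_def p2_def K_def field_simps)
  have "\<forall>\<^sub>F n::nat in at_top. 2 * real n powr (p2 / 2) \<le> K * (real n / ln (real n)) powr p2"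
    using par by real_asymp
  moreover have "\<forall>\<^sub>F n::nat in at_top. K * (real n / ln (real n)) powr p1 \<le> real n powr (1/2)"
    using par by real_asymp
  moreover have "\<forall>\<^sub>F n::nat in at_top. ln (real n) \<le> real n" by real_asymp
  moreover have "\<forall>\<^sub>F n::nat in at_top. 2 \<le> n" by (rule eventually_ge_at_top)
  ultimately show ?thesis
  proof eventually_elim
    case (elim n)
    show ?case
    proof
      fix \<beta> assume \<beta>: "\<beta> \<in> {\<beta>1..\<beta>2}"
      define R where "R = real n * (rate \<epsilon>0 \<beta> n)\<^sup>2"
      define j where "j = j_int j0 (rate \<epsilon>0 \<beta> n) n"
      define X where "X = real n / ln (real n)"
      have l: "0 < ln (real n)" using elim by auto
      have X1: "1 \<le> X" using elim l by (simp add: X_def field_simps)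
      have RX: "j0 * R / ln (real n) = K * X powr (1 / (2 * \<beta> + 1))"
        unfolding R_def using rate_squared(1)[of n \<beta> \<epsilon>0] elim \<beta> assms l by (simp add: K_def X_def)
      have lower: "X powr p2 \<le> X powr (1 / (2 * \<beta> + 1))"
        using X1 \<beta> assms by (intro powr_mono) (auto simp: p2_def field_simps)
      hence "2 * real n powr (p2 / 2) \<le> j0 * R / ln (real n)"
        unfolding RX using order.trans[OF elim(1)[folded X_def] mult_left_mono[OF lower, of K]] par by simp
      moreover have upper: "X powr (1 / (2 * \<beta> + 1)) \<le> X powr p1"
        using X1 \<beta> assms by (intro powr_mono) (auto simp: p1_def field_simps)
      hence "j0 * R / ln (real n) \<le> sqrt (real n)"
        unfolding RX using order.trans[OF mult_left_mono[OF upper, of K] elim(2)[folded X_def]] par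
        by (simp add: powr_half_sqrt)
      moreover have n1: "1 \<le> real n powr (p2 / 2)"
        using elim par by (intro ge_one_powr_ge_zero) auto
      moreover have jf: "real j = of_int \<lfloor>j0 * R / ln (real n)\<rfloor>"
        unfolding j_def j_int_def R_def using assms l by (simp add: mult_ac)
      have "real j \<le> j0 * R / ln (real n)" "j0 * R / ln (real n) < real j + 1"
        unfolding jf by linarith+
      moreover define y where "y = j0 * R / ln (real n)"
      ultimately have
        "real n powr (p2 / 2) \<le> real j" "real j \<le> sqrt (real n)" "real j \<le> y"
        "y \<le> 2 * real j" "y < real j + 1"
        unfolding y_def[symmetric] by linarith+
      thus "let R = real n * (rate \<epsilon>0 \<beta> n)\<^sup>2; j = j_int j0 (rate \<epsilon>0 \<beta> n) n in
          real n powr (1 / (2 * (2 * \<beta>2 + 1))) \<le> real j \<and> real j \<le> sqrt (real n) \<and>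
          real j * ln (real n) \<le> j0 * R \<and> j0 * R \<le> 2 * real j * ln (real n) \<and>
          j0 * R < (real j + 1) * ln (real n)"
        unfolding R_def[symmetric] j_def[symmetric] Let_def y_def using l
        by (simp add: p2_def field_simps)
    qed
  qed
qed

section \<open>Bias of the projections on Sobolev classes\<close>

lemma sobolev_tail_bound:
  assumes "\<theta> \<in> sobolev \<Theta> \<beta> L0" "0 < \<beta>"
  shows "summable (\<lambda>i. ((\<theta> - trunc j \<theta>) i)\<^sup>2)"
    and "(l2_norm (\<theta> - trunc j \<theta>))\<^sup>2 \<le> L0 * (real j + 1) powr (- (2 * \<beta>))"
proof -
  let ?w = "\<lambda>i. (\<theta> i)\<^sup>2 * real (i + 1) powr (2 * \<beta>)"
  let ?K = "(real j + 1) powr (- (2 * \<beta>))"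
  have s: "summable ?w" and lt: "(\<Sum>i. ?w i) < L0" using assms by (auto simp: sobolev_def)
  have le: "((\<theta> - trunc j \<theta>) i)\<^sup>2 \<le> ?w i * ?K" for i
  proof (cases "i < j")
    case False
    have "1 = real (i + 1) powr (2 * \<beta>) * real (i + 1) powr (- (2 * \<beta>))"
      by (simp flip: powr_add)
    also have "\<dots> \<le> real (i + 1) powr (2 * \<beta>) * ?K"
      using False assms(2) by (intro mult_left_mono powr_mono2') auto
    finally have "(\<theta> i)\<^sup>2 * 1 \<le> (\<theta> i)\<^sup>2 * (real (i + 1) powr (2 * \<beta>) * ?K)"
      by (intro mult_left_mono) auto
    thus ?thesis using False by (simp add: trunc_def mult.assoc)
  qed (simp add: trunc_def)
  have s2: "summable (\<lambda>i. ?w i * ?K)" using s by (rule summable_mult2)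
  show s1: "summable (\<lambda>i. ((\<theta> - trunc j \<theta>) i)\<^sup>2)"
    by (rule summable_comparison_test'[OF s2, of 0]) (use le in auto)
  have "(l2_norm (\<theta> - trunc j \<theta>))\<^sup>2 = (\<Sum>i. ((\<theta> - trunc j \<theta>) i)\<^sup>2)"
    unfolding l2_norm_def using s1 by (simp add: suminf_nonneg)
  also have "\<dots> \<le> (\<Sum>i. ?w i * ?K)" using le s1 s2 by (rule suminf_le)
  also have "\<dots> = (\<Sum>i. ?w i) * ?K" using s by (simp add: suminf_mult2)
  also have "\<dots> \<le> L0 * ?K" using lt by (intro mult_right_mono) auto
  finally show "(l2_norm (\<theta> - trunc j \<theta>))\<^sup>2 \<le> L0 * ?K" .
qed

text \<open>
  Young's inequality \<open>x y \<le> x\<^sup>2 + y\<^sup>2\<close> with \<open>y = (i + 1) powr (- \<beta>)\<close>, whose square is summable because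
  \<open>\<beta> > 1 / 2\<close>. This makes the sum that is compared with the truncation level of the prior a genuine one.
\<close>

lemma sobolev_abs_summable:
  assumes "\<theta> \<in> sobolev \<Theta> \<beta> L0" "1 / 2 < \<beta>"
  shows "summable (\<lambda>i. \<bar>\<theta> i\<bar>)"
proof -
  let ?w = "\<lambda>i. (\<theta> i)\<^sup>2 * real (i + 1) powr (2 * \<beta>)"
  let ?v = "\<lambda>i. real (i + 1) powr (- (2 * \<beta>))"
  have s: "summable ?w" using assms by (auto simp: sobolev_def)
  have "summable (\<lambda>i. real i powr (- (2 * \<beta>)))" using assms by (simp add: summable_real_powr_iff)
  hence v: "summable ?v" using summable_Suc_iff[of "\<lambda>i. real i powr (- (2 * \<beta>))"] by simp
  have "\<bar>\<theta> i\<bar> \<le> ?w i + ?v i" for i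
  proof -
    let ?x = "\<bar>\<theta> i\<bar> * real (i + 1) powr \<beta>" and ?y = "real (i + 1) powr (- \<beta>)"
    have "?x * ?y = \<bar>\<theta> i\<bar>" by (simp add: mult.assoc flip: powr_add)
    moreover have "(real (i + 1) powr s)\<^sup>2 = real (i + 1) powr (2 * s)" for s
      by (simp add: power2_eq_square flip: powr_add)
    hence "?x\<^sup>2 = ?w i" "?y\<^sup>2 = ?v i" by (simp_all only: power_mult_distrib power2_abs) simp
    moreover have "x * y \<le> x\<^sup>2 + y\<^sup>2" if "0 \<le> x * y" for x y :: real
      using sum_squares_bound[of x y] that by linarith
    hence "?x * ?y \<le> ?x\<^sup>2 + ?y\<^sup>2" by simp
    ultimately show ?thesis by linarith
  qed
  thus ?thesis by (intro summable_comparison_test'[OF summable_add[OF s v], of 0]) auto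
qed

text \<open>
  The squared bias is of order \<open>j powr (- 2 \<beta>)\<close>; since \<open>j + 1\<close> exceeds \<open>(n / ln n) powr (1 / (2 \<beta> + 1))\<close>, a
  constant that does not depend on \<open>\<beta>\<close> suffices to bring it below \<open>\<epsilon>\<^sup>2\<close>.
\<close>

lemma bias_le_rate:
  assumes "2 \<le> n" "0 < \<beta>" "0 < j0" "0 < \<epsilon>0" "0 \<le> A" "A \<le> \<epsilon>0\<^sup>2" "1 \<le> j0 * \<epsilon>0\<^sup>2"
    and j: "j0 * (real n * (rate \<epsilon>0 \<beta> n)\<^sup>2) < (real j + 1) * ln (real n)"
  shows "A * (real j + 1) powr (- (2 * \<beta>)) \<le> (rate \<epsilon>0 \<beta> n)\<^sup>2"
proof -
  define X where "X = real n / ln (real n)"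
  have l: "0 < ln (real n)" using assms by simp
  have X: "0 < X" using l assms by (simp add: X_def)
  have "1 * X powr (1 / (2 * \<beta> + 1)) \<le> j0 * \<epsilon>0\<^sup>2 * X powr (1 / (2 * \<beta> + 1))"
    using assms by (intro mult_right_mono) auto
  also have "\<dots> < real j + 1"
  proof -
    have "j0 * \<epsilon>0\<^sup>2 * X powr (1 / (2 * \<beta> + 1)) * ln (real n) < (real j + 1) * ln (real n)"
      using j rate_squared(1)[of n \<beta> \<epsilon>0] assms by (simp add: X_def mult.assoc)
    thus ?thesis using l by simp
  qed
  finally have "(real j + 1) powr (- (2 * \<beta>)) \<le> (X powr (1 / (2 * \<beta> + 1))) powr (- (2 * \<beta>))"
    using assms X by (intro powr_mono2') auto
  also have "\<dots> = X powr (- (2 * \<beta> / (2 * \<beta> + 1)))" by (simp add: powr_powr)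
  finally have "A * (real j + 1) powr (- (2 * \<beta>)) \<le> \<epsilon>0\<^sup>2 * X powr (- (2 * \<beta> / (2 * \<beta> + 1)))"
    using assms by (intro mult_mono) auto
  thus ?thesis using rate_squared(2)[of n \<beta> \<epsilon>0] assms by (simp add: X_def)
qed

text \<open>
  The factor \<open>C0 + C0\<^sup>2\<close> serves the two divergences at once: \<open>C0\<close> for the first, and \<open>C0\<^sup>2\<close> for the
  second after writing \<open>C0 powr m\<close> as \<open>(C0\<^sup>2) powr (m / 2)\<close>.
\<close>

lemma approximation_divergences:
  assumes approx: "approximation_condition \<mu> p m C0 n j \<theta>0"
    and \<theta>0: "\<theta>0 \<in> sobolev \<Theta> \<beta> L0" "0 < \<beta>"
    and bias: "(C0 + C0\<^sup>2) * L0 * (real j + 1) powr (- (2 * \<beta>)) \<le> \<epsilon>\<^sup>2"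
    and const: "0 < C0" "0 \<le> m"
  shows "KL \<mu> (p \<theta>0) (p (trunc j \<theta>0)) \<le> ereal (real n * \<epsilon>\<^sup>2)"
    and "V \<mu> m (p \<theta>0) (p (trunc j \<theta>0)) \<le> ennreal ((real n * \<epsilon>\<^sup>2) powr (m / 2))"
proof -
  let ?l = "l2_norm (\<theta>0 - trunc j \<theta>0)"
  have "(C0 + C0\<^sup>2) * ?l\<^sup>2 \<le> (C0 + C0\<^sup>2) * (L0 * (real j + 1) powr (- (2 * \<beta>)))"
    using sobolev_tail_bound(2)[OF \<theta>0] const by (intro mult_left_mono) auto
  hence b: "C0 * ?l\<^sup>2 + C0\<^sup>2 * ?l\<^sup>2 \<le> \<epsilon>\<^sup>2" using bias by (simp add: algebra_simps)
  have nn: "0 \<le> C0 * ?l\<^sup>2" "0 \<le> C0\<^sup>2 * ?l\<^sup>2" using const by auto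
  have "C0 * ?l\<^sup>2 \<le> \<epsilon>\<^sup>2" "C0\<^sup>2 * ?l\<^sup>2 \<le> \<epsilon>\<^sup>2" using b nn by linarith+
  hence b1: "real n * (C0 * ?l\<^sup>2) \<le> real n * \<epsilon>\<^sup>2" and b2: "real n * (C0\<^sup>2 * ?l\<^sup>2) \<le> real n * \<epsilon>\<^sup>2"
    by (auto intro: mult_left_mono)
  have "KL \<mu> (p \<theta>0) (p (trunc j \<theta>0)) \<le> ereal (C0 * real n * ?l\<^sup>2)"
    using approx by (simp add: approximation_condition_def)
  also have "\<dots> \<le> ereal (real n * \<epsilon>\<^sup>2)" using b1 by (simp add: mult_ac)
  finally show "KL \<mu> (p \<theta>0) (p (trunc j \<theta>0)) \<le> ereal (real n * \<epsilon>\<^sup>2)" .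
  have sq: "x powr m = (x\<^sup>2) powr (m / 2)" if "0 \<le> x" for x :: real
  proof (cases "x = 0")
    case False
    hence "x\<^sup>2 = x powr 2" using that by simp
    thus ?thesis by (simp only: powr_powr) simp
  qed simp
  have l0: "0 \<le> ?l"
    unfolding l2_norm_def using sobolev_tail_bound(1)[OF \<theta>0]
    by (intro real_sqrt_ge_zero suminf_nonneg) auto
  have "V \<mu> m (p \<theta>0) (p (trunc j \<theta>0)) \<le> ennreal (C0 powr m * real n powr (m / 2) * ?l powr m)"
    using approx by (simp add: approximation_condition_def)
  also have "C0 powr m * real n powr (m / 2) * ?l powr m = (real n * (C0\<^sup>2 * ?l\<^sup>2)) powr (m / 2)"
    using const l0 by (simp add: sq[of C0] sq[of ?l] powr_mult mult_ac)
  also have "\<dots> \<le> (real n * \<epsilon>\<^sup>2) powr (m / 2)" using b2 const by (intro powr_mono2) auto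
  finally show "V \<mu> m (p \<theta>0) (p (trunc j \<theta>0)) \<le> ennreal ((real n * \<epsilon>\<^sup>2) powr (m / 2))"
    by (simp add: ennreal_leI)
qed

section \<open>Likelihood ratios near the truth\<close>

text \<open>
  The centre \<open>K\<close> may be \<open>-\<infinity>\<close> and the value \<open>z\<close> may be \<open>\<infinity>\<close>: the deviation is then infinite, in
  agreement with the bound.
\<close>

lemma abs_powr_diff_lower:
  assumes "K \<le> ereal s" "ereal (s + R) < z" "0 \<le> R" "0 \<le> m"
  shows "ennreal (R powr m) \<le> abs_powr (z - K) m"
  using assms
  by (cases z; cases K) (auto simp: abs_powr_def intro!: ennreal_leI powr_mono2)

lemma abs_powr_diff_lower':
  assumes "ereal s < K" "z \<le> ereal (s - R)" "0 \<le> R" "0 \<le> m"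
  shows "ennreal (R powr m) \<le> abs_powr (z - K) m"
  using assms
  by (cases z; cases K) (auto simp: abs_powr_def intro!: ennreal_leI powr_mono2)

lemma log_ratio_gt:
  assumes "0 \<le> v" "v < exp (- s) * u" 
  shows "ereal s < log_ratio u v"
proof -
  have "0 < exp (- s) * u" using assms by linarith
  hence u: "0 < u" by (simp add: zero_less_mult_iff)
  show ?thesis
  proof (cases "v = 0")
    case False
    hence v: "0 < v" using assms by simp
    hence "exp s < u / v" using assms u by (simp add: exp_minus field_simps)
    hence "ln (exp s) < ln (u / v)" using v u by (subst ln_less_cancel_iff) auto
    thus ?thesis using False u by (simp add: log_ratio_def)
  qed (use u in \<open>simp add: log_ratio_def\<close>)
qed

lemma log_ratio_le:
  assumes "0 \<le> u" "0 < u \<Longrightarrow> exp (- s) * u \<le> v" "0 \<le> s" 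
  shows "log_ratio u v \<le> ereal s"
proof (cases "u = 0")
  case False
  hence v': "exp (- s) * u \<le> v" and "0 < exp (- s) * u" using assms by auto
  hence v: "0 < v" by linarith
  note v = v v'
  hence "u / v \<le> exp s" by (simp add: exp_minus field_simps)
  hence "ln (u / v) \<le> ln (exp s)" using v False assms by (subst ln_le_cancel_iff) auto
  hence "ln (u / v) \<le> s" by simp
  thus ?thesis using v False by (simp add: log_ratio_def)
qed (use assms in \<open>simp add: log_ratio_def zero_ereal_def\<close>)

text \<open>
  Markov's inequality in a form that applies directly to the integrands of the divergences: the event \<open>E\<close> is
  described by an inequality between densities, and \<open>h\<close> enters only through a lower bound on \<open>E\<close>.
\<close>

lemma nn_integral_lower_bound_on:
  assumes "E \<in> sets \<mu>" "\<And>x. x \<in> E \<Longrightarrow> c \<le> h x" "f \<in> borel_measurable \<mu>"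
  shows "c * emeasure (density \<mu> f) E \<le> (\<integral>\<^sup>+x. f x * h x \<partial>\<mu>)"
proof -
  have "c * emeasure (density \<mu> f) E = (\<integral>\<^sup>+x. c * (f x * indicator E x) \<partial>\<mu>)"
    using assms by (simp add: emeasure_density nn_integral_cmult)
  also have "\<dots> \<le> (\<integral>\<^sup>+x. f x * h x \<partial>\<mu>)"
    using assms(2) by (intro nn_integral_mono)
      (auto split: split_indicator simp: mult.commute[of c] intro!: mult_left_mono)
  finally show ?thesis .
qed

text \<open>
  The log-likelihood ratio of the truth to \<open>pt\<close> splits at the projection \<open>q\<close>. The first part is centred at most
  at \<open>R\<close>, and Markov's inequality for the \<open>m\<close>-th central moment bounds its excess over \<open>2 R\<close>. The second
  part is centred at the divergence of \<open>q\<close> and \<open>pt\<close>, which is not a mean under the truth; but the mean of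
  its absolute value is at most \<open>R\<close>, and the moment bound forces the centre to be near the bulk of the values, hence below
  \<open>3 R\<close>. Its excess over \<open>4 R\<close> is then controlled in the same way.
\<close>

lemma small_likelihood_ratio_prob:
  fixes p0 q pt :: "'x \<Rightarrow> real"
  assumes meas: "p0 \<in> borel_measurable \<mu>" "q \<in> borel_measurable \<mu>" "pt \<in> borel_measurable \<mu>"
    and nonneg: "\<And>x. x \<in> space \<mu> \<Longrightarrow> 0 \<le> p0 x \<and> 0 \<le> q x \<and> 0 \<le> pt x"
    and P0: "prob_space (density \<mu> (\<lambda>x. ennreal (p0 x)))"
    and m: "2 \<le> m" and R: "2 < R"
    and KL0: "KL \<mu> p0 q \<le> ereal R" and V0: "V \<mu> m p0 q \<le> ennreal (R powr (m / 2))"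
    and KL1: "KL_tilde \<mu> p0 q pt \<le> ennreal R" and V1: "V_tilde \<mu> m p0 q pt \<le> ennreal (R powr (m / 2))"
  shows "emeasure (density \<mu> (\<lambda>x. ennreal (p0 x))) {x \<in> space \<mu>. pt x < exp (- (6 * R)) * p0 x}
    \<le> ennreal (2 * R powr (- (m / 2)))"
proof -
  let ?P = "density \<mu> (\<lambda>x. ennreal (p0 x))"
  interpret P: prob_space ?P by (rule P0)
  note [measurable] = meas
  have fin: "emeasure ?P A = ennreal (P.prob A)" for A by (rule P.emeasure_eq_measure)
  have half: "R powr m = R powr (m / 2) * R powr (m / 2)" by (simp flip: powr_add)
  have Rm: "2 < R powr (m / 2)"
  proof -
    have "R powr 1 \<le> R powr (m / 2)" using m R by (intro powr_mono) auto
    thus ?thesis using R by simp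
  qed
  have deviation: "P.prob E \<le> R powr (- (m / 2))"
    if E: "E \<in> sets \<mu>" "\<And>x. x \<in> E \<Longrightarrow> ennreal (R powr m) \<le> h x"
      and h: "(\<integral>\<^sup>+x. ennreal (p0 x) * h x \<partial>\<mu>) \<le> ennreal (R powr (m / 2))" for E h
  proof -
    have "ennreal (R powr m) * emeasure ?P E \<le> ennreal (R powr (m / 2))"
      by (rule order.trans[OF nn_integral_lower_bound_on[OF E] h]) auto
    hence "R powr m * P.prob E \<le> R powr (m / 2)"
      by (simp add: fin flip: ennreal_mult)
    hence "R powr (m / 2) * (R powr (m / 2) * P.prob E) \<le> R powr (m / 2) * 1"
      unfolding half by (simp add: mult.assoc)
    hence "R powr (m / 2) * P.prob E \<le> 1"
      by (rule mult_left_le_imp_le) (use Rm in linarith)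
    moreover have "R powr (m / 2) * R powr (- (m / 2)) = 1" using R by (simp flip: powr_add)
    ultimately have "R powr (m / 2) * P.prob E \<le> R powr (m / 2) * R powr (- (m / 2))" by simp
    thus ?thesis by (rule mult_left_le_imp_le) (use Rm in linarith)
  qed
  define E1 where "E1 = {x \<in> space \<mu>. q x < exp (- (R + R)) * p0 x}"
  define E2 where "E2 = {x \<in> space \<mu>. pt x < exp (- (3 * R + R)) * q x}"
  have [measurable]: "E1 \<in> sets \<mu>" "E2 \<in> sets \<mu>" by (auto simp: E1_def E2_def)
  have b1: "P.prob E1 \<le> R powr (- (m / 2))"
  proof (rule deviation)
    fix x assume "x \<in> E1"
    hence "ereal (R + R) < log_ratio (p0 x) (q x)" using nonneg by (intro log_ratio_gt) (auto simp: E1_def)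
    thus "ennreal (R powr m) \<le> abs_powr (log_ratio (p0 x) (q x) - KL \<mu> p0 q) m"
      using KL0 R m by (intro abs_powr_diff_lower) auto
  qed (use V0 in \<open>auto simp: V_def\<close>)
  \<comment> \<open>otherwise the log-ratio, which is below \<open>2 R\<close> with probability at least \<open>1 / 2\<close>, would be at distance
    \<open>R\<close> from its centre that often, against the moment bound\<close>
  have centre: "KL \<mu> q pt \<le> ereal (3 * R)"
  proof (rule ccontr)
    assume "\<not> KL \<mu> q pt \<le> ereal (3 * R)"
    hence big: "ereal (3 * R) < KL \<mu> q pt" by simp
    define G where "G = {x \<in> space \<mu>. exp (- (2 * R)) * q x \<le> pt x}"
    have G[measurable]: "G \<in> sets \<mu>" by (auto simp: G_def)
    have "P.prob G \<le> R powr (- (m / 2))"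
    proof (rule deviation)
      fix x assume "x \<in> G"
      hence "log_ratio (q x) (pt x) \<le> ereal (3 * R - R)"
        using R nonneg by (intro log_ratio_le) (auto simp: G_def)
      thus "ennreal (R powr m) \<le> abs_powr (log_ratio (q x) (pt x) - KL \<mu> q pt) m"
        using big R m by (intro abs_powr_diff_lower') auto
    qed (use V1 in \<open>auto simp: V_tilde_def\<close>)
    moreover have "R powr (- (m / 2)) < 1 / 2" using Rm by (simp add: powr_minus divide_less_eq field_simps)
    moreover have "2 * R * P.prob (space \<mu> - G) \<le> R"
    proof -
      have "ennreal (2 * R) * emeasure ?P (space \<mu> - G) \<le> KL_tilde \<mu> p0 q pt"
        unfolding KL_tilde_def
      proof (rule nn_integral_lower_bound_on)
        fix x assume "x \<in> space \<mu> - G"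
        hence "ereal (2 * R) < log_ratio (q x) (pt x)"
          using nonneg by (intro log_ratio_gt) (auto simp: G_def)
        hence "ereal (2 * R) \<le> \<bar>log_ratio (q x) (pt x)\<bar>"
          by (cases "log_ratio (q x) (pt x)") auto
        thus "ennreal (2 * R) \<le> e2ennreal \<bar>log_ratio (q x) (pt x)\<bar>"
          by (metis e2ennreal_mono e2ennreal_ereal)
      qed auto
      also note KL1
      finally show ?thesis using R by (simp add: fin flip: ennreal_mult)
    qed
    hence "P.prob (space \<mu> - G) \<le> 1 / 2" using R by (simp add: field_simps)
    moreover have "P.prob (space \<mu> - G) = 1 - P.prob G"
      using P.prob_compl[of G] by simp
    ultimately show False by linarith
  qed
  have b2: "P.prob E2 \<le> R powr (- (m / 2))"
  proof (rule deviation)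
    fix x assume "x \<in> E2"
    hence "ereal (3 * R + R) < log_ratio (q x) (pt x)"
      using nonneg by (intro log_ratio_gt) (auto simp: E2_def)
    thus "ennreal (R powr m) \<le> abs_powr (log_ratio (q x) (pt x) - KL \<mu> q pt) m"
      using centre R m by (intro abs_powr_diff_lower) auto
  qed (use V1 in \<open>auto simp: V_tilde_def\<close>)
  have "{x \<in> space \<mu>. pt x < exp (- (6 * R)) * p0 x} \<subseteq> E1 \<union> E2"
  proof
    fix x assume x: "x \<in> {x \<in> space \<mu>. pt x < exp (- (6 * R)) * p0 x}"
    have "x \<in> E2" if "x \<notin> E1"
    proof -
      have "exp (- (4 * R)) * (exp (- (2 * R)) * p0 x) \<le> exp (- (4 * R)) * q x"
        using that x by (intro mult_left_mono) (auto simp: E1_def)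
      moreover have "exp (- (4 * R)) * (exp (- (2 * R)) * p0 x) = exp (- (6 * R)) * p0 x"
        by (simp flip: exp_add mult.assoc)
      ultimately show ?thesis using x by (auto simp: E2_def)
    qed
    thus "x \<in> E1 \<union> E2" by blast
  qed
  hence "P.prob {x \<in> space \<mu>. pt x < exp (- (6 * R)) * p0 x} \<le> P.prob (E1 \<union> E2)"
    by (intro P.finite_measure_mono) auto
  also have "\<dots> \<le> P.prob E1 + P.prob E2" by (intro measure_Un_le) auto
  also have "\<dots> \<le> 2 * R powr (- (m / 2))" using b1 b2 by simp
  finally show ?thesis unfolding fin by (rule ennreal_leI)
qed

section \<open>From the evidence to the expected posterior\<close>

lemma ennreal_inverse_antimono: "a \<le> b \<Longrightarrow> inverse b \<le> inverse (a::ennreal)"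
proof (cases "a = 0 \<or> b = \<top>")
  case False
  assume ab: "a \<le> b"
  obtain x y where xy: "a = ennreal x" "b = ennreal y" "0 \<le> x" "0 \<le> y"
    using False ab by (cases a; cases b) (auto simp: top_unique)
  hence "0 < x" "x \<le> y" using False ab by (auto simp: less_le)
  thus ?thesis unfolding xy by (simp add: inverse_ennreal ennreal_leI le_imp_inverse_le)
qed auto

text \<open>
  By Fubini, the expected mass of those \<open>y\<close> in \<open>A\<close> with a small likelihood is at most \<open>s\<close> times the mass of \<open>A\<close>.
  By Markov's inequality at least half of \<open>A\<close> has a large likelihood, outside an event of probability \<open>2 s\<close>.
\<close>

lemma evidence_lower_bound:
  fixes q :: "'y \<Rightarrow> 'x \<Rightarrow> real"
  assumes \<mu>: "sigma_finite_measure \<mu>" and \<nu>: "finite_measure \<nu>"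
    and A[measurable]: "A \<in> sets \<nu>" and v: "0 < measure \<nu> A"
    and q[measurable]: "(\<lambda>(y, x). q y x) \<in> borel_measurable (\<nu> \<Otimes>\<^sub>M \<mu>)"
    and p0[measurable]: "p0 \<in> borel_measurable \<mu>"
    and nonneg: "\<And>x. x \<in> space \<mu> \<Longrightarrow> 0 \<le> p0 x" "0 \<le> \<kappa>" "0 \<le> s"
    and small: "\<And>y. y \<in> A \<Longrightarrow>
      emeasure (density \<mu> (\<lambda>x. ennreal (p0 x))) {x \<in> space \<mu>. q y x < \<kappa> * p0 x} \<le> ennreal s"
  obtains E where "E \<in> sets \<mu>"
    "emeasure (density \<mu> (\<lambda>x. ennreal (p0 x))) (space \<mu> - E) \<le> ennreal (2 * s)"
    "\<And>x. x \<in> E \<Longrightarrow> ennreal (\<kappa> * p0 x * measure \<nu> A / 2) \<le> (\<integral>\<^sup>+y\<in>A. ennreal (q y x) \<partial>\<nu>)"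
proof -
  let ?P = "density \<mu> (\<lambda>x. ennreal (p0 x))"
  let ?S = "\<lambda>y x. if q y x < \<kappa> * p0 x then 1 else (0::ennreal)"
  let ?v = "measure \<nu> A"
  interpret nu: finite_measure \<nu> by (rule \<nu>)
  interpret mu: sigma_finite_measure \<mu> by (rule \<mu>)
  interpret pr: pair_sigma_finite \<nu> \<mu> ..
  have [measurable]: "(\<lambda>x. q y x) \<in> borel_measurable \<mu>" if "y \<in> space \<nu>" for y
    using measurable_Pair2[OF q that] by simp
  have [measurable]: "(\<lambda>y. q y x) \<in> borel_measurable \<nu>" if "x \<in> space \<mu>" for x
    using measurable_Pair1[OF q that] by simp
  have Am: "y \<in> space \<nu>" if "y \<in> A" for y using sets.sets_into_space[OF A] that by auto
  have eA: "emeasure \<nu> A = ennreal ?v" by (rule nu.emeasure_eq_measure)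
  \<comment> \<open>the mass of those parameters in \<open>A\<close> whose likelihood is small\<close>
  define N where "N x = (\<integral>\<^sup>+y. ?S y x * indicator A y \<partial>\<nu>)" for x
  have [measurable]: "N \<in> borel_measurable \<mu>" unfolding N_def by measurable
  define E where "E = {x \<in> space \<mu>. N x \<le> ennreal (?v / 2)}"
  have E[measurable]: "E \<in> sets \<mu>" unfolding E_def by measurable
  have "(\<integral>\<^sup>+x. ennreal (p0 x) * N x \<partial>\<mu>) = (\<integral>\<^sup>+x. (\<integral>\<^sup>+y. ennreal (p0 x) * (?S y x * indicator A y) \<partial>\<nu>) \<partial>\<mu>)"
    unfolding N_def by (intro nn_integral_cong) (subst nn_integral_cmult; simp)
  also have "\<dots> = (\<integral>\<^sup>+y. (\<integral>\<^sup>+x. ennreal (p0 x) * (?S y x * indicator A y) \<partial>\<mu>) \<partial>\<nu>)"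
    by (rule pr.Fubini') measurable
  also have "\<dots> \<le> (\<integral>\<^sup>+y. ennreal s * indicator A y \<partial>\<nu>)"
  proof (intro nn_integral_mono)
    fix y assume y: "y \<in> space \<nu>"
    show "(\<integral>\<^sup>+x. ennreal (p0 x) * (?S y x * indicator A y) \<partial>\<mu>) \<le> ennreal s * indicator A y"
    proof (cases "y \<in> A")
      case True
      have "(\<integral>\<^sup>+x. ennreal (p0 x) * (?S y x * indicator A y) \<partial>\<mu>)
          = (\<integral>\<^sup>+x. ennreal (p0 x) * indicator {x \<in> space \<mu>. q y x < \<kappa> * p0 x} x \<partial>\<mu>)"
        using True by (intro nn_integral_cong) (auto split: split_indicator)
      also have "\<dots> = emeasure ?P {x \<in> space \<mu>. q y x < \<kappa> * p0 x}"
        using y by (subst emeasure_density) auto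
      finally show ?thesis using small[OF True] True by simp
    qed simp
  qed
  also have "\<dots> = ennreal (s * ?v)" using eA nonneg by (simp add: nn_integral_cmult ennreal_mult)
  finally have EN: "(\<integral>\<^sup>+x. ennreal (p0 x) * N x \<partial>\<mu>) \<le> ennreal (s * ?v)" .
  have "ennreal (?v / 2) * emeasure ?P (space \<mu> - E) = (\<integral>\<^sup>+x. ennreal (?v / 2) * (ennreal (p0 x) * indicator (space \<mu> - E) x) \<partial>\<mu>)"
    by (simp add: emeasure_density nn_integral_cmult)
  also have "\<dots> \<le> (\<integral>\<^sup>+x. ennreal (p0 x) * N x \<partial>\<mu>)"
    by (intro nn_integral_mono) (auto split: split_indicator simp: E_def mult.commute[of "ennreal (?v / 2)"] intro!: mult_left_mono)
  also note EN
  finally have "ennreal (2 / ?v) * (ennreal (?v / 2) * emeasure ?P (space \<mu> - E)) \<le> ennreal (2 / ?v) * ennreal (s * ?v)"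
    by (rule mult_left_mono) simp
  hence 1: "emeasure ?P (space \<mu> - E) \<le> ennreal (2 * s)"
    using v nonneg by (simp flip: ennreal_mult mult.assoc)
  have 2: "ennreal (\<kappa> * p0 x * ?v / 2) \<le> (\<integral>\<^sup>+y\<in>A. ennreal (q y x) \<partial>\<nu>)" if "x \<in> E" for x
  proof -
    have x: "x \<in> space \<mu>" "N x \<le> ennreal (?v / 2)" using that by (auto simp: E_def)
    note [measurable] = x(1)
    let ?k = "\<kappa> * p0 x"
    have k: "0 \<le> ?k" using nonneg x by simp
    have "ennreal ?v = (\<integral>\<^sup>+y. indicator A y \<partial>\<nu>)" by (simp add: eA)
    also have "\<dots> = (\<integral>\<^sup>+y. ?S y x * indicator A y + (1 - ?S y x) * indicator A y \<partial>\<nu>)"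
      by (intro nn_integral_cong) (auto split: split_indicator)
    also have "\<dots> = N x + (\<integral>\<^sup>+y. (1 - ?S y x) * indicator A y \<partial>\<nu>)"
      unfolding N_def using x by (intro nn_integral_add) measurable
    finally have "ennreal ?v \<le> ennreal (?v / 2) + (\<integral>\<^sup>+y. (1 - ?S y x) * indicator A y \<partial>\<nu>)"
      using x(2) by (simp add: add_right_mono)
    hence "ennreal ?v - ennreal (?v / 2) \<le> (\<integral>\<^sup>+y. (1 - ?S y x) * indicator A y \<partial>\<nu>)"
      by (simp add: ennreal_minus_le_iff)
    hence "ennreal (?v / 2) \<le> (\<integral>\<^sup>+y. (1 - ?S y x) * indicator A y \<partial>\<nu>)"
      by (simp add: ennreal_minus)
    hence "ennreal ?k * ennreal (?v / 2) \<le> ennreal ?k * (\<integral>\<^sup>+y. (1 - ?S y x) * indicator A y \<partial>\<nu>)"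
      by (rule mult_left_mono) simp
    also have "\<dots> = (\<integral>\<^sup>+y. ennreal ?k * ((1 - ?S y x) * indicator A y) \<partial>\<nu>)"
      using x by (subst nn_integral_cmult) auto
    also have "\<dots> \<le> (\<integral>\<^sup>+y\<in>A. ennreal (q y x) \<partial>\<nu>)"
      by (intro nn_integral_mono) (auto split: split_indicator intro!: ennreal_leI)
    finally show ?thesis using k by (simp flip: ennreal_mult)
  qed
  show ?thesis by (rule that[OF E 1 2])
qed

lemma posterior_le_1: "B \<in> sets Pr \<Longrightarrow> posterior Pr p B x \<le> 1"
proof -
  let ?n = "\<integral>\<^sup>+\<theta>\<in>B. ennreal (p \<theta> x) \<partial>Pr" and ?d = "\<integral>\<^sup>+\<theta>. ennreal (p \<theta> x) \<partial>Pr"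
  have "?n \<le> ?d" by (intro nn_integral_mono) (auto split: split_indicator)
  hence "posterior Pr p B x \<le> ?d / ?d" unfolding posterior_def by (rule divide_right_mono_ennreal)
  also have "\<dots> \<le> 1"
  proof (cases "?d = 0 \<or> ?d = \<top>")
    case True
    thus ?thesis by (elim disjE) (simp_all only: ennreal_divide_top ennreal_zero_divide zero_le)
  next
    case False
    hence "?d / ?d = 1" by (intro ennreal_divide_self) (simp_all add: less_top)
    thus ?thesis by simp
  qed
  finally show ?thesis .
qed

text \<open>
  Split \<open>1 = \<Phi> + (1 - \<Phi>)\<close>. Where \<open>\<Phi>\<close> or the complement of \<open>E\<close> is charged, the posterior is at most 1. On \<open>E\<close> the
  evidence is at least \<open>e p0\<close>, which cancels the true density, and Fubini turns the remaining term
  into an average of errors of the second kind.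
\<close>

lemma expected_posterior_le:
  fixes p :: "param \<Rightarrow> 'x \<Rightarrow> real"
  assumes \<mu>: "sigma_finite_measure \<mu>" and Pr: "sigma_finite_measure Pr"
    and p[measurable]: "(\<lambda>(\<theta>, x). p \<theta> x) \<in> borel_measurable (Pr \<Otimes>\<^sub>M \<mu>)"
    and p0[measurable]: "p0 \<in> borel_measurable \<mu>"
    and nonneg: "\<And>x. x \<in> space \<mu> \<Longrightarrow> 0 \<le> p0 x"
    and B[measurable]: "B \<in> sets Pr"
    and \<Phi>[measurable]: "\<Phi> \<in> borel_measurable \<mu>" and \<Phi>01: "\<And>x. x \<in> space \<mu> \<Longrightarrow> 0 \<le> \<Phi> x \<and> \<Phi> x \<le> 1"
    and E[measurable]: "E \<in> sets \<mu>" and e: "0 < e"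
    and evidence: "\<And>x. x \<in> E \<Longrightarrow> ennreal (e * p0 x) \<le> (\<integral>\<^sup>+\<theta>. ennreal (p \<theta> x) \<partial>Pr)"
  shows "(\<integral>\<^sup>+x. posterior Pr p B x \<partial>density \<mu> (\<lambda>x. ennreal (p0 x)))
    \<le> (\<integral>\<^sup>+x. ennreal (p0 x) * ennreal (\<Phi> x) \<partial>\<mu>)
      + emeasure (density \<mu> (\<lambda>x. ennreal (p0 x))) (space \<mu> - E)
      + ennreal (1 / e) * (\<integral>\<^sup>+\<theta>\<in>B. (\<integral>\<^sup>+x. ennreal (1 - \<Phi> x) * ennreal (p \<theta> x) \<partial>\<mu>) \<partial>Pr)"
proof -
  interpret mu: sigma_finite_measure \<mu> by (rule \<mu>)
  interpret nu: sigma_finite_measure Pr by (rule Pr)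
  interpret pr: pair_sigma_finite Pr \<mu> ..
  have [measurable]: "(\<lambda>x. p y x) \<in> borel_measurable \<mu>" if "y \<in> space Pr" for y
    using measurable_Pair2[OF p that] by simp
  have [measurable]: "(\<lambda>y. p y x) \<in> borel_measurable Pr" if "x \<in> space \<mu>" for x
    using measurable_Pair1[OF p that] by simp
  let ?n = "\<lambda>x. \<integral>\<^sup>+\<theta>\<in>B. ennreal (p \<theta> x) \<partial>Pr"
  let ?d = "\<lambda>x. \<integral>\<^sup>+\<theta>. ennreal (p \<theta> x) \<partial>Pr"
  have pm: "(\<lambda>x. posterior Pr p B x) \<in> borel_measurable \<mu>" unfolding posterior_def by measurable
  have pw: "ennreal (p0 x) * posterior Pr p B x \<le> ennreal (p0 x) * ennreal (\<Phi> x)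
      + ennreal (p0 x) * indicator (space \<mu> - E) x
      + ennreal (1 / e) * (ennreal (1 - \<Phi> x) * ?n x)" if x: "x \<in> space \<mu>" for x
  proof (cases "x \<in> E \<and> p0 x \<noteq> 0")
    case False
    have "ennreal (p0 x) * posterior Pr p B x \<le> ennreal (p0 x) * 1"
      by (intro mult_left_mono posterior_le_1) auto
    also have "\<dots> = ennreal (p0 x) * indicator (space \<mu> - E) x" using False x by auto
    also have "\<dots> \<le> ennreal (p0 x) * ennreal (\<Phi> x) + \<dots> + ennreal (1 / e) * (ennreal (1 - \<Phi> x) * ?n x)"
      by (intro add_increasing2 add_increasing order.refl) simp_all
    finally show ?thesis .
  next
    case True
    hence p0: "0 < p0 x" using nonneg[OF x] by simp
    have ev: "ennreal (e * p0 x) \<le> ?d x" using evidence True by blast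
    have "posterior Pr p B x = ennreal (\<Phi> x) * posterior Pr p B x + ennreal (1 - \<Phi> x) * posterior Pr p B x"
      using \<Phi>01[OF x] by (simp flip: distrib_right ennreal_plus)
    also have "\<dots> \<le> ennreal (\<Phi> x) * 1 + ennreal (1 - \<Phi> x) * (?n x / ennreal (e * p0 x))"
    proof (intro add_mono mult_left_mono posterior_le_1)
      show "posterior Pr p B x \<le> ?n x / ennreal (e * p0 x)"
        unfolding posterior_def divide_ennreal_def
        using ev by (intro mult_left_mono ennreal_inverse_antimono) auto
    qed auto
    finally have "ennreal (p0 x) * posterior Pr p B x
        \<le> ennreal (p0 x) * (ennreal (\<Phi> x) * 1 + ennreal (1 - \<Phi> x) * (?n x / ennreal (e * p0 x)))"
      by (rule mult_left_mono) simp
    also have "\<dots> = ennreal (p0 x) * ennreal (\<Phi> x) + (ennreal (p0 x) * ennreal (1 / (e * p0 x))) * (ennreal (1 - \<Phi> x) * ?n x)"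
      using p0 e by (simp add: divide_ennreal_def inverse_ennreal distrib_left mult_ac inverse_eq_divide)
    also have "ennreal (p0 x) * ennreal (1 / (e * p0 x)) = ennreal (1 / e)"
      using p0 e by (simp flip: ennreal_mult)
    finally show ?thesis
      by (rule order.trans) (intro add_mono add_increasing2 order.refl; simp)
  qed
  have swap: "(\<integral>\<^sup>+x. ennreal (1 - \<Phi> x) * ?n x \<partial>\<mu>)
    = (\<integral>\<^sup>+\<theta>\<in>B. (\<integral>\<^sup>+x. ennreal (1 - \<Phi> x) * ennreal (p \<theta> x) \<partial>\<mu>) \<partial>Pr)"
  proof -
    have "(\<integral>\<^sup>+x. ennreal (1 - \<Phi> x) * ?n x \<partial>\<mu>)
      = (\<integral>\<^sup>+x. (\<integral>\<^sup>+\<theta>. ennreal (1 - \<Phi> x) * (ennreal (p \<theta> x) * indicator B \<theta>) \<partial>Pr) \<partial>\<mu>)"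
      by (intro nn_integral_cong) (subst nn_integral_cmult; simp)
    also have "\<dots> = (\<integral>\<^sup>+\<theta>. (\<integral>\<^sup>+x. ennreal (1 - \<Phi> x) * (ennreal (p \<theta> x) * indicator B \<theta>) \<partial>\<mu>) \<partial>Pr)"
      by (rule pr.Fubini') measurable
    also have "\<dots> = (\<integral>\<^sup>+\<theta>\<in>B. (\<integral>\<^sup>+x. ennreal (1 - \<Phi> x) * ennreal (p \<theta> x) \<partial>\<mu>) \<partial>Pr)"
      by (intro nn_integral_cong) (auto simp: mult.assoc[symmetric] nn_integral_multc)
    finally show ?thesis .
  qed
  have "(\<integral>\<^sup>+x. posterior Pr p B x \<partial>density \<mu> (\<lambda>x. ennreal (p0 x)))
      = (\<integral>\<^sup>+x. ennreal (p0 x) * posterior Pr p B x \<partial>\<mu>)"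
    using pm by (intro nn_integral_density) auto
  also have "\<dots> \<le> (\<integral>\<^sup>+x. ennreal (p0 x) * ennreal (\<Phi> x)
      + ennreal (p0 x) * indicator (space \<mu> - E) x
      + ennreal (1 / e) * (ennreal (1 - \<Phi> x) * ?n x) \<partial>\<mu>)"
    by (intro nn_integral_mono pw)
  also have "\<dots> = (\<integral>\<^sup>+x. ennreal (p0 x) * ennreal (\<Phi> x) \<partial>\<mu>)
      + (\<integral>\<^sup>+x. ennreal (p0 x) * indicator (space \<mu> - E) x \<partial>\<mu>)
      + ennreal (1 / e) * (\<integral>\<^sup>+x. ennreal (1 - \<Phi> x) * ?n x \<partial>\<mu>)"
    by (simp add: nn_integral_add nn_integral_cmult)
  finally show ?thesis by (simp add: swap emeasure_density)
qed

section \<open>The sieve prior\<close>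

lemma measurable_sum_coordinates:
  fixes f :: "real \<Rightarrow> real"
  assumes "f \<in> borel_measurable borel"
  shows "(\<lambda>x. \<Sum>j<k. f (x j)) \<in> borel_measurable (PiM {..<k::nat} (\<lambda>_. lborel :: real measure))"
  using assms by (intro borel_measurable_sum measurable_compose[OF measurable_component_singleton]) auto

lemma measurable_L2_set_coordinates:
  "(\<lambda>x. L2_set x {..<k}) \<in> borel_measurable (PiM {..<k::nat} (\<lambda>_. lborel :: real measure))"
  unfolding L2_set_def
  by (intro measurable_compose[OF _ borel_measurable_sqrt] measurable_sum_coordinates[where f = "\<lambda>t. t\<^sup>2"])
    simp

text \<open>
  The component of the prior on \<open>\<real>\<^sup>k\<close>, before normalisation and before \<open>\<real>\<^sup>k\<close> is embedded in the parameter set. Balls and boxes are measurable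
  in \<open>\<real>\<^sup>k\<close>, whereas their images need not belong to the \<open>\<sigma>\<close>-field on the parameter set; all estimates of
  prior masses are therefore made here.
\<close>

definition product_density :: "(real \<Rightarrow> real) \<Rightarrow> (nat \<Rightarrow> real) \<Rightarrow> ereal \<Rightarrow> nat \<Rightarrow> param measure" where
  "product_density g \<tau> r k = density (PiM {..<k} (\<lambda>_. lborel))
     (\<lambda>x. ennreal (\<Prod>j<k. g (x j / \<tau> j) / \<tau> j) * indicator {x. ereal (\<Sum>j<k. \<bar>x j\<bar>) \<le> r} x)"

definition coordinate_prior :: "(real \<Rightarrow> real) \<Rightarrow> (nat \<Rightarrow> real) \<Rightarrow> ereal \<Rightarrow> nat \<Rightarrow> param measure" where
  "coordinate_prior g \<tau> r k = scale_measure
     (inverse (emeasure (product_density g \<tau> r k) (space (product_density g \<tau> r k))))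
     (product_density g \<tau> r k)"

lemma prior_component_eq_distr:
  "prior_component T g \<tau> r k = distr (coordinate_prior g \<tau> r k) T (trunc k)"
  by (simp add: prior_component_def coordinate_prior_def product_density_def Let_def)

lemma sets_product_density [measurable_cong]:
  "sets (product_density g \<tau> r k) = sets (PiM {..<k} (\<lambda>_. lborel))"
  by (simp add: product_density_def)

lemma sets_coordinate_prior [measurable_cong]:
  "sets (coordinate_prior g \<tau> r k) = sets (PiM {..<k} (\<lambda>_. lborel))"
  by (simp add: coordinate_prior_def sets_product_density)

lemma space_coordinate_prior:
  "space (coordinate_prior g \<tau> r k) = space (PiM {..<k} (\<lambda>_. lborel :: real measure))"
  by (rule sets_eq_imp_space_eq) (rule sets_coordinate_prior)

lemma emeasure_coordinate_prior:
  "emeasure (coordinate_prior g \<tau> r k) A =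
    inverse (emeasure (product_density g \<tau> r k) (space (product_density g \<tau> r k)))
      * emeasure (product_density g \<tau> r k) A"
  by (simp add: coordinate_prior_def)

lemma coordinate_prior_le_1:
  "emeasure (coordinate_prior g \<tau> r k) (space (coordinate_prior g \<tau> r k)) \<le> 1"
proof -
  let ?D = "product_density g \<tau> r k"
  have s: "space (coordinate_prior g \<tau> r k) = space ?D"
    by (simp add: coordinate_prior_def space_scale_measure)
  let ?e = "emeasure ?D (space ?D)"
  show ?thesis
  proof (cases "?e = 0 \<or> ?e = \<top>")
    case True
    thus ?thesis unfolding emeasure_coordinate_prior s by auto
  next
    case False
    hence "?e / ?e = 1" by (intro ennreal_divide_self) (simp_all add: less_top)
    thus ?thesis unfolding emeasure_coordinate_prior s by (simp add: divide_ennreal_def mult.commute)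
  qed
qed

context
  fixes g :: "real \<Rightarrow> real" and \<tau> :: "nat \<Rightarrow> real"
  assumes g[measurable]: "g \<in> borel_measurable borel" and g_nonneg: "\<And>t. 0 \<le> g t"
    and g_prob: "(\<integral>\<^sup>+t. ennreal (g t) \<partial>lborel) = 1" and \<tau>: "\<And>j. 0 < \<tau> j"
begin

lemma scaled_density_integral:
  assumes [measurable]: "f \<in> borel_measurable borel" and "0 < s"
  shows "(\<integral>\<^sup>+t. ennreal (g (t / s) / s) * f (t / s) \<partial>lborel) = (\<integral>\<^sup>+t. ennreal (g t) * f t \<partial>lborel)"
proof -
  have "(\<integral>\<^sup>+t. ennreal (g t) * f t \<partial>lborel) = \<bar>1 / s\<bar> * (\<integral>\<^sup>+t. ennreal (g (0 + 1 / s * t)) * f (0 + 1 / s * t) \<partial>lborel)"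
    using assms by (intro nn_integral_real_affine) auto
  also have "\<dots> = (\<integral>\<^sup>+t. \<bar>1 / s\<bar> * (ennreal (g (t / s)) * f (t / s)) \<partial>lborel)"
    by (subst nn_integral_cmult) auto
  also have "\<dots> = (\<integral>\<^sup>+t. ennreal (g (t / s) / s) * f (t / s) \<partial>lborel)"
    using assms(2) by (intro nn_integral_cong) (simp add: mult.assoc[symmetric] g_nonneg flip: ennreal_mult)
  finally show ?thesis by simp
qed

lemma product_density_measurable [measurable]:
  "(\<lambda>x. ennreal (\<Prod>j<k. g (x j / \<tau> j) / \<tau> j) * indicator {x. ereal (\<Sum>j<k. \<bar>x j\<bar>) \<le> r} x)
    \<in> borel_measurable (PiM {..<k} (\<lambda>_. lborel))"
proof -
  have [measurable]: "(\<lambda>x. x j) \<in> borel_measurable (PiM {..<k} (\<lambda>_. lborel))" if "j \<in> {..<k}" for j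
    using measurable_component_singleton[OF that, of "\<lambda>_. lborel"] by simp
  have 1: "(\<lambda>x. \<Prod>j<k. g (x j / \<tau> j) / \<tau> j) \<in> borel_measurable (PiM {..<k} (\<lambda>_. lborel))"
    by (intro borel_measurable_prod) measurable
  have 2: "(\<lambda>x. \<Sum>j<k. \<bar>x j\<bar>) \<in> borel_measurable (PiM {..<k} (\<lambda>_. lborel :: real measure))"
    by (rule measurable_sum_coordinates[where f = abs]) simp
  note [measurable] = 1 2
  show ?thesis unfolding indicator_def mem_Collect_eq by measurable
qed

text \<open>
  Dropping the truncation leaves a product, so that an event constraining one coordinate is
  estimated by a one-dimensional integral.
\<close>

lemma product_density_le_prod:
  assumes "A \<in> sets (PiM {..<k} (\<lambda>_. lborel))" "\<And>i. i < k \<Longrightarrow> f i \<in> borel_measurable borel"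
    and "\<And>x. x \<in> A \<Longrightarrow> 1 \<le> (\<Prod>i<k. f i (x i))"
  shows "emeasure (product_density g \<tau> r k) A
    \<le> (\<Prod>i<k. \<integral>\<^sup>+t. ennreal (g (t / \<tau> i) / \<tau> i) * f i t \<partial>lborel)"
proof -
  interpret product_sigma_finite "\<lambda>_::nat. lborel :: real measure" ..
  have "emeasure (product_density g \<tau> r k) A
    = (\<integral>\<^sup>+x. ennreal (\<Prod>j<k. g (x j / \<tau> j) / \<tau> j) * indicator {x. ereal (\<Sum>j<k. \<bar>x j\<bar>) \<le> r} x * indicator A x
        \<partial>PiM {..<k} (\<lambda>_. lborel))"
    unfolding product_density_def using assms(1) by (subst emeasure_density) auto
  also have "\<dots> \<le> (\<integral>\<^sup>+x. (\<Prod>i<k. ennreal (g (x i / \<tau> i) / \<tau> i) * f i (x i)) \<partial>PiM {..<k} (\<lambda>_. lborel))"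
  proof (intro nn_integral_mono)
    fix x
    have e: "ennreal (\<Prod>j<k. g (x j / \<tau> j) / \<tau> j) = (\<Prod>j<k. ennreal (g (x j / \<tau> j) / \<tau> j))"
      using g_nonneg \<tau> by (subst prod_ennreal) (auto intro!: divide_nonneg_nonneg simp: less_imp_le)
    have "ennreal (\<Prod>j<k. g (x j / \<tau> j) / \<tau> j) * indicator A x
        \<le> ennreal (\<Prod>j<k. g (x j / \<tau> j) / \<tau> j) * (\<Prod>i<k. f i (x i))"
      using assms(3) by (intro mult_left_mono) (auto split: split_indicator)
    also have "\<dots> = (\<Prod>i<k. ennreal (g (x i / \<tau> i) / \<tau> i) * f i (x i))"
      unfolding e prod.distrib ..
    finally show "ennreal (\<Prod>j<k. g (x j / \<tau> j) / \<tau> j) * indicator {x. ereal (\<Sum>j<k. \<bar>x j\<bar>) \<le> r} x * indicator A x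
      \<le> (\<Prod>i<k. ennreal (g (x i / \<tau> i) / \<tau> i) * f i (x i))"
      by (auto split: split_indicator)
  qed
  also have "\<dots> = (\<Prod>i<k. \<integral>\<^sup>+t. ennreal (g (t / \<tau> i) / \<tau> i) * f i t \<partial>lborel)"
    using assms(2) by (intro product_nn_integral_prod) auto
  finally show ?thesis .
qed

lemma scaled_density_prob: "0 < s \<Longrightarrow> (\<integral>\<^sup>+t. ennreal (g (t / s) / s) \<partial>lborel) = 1"
  using scaled_density_integral[of "\<lambda>_. 1" s] g_prob by simp

lemma product_density_le_1:
  "emeasure (product_density g \<tau> r k) (space (product_density g \<tau> r k)) \<le> 1"
proof -
  have "emeasure (product_density g \<tau> r k) (space (product_density g \<tau> r k))
    \<le> (\<Prod>i<k. \<integral>\<^sup>+t. ennreal (g (t / \<tau> i) / \<tau> i) * 1 \<partial>lborel)"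
    using sets.top[of "product_density g \<tau> r k"]
    by (intro product_density_le_prod) (auto simp: sets_product_density)
  thus ?thesis using \<tau> by (simp add: scaled_density_prob)
qed

lemma product_density_untruncated:
  "emeasure (product_density g \<tau> \<infinity> k) (space (product_density g \<tau> \<infinity> k)) = 1"
proof -
  interpret product_sigma_finite "\<lambda>_::nat. lborel :: real measure" ..
  have "emeasure (product_density g \<tau> \<infinity> k) (space (product_density g \<tau> \<infinity> k))
    = (\<integral>\<^sup>+x. ennreal (\<Prod>j<k. g (x j / \<tau> j) / \<tau> j) * indicator {x. ereal (\<Sum>j<k. \<bar>x j\<bar>) \<le> \<infinity>} x
        * indicator (space (PiM {..<k} (\<lambda>_. lborel))) x \<partial>PiM {..<k} (\<lambda>_. lborel))"
    unfolding product_density_def by (subst emeasure_density) auto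
  also have "\<dots> = (\<integral>\<^sup>+x. (\<Prod>i<k. ennreal (g (x i / \<tau> i) / \<tau> i)) \<partial>PiM {..<k} (\<lambda>_. lborel))"
    using g_nonneg \<tau> by (intro nn_integral_cong)
      (subst prod_ennreal, auto intro!: divide_nonneg_nonneg simp: less_imp_le)
  also have "\<dots> = (\<Prod>i<k. \<integral>\<^sup>+t. ennreal (g (t / \<tau> i) / \<tau> i) \<partial>lborel)"
    by (intro product_nn_integral_prod) auto
  finally show ?thesis using \<tau> by (simp add: scaled_density_prob)
qed

text \<open>
  Truncation only removes mass, so normalising increases the measure: lower bounds for prior masses
  may ignore the normalising factor.
\<close>

lemma product_density_le_coordinate_prior:
  "emeasure (product_density g \<tau> r k) A \<le> emeasure (coordinate_prior g \<tau> r k) A"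
proof -
  have "1 \<le> inverse (emeasure (product_density g \<tau> r k) (space (product_density g \<tau> r k)))"
    using ennreal_inverse_antimono[OF product_density_le_1] by simp
  hence "1 * emeasure (product_density g \<tau> r k) A \<le> emeasure (coordinate_prior g \<tau> r k) A"
    unfolding emeasure_coordinate_prior by (rule mult_right_mono) simp
  thus ?thesis by simp
qed

lemma coordinate_prior_box:
  assumes "\<And>i. i < k \<Longrightarrow> 0 \<le> w i" "0 \<le> \<delta>"
    and "\<And>i t. i < k \<Longrightarrow> \<bar>t - c i\<bar> \<le> \<delta> \<Longrightarrow> w i \<le> g (t / \<tau> i) / \<tau> i"
    and "\<And>x. (\<And>i. i < k \<Longrightarrow> \<bar>x i - c i\<bar> \<le> \<delta>) \<Longrightarrow> ereal (\<Sum>i<k. \<bar>x i\<bar>) \<le> r"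
  shows "ennreal (\<Prod>i<k. w i * (2 * \<delta>))
    \<le> emeasure (coordinate_prior g \<tau> r k) (PiE {..<k} (\<lambda>i. {c i - \<delta>..c i + \<delta>}))"
proof -
  interpret product_sigma_finite "\<lambda>_::nat. lborel :: real measure" ..
  let ?A = "PiE {..<k} (\<lambda>i. {c i - \<delta>..c i + \<delta>})"
  have A: "?A \<in> sets (PiM {..<k} (\<lambda>_. lborel))" by (intro sets_PiM_I_finite) auto
  have "ennreal (\<Prod>i<k. w i * (2 * \<delta>)) = (\<Prod>i<k. \<integral>\<^sup>+t. ennreal (w i) * indicator {c i - \<delta>..c i + \<delta>} t \<partial>lborel)"
    using assms(1,2) by (subst prod_ennreal[symmetric]) (auto simp: nn_integral_cmult ennreal_mult intro!: prod.cong)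
  also have "\<dots> = (\<integral>\<^sup>+x. (\<Prod>i<k. ennreal (w i) * indicator {c i - \<delta>..c i + \<delta>} (x i)) \<partial>PiM {..<k} (\<lambda>_. lborel))"
    by (intro product_nn_integral_prod[symmetric]) auto
  also have "\<dots> \<le> (\<integral>\<^sup>+x. ennreal (\<Prod>j<k. g (x j / \<tau> j) / \<tau> j) * indicator {x. ereal (\<Sum>j<k. \<bar>x j\<bar>) \<le> r} x * indicator ?A x
        \<partial>PiM {..<k} (\<lambda>_. lborel))"
  proof (intro nn_integral_mono)
    fix x assume x: "x \<in> space (PiM {..<k} (\<lambda>_. lborel :: real measure))"
    show "(\<Prod>i<k. ennreal (w i) * indicator {c i - \<delta>..c i + \<delta>} (x i))
      \<le> ennreal (\<Prod>j<k. g (x j / \<tau> j) / \<tau> j) * indicator {x. ereal (\<Sum>j<k. \<bar>x j\<bar>) \<le> r} x * indicator ?A x"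
    proof (cases "\<forall>i<k. x i \<in> {c i - \<delta>..c i + \<delta>}")
      case True
      hence xA: "x \<in> ?A" using x by (auto simp: space_PiM PiE_iff)
      have b: "\<bar>x i - c i\<bar> \<le> \<delta>" if "i < k" for i using True that by (auto simp: abs_le_iff algebra_simps)
      have "(\<Prod>i<k. ennreal (w i) * indicator {c i - \<delta>..c i + \<delta>} (x i)) = ennreal (\<Prod>i<k. w i)"
        using True assms(1) by (subst prod_ennreal[symmetric]) (auto intro!: prod.cong)
      also have "\<dots> \<le> ennreal (\<Prod>j<k. g (x j / \<tau> j) / \<tau> j)"
        using assms(1,3) b by (intro ennreal_leI prod_mono) auto
      finally show ?thesis using xA assms(4)[of x] b by simp
    next
      case False
      then obtain i where "i < k" "x i \<notin> {c i - \<delta>..c i + \<delta>}" by blast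
      hence "(\<Prod>i<k. ennreal (w i) * indicator {c i - \<delta>..c i + \<delta>} (x i)) = 0"
        by (intro prod_zero finite_lessThan bexI[of _ i]) auto
      thus ?thesis by (simp only: zero_le)
    qed
  qed
  also have "\<dots> = emeasure (product_density g \<tau> r k) ?A"
    unfolding product_density_def using A by (subst emeasure_density) auto
  also note product_density_le_coordinate_prior
  finally show ?thesis .
qed

text \<open>
  Half of the exponent gives the decay. The other half is integrated by rescaling until its
  constant is \<open>G2\<close>; then \<open>exp (- G2 \<bar>x\<bar> powr \<alpha>) \<le> g x / G1\<close>, and \<open>g\<close> has integral 1.
\<close>

lemma scaled_density_tail:
  assumes "0 < G1" "0 < G2" "0 < G3" "0 < G4" "0 < \<alpha>" "0 < s" "s \<le> \<tau>0" "0 \<le> t"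
    and g_bounds: "\<And>x. G1 * exp (- G2 * \<bar>x\<bar> powr \<alpha>) \<le> g x" "\<And>x. g x \<le> G3 * exp (- G4 * \<bar>x\<bar> powr \<alpha>)"
  shows "(\<integral>\<^sup>+x. ennreal (g (x / s) / s) * indicator {x. t < \<bar>x\<bar>} x \<partial>lborel)
    \<le> ennreal (G3 * exp (- (G4 / 2) * (t / \<tau>0) powr \<alpha>) * ((2 * G2 / G4) powr (1 / \<alpha>) / G1))"
proof -
  define \<sigma> where "\<sigma> = (2 * G2 / G4) powr (1 / \<alpha>)"
  have \<sigma>: "0 < \<sigma>" using assms by (simp add: \<sigma>_def)
  have \<sigma>\<alpha>: "G4 / 2 * \<sigma> powr \<alpha> = G2" using assms by (simp add: \<sigma>_def powr_powr)
  define K where "K = G3 * exp (- (G4 / 2) * (t / \<tau>0) powr \<alpha>)"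
  have K: "0 < K" using assms by (simp add: K_def)
  have "(\<integral>\<^sup>+x. ennreal (g (x / s) / s) * indicator {x. t < \<bar>x\<bar>} x \<partial>lborel)
      = (\<integral>\<^sup>+x. ennreal (g (x / s) / s) * indicator {x. t / s < \<bar>x\<bar>} (x / s) \<partial>lborel)"
    using assms by (intro nn_integral_cong) (auto split: split_indicator simp: divide_simps)
  also have "\<dots> = (\<integral>\<^sup>+x. ennreal (g x) * indicator {x. t / s < \<bar>x\<bar>} x \<partial>lborel)"
    by (rule scaled_density_integral) (use assms in auto)
  also have "\<dots> \<le> (\<integral>\<^sup>+x. ennreal K * ennreal (exp (- (G4 / 2) * \<bar>x\<bar> powr \<alpha>)) \<partial>lborel)"
  proof (intro nn_integral_mono)
    fix x :: real
    have "g x \<le> K * exp (- (G4 / 2) * \<bar>x\<bar> powr \<alpha>)" if "t / s < \<bar>x\<bar>"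
    proof -
      have "t / \<tau>0 \<le> t / s" using assms by (intro divide_left_mono) auto
      hence "(t / \<tau>0) powr \<alpha> \<le> \<bar>x\<bar> powr \<alpha>" using that assms by (intro powr_mono2) auto
      hence "G4 / 2 * (t / \<tau>0) powr \<alpha> \<le> G4 / 2 * \<bar>x\<bar> powr \<alpha>" using assms by (intro mult_left_mono) auto
      hence "G3 * exp (- G4 * \<bar>x\<bar> powr \<alpha>) \<le> G3 * exp (- (G4 / 2) * (t / \<tau>0) powr \<alpha> + - (G4 / 2) * \<bar>x\<bar> powr \<alpha>)"
        using assms by (intro mult_left_mono) (auto simp: field_simps)
      also have "\<dots> = K * exp (- (G4 / 2) * \<bar>x\<bar> powr \<alpha>)" by (simp only: exp_add K_def mult.assoc)
      finally show ?thesis using g_bounds(2)[of x] by linarith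
    qed
    thus "ennreal (g x) * indicator {x. t / s < \<bar>x\<bar>} x \<le> ennreal K * ennreal (exp (- (G4 / 2) * \<bar>x\<bar> powr \<alpha>))"
      using K by (auto split: split_indicator simp flip: ennreal_mult intro!: ennreal_leI)
  qed
  also have "\<dots> = ennreal K * (\<bar>\<sigma>\<bar> * (\<integral>\<^sup>+x. ennreal (exp (- (G4 / 2) * \<bar>0 + \<sigma> * x\<bar> powr \<alpha>)) \<partial>lborel))"
    using \<sigma> by (subst nn_integral_cmult, simp, subst nn_integral_real_affine[where c = \<sigma> and t = 0]) auto
  also have "(\<integral>\<^sup>+x. ennreal (exp (- (G4 / 2) * \<bar>0 + \<sigma> * x\<bar> powr \<alpha>)) \<partial>lborel)
      \<le> (\<integral>\<^sup>+x. ennreal (1 / G1) * ennreal (g x) \<partial>lborel)"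
  proof (intro nn_integral_mono)
    fix x :: real
    have "G4 / 2 * \<bar>0 + \<sigma> * x\<bar> powr \<alpha> = G2 * \<bar>x\<bar> powr \<alpha>"
      using \<sigma> \<sigma>\<alpha> by (simp add: abs_mult powr_mult flip: mult.assoc)
    hence "exp (- (G4 / 2) * \<bar>0 + \<sigma> * x\<bar> powr \<alpha>) \<le> 1 / G1 * g x"
      using g_bounds(1)[of x] assms by (simp add: field_simps)
    thus "ennreal (exp (- (G4 / 2) * \<bar>0 + \<sigma> * x\<bar> powr \<alpha>)) \<le> ennreal (1 / G1) * ennreal (g x)"
      using assms g_nonneg by (simp flip: ennreal_mult add: ennreal_leI)
  qed
  also have "\<dots> = ennreal (1 / G1)" by (simp add: nn_integral_cmult g_prob)
  finally have "(\<integral>\<^sup>+x. ennreal (g (x / s) / s) * indicator {x. t < \<bar>x\<bar>} x \<partial>lborel)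
      \<le> ennreal K * (ennreal \<bar>\<sigma>\<bar> * ennreal (1 / G1))"
    by (simp add: mult_left_mono)
  also have "\<dots> = ennreal (K * (\<sigma> / G1))" using K \<sigma> assms by (simp flip: ennreal_mult)
  finally show ?thesis unfolding K_def \<sigma>_def .
qed

text \<open>
  Without truncation the normalising factor is 1, and a norm above \<open>\<rho>\<close> forces some coordinate above
  \<open>\<rho> / k\<close>. With truncation at a level below \<open>\<rho>\<close> the event is empty.
\<close>

lemma coordinate_prior_tail:
  assumes tail: "\<And>i. i < k \<Longrightarrow> (\<integral>\<^sup>+x. ennreal (g (x / \<tau> i) / \<tau> i) * indicator {x. \<rho> / real k < \<bar>x\<bar>} x \<partial>lborel) \<le> ennreal q"
    and r: "r = \<infinity> \<or> r \<le> ereal \<rho>" and "0 \<le> q" "0 \<le> \<rho>"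
  shows "emeasure (coordinate_prior g \<tau> r k)
      {x \<in> space (coordinate_prior g \<tau> r k). \<rho> < L2_set x {..<k}} \<le> ennreal (real k * q)"
proof -
  let ?M = "PiM {..<k} (\<lambda>_. lborel) :: param measure"
  have [measurable]: "(\<lambda>x. x j) \<in> borel_measurable ?M" if "j \<in> {..<k}" for j
    using measurable_component_singleton[OF that, of "\<lambda>_. lborel"] by simp
  note [measurable] = measurable_L2_set_coordinates
  let ?A = "{x \<in> space ?M. \<rho> < L2_set x {..<k}}"
  have A: "?A \<in> sets ?M" by measurable
  have sA: "{x \<in> space (coordinate_prior g \<tau> r k). \<rho> < L2_set x {..<k}} = ?A"
    by (simp add: space_coordinate_prior)
  have le: "L2_set x {..<k} \<le> (\<Sum>j<k. \<bar>x j\<bar>)" for x by (rule L2_set_le_sum_abs)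
  show ?thesis
  proof (cases "r = \<infinity>")
    case True
    let ?Ai = "\<lambda>i. {x \<in> space ?M. \<rho> / real k < \<bar>x i\<bar>}"
    have "emeasure (coordinate_prior g \<tau> r k) ?A = emeasure (product_density g \<tau> r k) ?A"
      unfolding emeasure_coordinate_prior True product_density_untruncated by simp
    also have "\<dots> \<le> emeasure (product_density g \<tau> r k) (\<Union>i<k. ?Ai i)"
    proof (intro emeasure_mono)
      show "?A \<subseteq> (\<Union>i<k. ?Ai i)"
      proof (rule ccontr)
        assume "\<not> ?thesis"
        then obtain x where x: "x \<in> ?A" "\<And>i. i < k \<Longrightarrow> \<bar>x i\<bar> \<le> \<rho> / real k" by fastforce
        hence "(\<Sum>j<k. \<bar>x j\<bar>) \<le> (\<Sum>j<k. \<rho> / real k)" by (intro sum_mono) auto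
        also have "\<dots> \<le> \<rho>" using \<open>0 \<le> \<rho>\<close> by simp
        finally show False using le[of x] x by simp
      qed
    qed (auto simp: sets_product_density)
    also have "\<dots> \<le> (\<Sum>i<k. emeasure (product_density g \<tau> r k) (?Ai i))"
      by (intro emeasure_subadditive_finite) (auto simp: sets_product_density)
    also have "\<dots> \<le> (\<Sum>i<k. ennreal q)"
    proof (intro sum_mono)
      fix i assume i: "i \<in> {..<k}"
      \<comment> \<open>all coordinates other than \<open>i\<close> integrate to 1\<close>
      let ?f = "\<lambda>j t. if j = i then indicator {x. \<rho> / real k < \<bar>x\<bar>} t else (1::ennreal)"
      have "emeasure (product_density g \<tau> r k) (?Ai i) \<le> (\<Prod>j<k. \<integral>\<^sup>+t. ennreal (g (t / \<tau> j) / \<tau> j) * ?f j t \<partial>lborel)"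
      proof (intro product_density_le_prod)
        show "?Ai i \<in> sets ?M" using i by measurable
        show "?f j \<in> borel_measurable borel" for j by (cases "j = i") auto
        show "1 \<le> (\<Prod>j<k. ?f j (x j))" if "x \<in> ?Ai i" for x
          using that by (subst prod.neutral) auto
      qed
      also have "\<dots> = (\<Prod>j\<in>{..<k}. if j = i then \<integral>\<^sup>+x. ennreal (g (x / \<tau> i) / \<tau> i) * indicator {x. \<rho> / real k < \<bar>x\<bar>} x \<partial>lborel else 1)"
        using \<tau> by (intro prod.cong) (auto simp: scaled_density_prob)
      also have "\<dots> \<le> ennreal q" using i tail by simp
      finally show "emeasure (product_density g \<tau> r k) (?Ai i) \<le> ennreal q" .
    qed
    finally show ?thesis unfolding sA using \<open>0 \<le> q\<close> by (simp add: ennreal_mult ennreal_of_nat_eq_real_of_nat)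
  next
    case False
    hence r': "r \<le> ereal \<rho>" using r by simp
    have "emeasure (product_density g \<tau> r k) ?A
      = (\<integral>\<^sup>+x. ennreal (\<Prod>j<k. g (x j / \<tau> j) / \<tau> j) * indicator {x. ereal (\<Sum>j<k. \<bar>x j\<bar>) \<le> r} x * indicator ?A x \<partial>?M)"
      unfolding product_density_def using A by (subst emeasure_density) auto
    also have "\<dots> = (\<integral>\<^sup>+x. 0 \<partial>?M)"
    proof (intro nn_integral_cong)
      fix x
      have "\<not> ereal (\<Sum>j<k. \<bar>x j\<bar>) \<le> r" if "\<rho> < L2_set x {..<k}"
        using that le[of x] r' by (meson ereal_less_eq(3) leD less_le_trans order.trans)
      thus "ennreal (\<Prod>j<k. g (x j / \<tau> j) / \<tau> j) * indicator {x. ereal (\<Sum>j<k. \<bar>x j\<bar>) \<le> r} x * indicator ?A x = 0"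
        by (auto split: split_indicator)
    qed
    finally show ?thesis unfolding sA emeasure_coordinate_prior by simp
  qed
qed

end

lemma prior_component_measurable:
  assumes "\<And>k. trunc k \<in> PiM {..<k} (\<lambda>_. lborel) \<rightarrow>\<^sub>M T"
  shows "prior_component T g \<tau> r \<in> measure_pmf \<pi> \<rightarrow>\<^sub>M subprob_algebra T"
proof -
  have "subprob_space (prior_component T g \<tau> r k)" for k
  proof (rule subprob_spaceI)
    have t: "trunc k \<in> coordinate_prior g \<tau> r k \<rightarrow>\<^sub>M T"
      using assms by (simp add: measurable_cong_sets[OF sets_coordinate_prior refl])
    show "emeasure (prior_component T g \<tau> r k) (space (prior_component T g \<tau> r k)) \<le> 1"
      using t coordinate_prior_le_1[of g \<tau> r k] unfolding prior_component_eq_distr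
      by (simp add: emeasure_distr measurable_space[OF t] Collect_conj_eq Int_absorb1 subset_eq vimage_def)
    have "space T \<noteq> {}" using measurable_space[OF assms[of 0]] by (auto simp: space_PiM)
    thus "space (prior_component T g \<tau> r k) \<noteq> {}" by (simp add: prior_component_eq_distr)
  qed
  thus ?thesis
    by (auto simp: measurable_def space_subprob_algebra prior_component_eq_distr)
qed

context
  fixes T :: "param measure" and g :: "real \<Rightarrow> real" and \<tau> :: "nat \<Rightarrow> real" and r :: ereal and \<pi> :: "nat pmf"
  assumes trunc_measurable: "\<And>k. trunc k \<in> PiM {..<k} (\<lambda>_. lborel) \<rightarrow>\<^sub>M T"
begin

lemma sets_sieve_prior: "sets (sieve_prior T \<pi> g \<tau> r) = sets T"
  unfolding sieve_prior_def by (rule sets_bind) (auto simp: prior_component_eq_distr)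

lemma subprob_space_sieve_prior: "subprob_space (sieve_prior T \<pi> g \<tau> r)"
  unfolding sieve_prior_def
  by (intro subprob_space_bind[OF _ prior_component_measurable[OF trunc_measurable]])
    (rule prob_space_imp_subprob_space[OF prob_space_measure_pmf])

lemma nn_integral_sieve_prior:
  assumes f[measurable]: "f \<in> borel_measurable T"
  shows "(\<integral>\<^sup>+\<theta>. f \<theta> \<partial>sieve_prior T \<pi> g \<tau> r)
    = (\<integral>\<^sup>+k. (\<integral>\<^sup>+x. f (trunc k x) \<partial>coordinate_prior g \<tau> r k) \<partial>measure_pmf \<pi>)"
proof -
  have t: "trunc k \<in> coordinate_prior g \<tau> r k \<rightarrow>\<^sub>M T" for k
    using trunc_measurable by (simp add: measurable_cong_sets[OF sets_coordinate_prior refl])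
  show ?thesis unfolding sieve_prior_def
    by (subst nn_integral_bind[OF f prior_component_measurable[OF trunc_measurable]])
      (simp add: prior_component_eq_distr nn_integral_distr[OF t])
qed

lemma sieve_prior_integral_ge:
  assumes f[measurable]: "f \<in> borel_measurable T"
  shows "ennreal (pmf \<pi> j) * (\<integral>\<^sup>+x\<in>A. f (trunc j x) \<partial>coordinate_prior g \<tau> r j)
    \<le> (\<integral>\<^sup>+\<theta>. f \<theta> \<partial>sieve_prior T \<pi> g \<tau> r)"
proof -
  let ?F = "\<lambda>k. \<integral>\<^sup>+x. f (trunc k x) \<partial>coordinate_prior g \<tau> r k"
  have "ennreal (pmf \<pi> j) * (\<integral>\<^sup>+x\<in>A. f (trunc j x) \<partial>coordinate_prior g \<tau> r j) \<le> ennreal (pmf \<pi> j) * ?F j"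
    by (intro mult_left_mono nn_integral_mono) (auto split: split_indicator)
  also have "\<dots> = (\<integral>\<^sup>+k. ?F j * indicator {j} k \<partial>measure_pmf \<pi>)"
    by (subst nn_integral_cmult) (simp_all add: emeasure_pmf_single mult.commute)
  also have "\<dots> \<le> (\<integral>\<^sup>+k. ?F k \<partial>measure_pmf \<pi>)"
    by (intro nn_integral_mono) (auto split: split_indicator)
  finally show ?thesis by (simp add: nn_integral_sieve_prior)
qed

text \<open>
  This is the place where the prior is split along the sieve: components beyond \<open>K\<close>, points of large norm in the
  other components, and the rest, where \<open>f\<close> is small.
\<close>

lemma sieve_prior_integral_le:
  assumes f[measurable]: "f \<in> borel_measurable T" and f1: "\<And>\<theta>. \<theta> \<in> space T \<Longrightarrow> f \<theta> \<le> 1"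
    and small: "\<And>k x. \<lbrakk>k \<le> K; x \<in> space (PiM {..<k} (\<lambda>_. lborel)); L2_set x {..<k} \<le> \<rho>\<rbrakk> \<Longrightarrow> f (trunc k x) \<le> \<eta>"
    and tail: "\<And>k. k \<le> K \<Longrightarrow> emeasure (coordinate_prior g \<tau> r k)
      {x \<in> space (coordinate_prior g \<tau> r k). \<rho> < L2_set x {..<k}} \<le> q"
  shows "(\<integral>\<^sup>+\<theta>. f \<theta> \<partial>sieve_prior T \<pi> g \<tau> r) \<le> \<eta> + q + emeasure (measure_pmf \<pi>) {K<..}"
proof -
  have "(\<integral>\<^sup>+\<theta>. f \<theta> \<partial>sieve_prior T \<pi> g \<tau> r) \<le> (\<integral>\<^sup>+k. \<eta> + q + indicator {K<..} k \<partial>measure_pmf \<pi>)"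
    unfolding nn_integral_sieve_prior[OF f]
  proof (intro nn_integral_mono)
    fix k
    let ?N = "coordinate_prior g \<tau> r k"
    let ?M = "PiM {..<k} (\<lambda>_. lborel) :: param measure"
    note [measurable] = measurable_L2_set_coordinates
    have in_T: "trunc k x \<in> space T" if "x \<in> space ?N" for x
      using that measurable_space[OF trunc_measurable[of k]] by (simp add: space_coordinate_prior)
    show "(\<integral>\<^sup>+x. f (trunc k x) \<partial>?N) \<le> \<eta> + q + indicator {K<..} k"
    proof (cases "k \<le> K")
      case True
      let ?A = "{x \<in> space ?N. \<rho> < L2_set x {..<k}}"
      have [measurable]: "?A \<in> sets ?N" by measurable
      have "(\<integral>\<^sup>+x. f (trunc k x) \<partial>?N) \<le> (\<integral>\<^sup>+x. \<eta> + indicator ?A x \<partial>?N)"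
      proof (intro nn_integral_mono)
        fix x assume x: "x \<in> space ?N"
        show "f (trunc k x) \<le> \<eta> + indicator ?A x"
        proof (cases "x \<in> ?A")
          case False
          thus ?thesis using small[OF True] x by (simp add: space_coordinate_prior)
        next
          case True
          thus ?thesis using f1[OF in_T[OF x]] by (simp add: add_increasing)
        qed
      qed
      also have "\<dots> = \<eta> * emeasure ?N (space ?N) + emeasure ?N ?A" by (subst nn_integral_add) auto
      also have "\<dots> \<le> \<eta> * 1 + q" using True by (intro add_mono mult_left_mono coordinate_prior_le_1 tail) auto
      finally show ?thesis using True by simp
    next
      case False
      have "(\<integral>\<^sup>+x. f (trunc k x) \<partial>?N) \<le> (\<integral>\<^sup>+x. 1 \<partial>?N)"
        by (intro nn_integral_mono f1 in_T)
      also have "\<dots> \<le> 1" using coordinate_prior_le_1[of g \<tau> r k] by simp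
      finally show ?thesis using False by (simp add: add_increasing)
    qed
  qed
  also have "\<dots> = \<eta> + q + emeasure (measure_pmf \<pi>) {K<..}"
    by (simp add: nn_integral_add measure_pmf.emeasure_space_1[simplified])
  finally show ?thesis .
qed

end

text \<open>
  The constant 3 is a bound for the sum \<open>pi\<^sup>2 / 6\<close> of the inverse squares.
\<close>

lemma emeasure_pmf_tail_le:
  fixes \<pi> :: "nat pmf"
  assumes "0 \<le> s" "0 \<le> t"
    and mid: "\<And>i. K < i \<Longrightarrow> i \<le> n \<Longrightarrow> pmf \<pi> i \<le> s"
    and far: "\<And>i. n < i \<Longrightarrow> pmf \<pi> i \<le> t / (real i)\<^sup>2"
  shows "emeasure (measure_pmf \<pi>) {K<..} \<le> ennreal (real n * s + 3 * t)"
proof -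
  define F where "F i = (if i \<in> {1..n} then s else 0) + t * (1 / (real i)\<^sup>2)" for i
  have F0: "0 \<le> F i" for i using assms(1,2) by (simp add: F_def)
  have "(\<lambda>i. 1 / (real (Suc i))\<^sup>2) sums (pi\<^sup>2 / 6)" using inverse_squares_sums by (simp add: add.commute)
  hence "(\<lambda>i. 1 / (real i)\<^sup>2) sums (pi\<^sup>2 / 6)" by (subst (asm) sums_Suc_iff) simp
  from sums_add[OF sums_If_finite_set[of "{1..n}" "\<lambda>_. s"] sums_mult[OF this, of t]]
  have sF: "F sums (real n * s + t * (pi\<^sup>2 / 6))" by (simp add: F_def[abs_def])
  have "pi\<^sup>2 / 6 \<le> 3"
  proof -
    have "pi\<^sup>2 \<le> 4\<^sup>2" using pi_less_4 pi_ge_zero by (intro power_mono) auto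
    thus ?thesis by simp
  qed
  hence "t * (pi\<^sup>2 / 6) \<le> t * 3" using assms(2) by (intro mult_left_mono) auto
  hence total: "(\<Sum>i. F i) \<le> real n * s + 3 * t" using sums_unique[OF sF] by simp
  have "emeasure (measure_pmf \<pi>) {K<..} = (\<integral>\<^sup>+i. ennreal (pmf \<pi> i) * indicator {K<..} i \<partial>count_space UNIV)"
    by (simp add: nn_integral_pmf[symmetric] nn_integral_count_space_indicator)
  also have "\<dots> = (\<Sum>i. ennreal (pmf \<pi> i) * indicator {K<..} i)" by (rule nn_integral_count_space_nat)
  also have "\<dots> \<le> (\<Sum>i. ennreal (F i))"
  proof (rule suminf_le)
    fix i
    have "pmf \<pi> i \<le> F i" if "K < i"
    proof (cases "i \<le> n")
      case True
      have "0 \<le> t * (1 / (real i)\<^sup>2)" using assms(2) by simp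
      thus ?thesis using mid[OF that True] that True unfolding F_def by auto
    next
      case False
      thus ?thesis using far[of i] assms(1) by (simp add: F_def)
    qed
    thus "ennreal (pmf \<pi> i) * indicator {K<..} i \<le> ennreal (F i)"
      by (auto split: split_indicator intro!: ennreal_leI)
  qed auto
  also have "\<dots> = ennreal (\<Sum>i. F i)" using F0 sums_summable[OF sF] by (intro suminf_ennreal2) auto
  also have "\<dots> \<le> ennreal (real n * s + 3 * t)" using total by (rule ennreal_leI)
  finally show ?thesis .
qed

text \<open>
  On the box, each \<open>\<bar>t / \<tau> i\<bar>\<close> is at most twice the larger of \<open>\<bar>\<theta>0 i\<bar> / \<tau> i\<close> and 1, because the half side of
  the box does not exceed \<open>\<tau> i\<close>. Thus the density of the \<open>i\<close>-th coordinate costs \<open>G2 * 2 powr \<alpha>\<close> times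
  \<open>\<bar>\<theta>0 i\<bar> powr \<alpha> / \<tau> i powr \<alpha> + 1\<close> in the exponent, and the side of the box costs \<open>H + 1\<close> times \<open>ln n\<close>.
\<close>

lemma coordinate_prior_box_exp:
  fixes g :: "real \<Rightarrow> real" and \<tau> \<theta>0 :: "nat \<Rightarrow> real"
  assumes g: "g \<in> borel_measurable borel" "\<And>t. 0 \<le> g t" "(\<integral>\<^sup>+t. ennreal (g t) \<partial>lborel) = 1"
    and \<tau>: "\<And>i. 0 < \<tau> i" "\<And>i. \<tau> i \<le> \<tau>0" "\<And>i. i < j \<Longrightarrow> real n powr (- H2) \<le> \<tau> i"
    and g_lower: "\<And>t. G1 * exp (- G2 * \<bar>t\<bar> powr \<alpha>) \<le> g t"
    and scaled: "(\<Sum>i<j. \<bar>\<theta>0 i\<bar> powr \<alpha> / \<tau> i powr \<alpha>) \<le> C * real j * ln (real n)"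
    and const: "0 < G1" "0 < G2" "0 < \<alpha>" "0 < \<tau>0" "H2 \<le> H" "0 \<le> H"
    and n: "3 \<le> n" "1 / real n \<le> 2 * G1 / \<tau>0"
    and r: "ereal ((\<Sum>i<j. \<bar>\<theta>0 i\<bar>) + real j * real n powr (- H)) \<le> r"
  shows "ennreal (exp (- ((H + 1 + G2 * 2 powr \<alpha> * (C + 1)) * real j * ln (real n))))
    \<le> emeasure (coordinate_prior g \<tau> r j)
        (PiE {..<j} (\<lambda>i. {\<theta>0 i - real n powr (- H)..\<theta>0 i + real n powr (- H)}))"
proof -
  define \<delta> where "\<delta> = real n powr (- H)"
  define l where "l = ln (real n)"
  have l1: "1 \<le> l"
  proof -
    have "exp 1 \<le> real n" using exp_le n by simp
    thus ?thesis using n unfolding l_def by (subst ln_ge_iff) auto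
  qed
  have \<delta>: "0 < \<delta>" "\<delta> = exp (- H * l)" using n by (auto simp: \<delta>_def l_def powr_def)
  define w where "w i = G1 / \<tau>0 * exp (- (G2 * 2 powr \<alpha> * (\<bar>\<theta>0 i\<bar> powr \<alpha> / \<tau> i powr \<alpha> + 1)))" for i
  have w0: "0 \<le> w i" for i using const by (simp add: w_def)
  have \<delta>\<tau>: "\<delta> \<le> \<tau> i" if "i < j" for i
  proof -
    have "\<delta> \<le> real n powr (- H2)" unfolding \<delta>_def using const n by (intro powr_mono) auto
    thus ?thesis using \<tau>(3)[OF that] by linarith
  qed
  have w_le: "w i \<le> g (t / \<tau> i) / \<tau> i" if i: "i < j" and t: "\<bar>t - \<theta>0 i\<bar> \<le> \<delta>" for i t
  proof -
    let ?A = "\<bar>\<theta>0 i\<bar> powr \<alpha> / \<tau> i powr \<alpha>"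
    have M: "\<bar>t / \<tau> i\<bar> \<le> 2 * max (\<bar>\<theta>0 i\<bar> / \<tau> i) 1"
    proof -
      have "\<bar>t\<bar> \<le> \<bar>\<theta>0 i\<bar> + \<tau> i" using t \<delta>\<tau>[OF i] by linarith
      hence "\<bar>t\<bar> / \<tau> i \<le> (\<bar>\<theta>0 i\<bar> + \<tau> i) / \<tau> i" using \<tau>(1)[of i] by (intro divide_right_mono) auto
      also have "\<dots> = \<bar>\<theta>0 i\<bar> / \<tau> i + 1" using \<tau>(1)[of i] by (simp add: add_divide_distrib)
      finally show ?thesis using \<tau>(1)[of i] by (simp add: abs_divide)
    qed
    have "\<bar>t / \<tau> i\<bar> powr \<alpha> \<le> (2 * max (\<bar>\<theta>0 i\<bar> / \<tau> i) 1) powr \<alpha>"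
      using M const by (intro powr_mono2) auto
    also have "\<dots> = 2 powr \<alpha> * (max (\<bar>\<theta>0 i\<bar> / \<tau> i) 1) powr \<alpha>" by (simp add: powr_mult)
    also have "(max (\<bar>\<theta>0 i\<bar> / \<tau> i) 1) powr \<alpha> \<le> ?A + 1"
      using \<tau>(1)[of i] by (simp add: max_def powr_divide less_imp_le)
    finally have "\<bar>t / \<tau> i\<bar> powr \<alpha> \<le> 2 powr \<alpha> * (?A + 1)" by simp
    hence "G2 * \<bar>t / \<tau> i\<bar> powr \<alpha> \<le> G2 * 2 powr \<alpha> * (?A + 1)" using const by (simp add: mult.assoc)
    hence "G1 * exp (- (G2 * 2 powr \<alpha> * (?A + 1))) \<le> G1 * exp (- G2 * \<bar>t / \<tau> i\<bar> powr \<alpha>)"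
      using const by simp
    also have "\<dots> \<le> g (t / \<tau> i)" by (rule g_lower)
    finally have "G1 * exp (- (G2 * 2 powr \<alpha> * (?A + 1))) / \<tau>0 \<le> g (t / \<tau> i) / \<tau> i"
      using const \<tau>(1,2)[of i] g(2) by (intro frac_le) auto
    thus ?thesis by (simp add: w_def)
  qed
  have box: "ennreal (\<Prod>i<j. w i * (2 * \<delta>)) \<le> emeasure (coordinate_prior g \<tau> r j) (PiE {..<j} (\<lambda>i. {\<theta>0 i - \<delta>..\<theta>0 i + \<delta>}))"
  proof (rule coordinate_prior_box[OF g \<tau>(1) w0])
    fix x assume x: "\<And>i. i < j \<Longrightarrow> \<bar>x i - \<theta>0 i\<bar> \<le> \<delta>"
    have "(\<Sum>i<j. \<bar>x i\<bar>) \<le> (\<Sum>i<j. \<bar>\<theta>0 i\<bar> + \<delta>)"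
    proof (rule sum_mono)
      fix i assume "i \<in> {..<j}"
      thus "\<bar>x i\<bar> \<le> \<bar>\<theta>0 i\<bar> + \<delta>" using x[of i] by auto
    qed
    also have "\<dots> = (\<Sum>i<j. \<bar>\<theta>0 i\<bar>) + real j * \<delta>" by (simp add: sum.distrib)
    finally show "ereal (\<Sum>i<j. \<bar>x i\<bar>) \<le> r" using r unfolding \<delta>_def by (meson ereal_less_eq(3) order.trans)
  qed (use \<delta> w_le in auto)
  have "exp (- ((H + 1 + G2 * 2 powr \<alpha> * (C + 1)) * real j * l)) \<le> (\<Prod>i<j. w i * (2 * \<delta>))"
  proof -
    let ?S = "\<Sum>i<j. \<bar>\<theta>0 i\<bar> powr \<alpha> / \<tau> i powr \<alpha>"
    have "G2 * 2 powr \<alpha> * (?S + real j) \<le> G2 * 2 powr \<alpha> * ((C + 1) * real j * l)"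
    proof (rule mult_left_mono)
      have "real j * 1 \<le> real j * l" using l1 by (intro mult_left_mono) auto
      thus "?S + real j \<le> (C + 1) * real j * l" using scaled unfolding l_def[symmetric]
        by (simp add: algebra_simps)
    qed (use const in auto)
    hence "exp (- ((H + 1 + G2 * 2 powr \<alpha> * (C + 1)) * real j * l))
        \<le> exp (real j * (- l - H * l) - G2 * 2 powr \<alpha> * (?S + real j))"
      by (simp add: algebra_simps)
    also have "\<dots> = (\<Prod>i<j. exp (- l - H * l - G2 * 2 powr \<alpha> * (\<bar>\<theta>0 i\<bar> powr \<alpha> / \<tau> i powr \<alpha> + 1)))"
      by (simp add: exp_sum[symmetric] sum_subtractf sum_distrib_left[symmetric] sum.distrib)
    also have "\<dots> \<le> (\<Prod>i<j. w i * (2 * \<delta>))"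
    proof (rule prod_mono)
      fix i assume "i \<in> {..<j}"
      have e: "exp (- l) = 1 / real n" using n by (simp add: l_def exp_minus inverse_eq_divide)
      have "exp (- l - H * l - G2 * 2 powr \<alpha> * (\<bar>\<theta>0 i\<bar> powr \<alpha> / \<tau> i powr \<alpha> + 1))
        = exp (- l) * (\<delta> * exp (- (G2 * 2 powr \<alpha> * (\<bar>\<theta>0 i\<bar> powr \<alpha> / \<tau> i powr \<alpha> + 1))))"
        unfolding \<delta>(2) by (simp flip: exp_add)
      also have "\<dots> \<le> 2 * G1 / \<tau>0 * (\<delta> * exp (- (G2 * 2 powr \<alpha> * (\<bar>\<theta>0 i\<bar> powr \<alpha> / \<tau> i powr \<alpha> + 1))))"
        unfolding e using n(2) \<delta>(1) by (intro mult_right_mono) auto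
      also have "\<dots> = w i * (2 * \<delta>)" by (simp add: w_def)
      finally show "0 \<le> exp (- l - H * l - G2 * 2 powr \<alpha> * (\<bar>\<theta>0 i\<bar> powr \<alpha> / \<tau> i powr \<alpha> + 1)) \<and>
        exp (- l - H * l - G2 * 2 powr \<alpha> * (\<bar>\<theta>0 i\<bar> powr \<alpha> / \<tau> i powr \<alpha> + 1)) \<le> w i * (2 * \<delta>)" by simp
    qed
    finally show ?thesis .
  qed
  thus ?thesis using box unfolding \<delta>_def l_def by (meson ennreal_leI order.trans)
qed

text \<open>
  The threshold \<open>n powr Q / k\<close> for a single coordinate is at least \<open>n powr (1 / \<alpha>)\<close>, and the \<open>\<alpha>\<close>-th power of
  the latter is \<open>n\<close>.
\<close>

lemma sieve_truncation_tail:
  fixes g :: "real \<Rightarrow> real" and \<tau> :: "nat \<Rightarrow> real"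
  assumes g: "g \<in> borel_measurable borel" "\<And>t. 0 \<le> g t" "(\<integral>\<^sup>+t. ennreal (g t) \<partial>lborel) = 1"
    and \<tau>: "\<And>i. 0 < \<tau> i" "\<And>i. \<tau> i \<le> \<tau>0"
    and g_bounds: "\<And>x. G1 * exp (- G2 * \<bar>x\<bar> powr \<alpha>) \<le> g x" "\<And>x. g x \<le> G3 * exp (- G4 * \<bar>x\<bar> powr \<alpha>)"
    and const: "0 < G1" "0 < G2" "0 < G3" "0 < G4" "0 < \<alpha>" "0 < \<tau>0"
    and r: "r = \<infinity> \<or> r \<le> ereal (real n powr Q)" and Q: "1 + 1 / \<alpha> \<le> Q" and k: "k \<le> n"
  shows "emeasure (coordinate_prior g \<tau> r k)
      {x \<in> space (coordinate_prior g \<tau> r k). real n powr Q < L2_set x {..<k}}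
    \<le> ennreal (real n * (G3 * (2 * G2 / G4) powr (1 / \<alpha>) / G1 * exp (- (G4 / 2 / \<tau>0 powr \<alpha> * real n))))"
proof -
  let ?q = "G3 * (2 * G2 / G4) powr (1 / \<alpha>) / G1 * exp (- (G4 / 2 / \<tau>0 powr \<alpha> * real n))"
  have q: "0 \<le> ?q" using const by simp
  have "emeasure (coordinate_prior g \<tau> r k)
      {x \<in> space (coordinate_prior g \<tau> r k). real n powr Q < L2_set x {..<k}} \<le> ennreal (real k * ?q)"
  proof (rule coordinate_prior_tail[OF g \<tau>(1) _ r q])
    fix i assume i: "i < k"
    let ?t = "real n powr Q / real k"
    have n: "1 \<le> real n" using i k by simp
    have "real n powr (1 / \<alpha>) * real k \<le> real n powr (1 / \<alpha>) * real n" using k by (intro mult_left_mono) auto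
    also have "\<dots> = real n powr (1 / \<alpha> + 1)" using n by (simp add: powr_add)
    also have "\<dots> \<le> real n powr Q" using n Q by (intro powr_mono) auto
    finally have "real n powr (1 / \<alpha>) \<le> ?t" using i by (simp add: field_simps)
    hence "real n powr (1 / \<alpha>) / \<tau>0 \<le> ?t / \<tau>0" using const by (intro divide_right_mono) auto
    hence "(real n powr (1 / \<alpha>) / \<tau>0) powr \<alpha> \<le> (?t / \<tau>0) powr \<alpha>" using const by (intro powr_mono2) auto
    moreover have "(real n powr (1 / \<alpha>) / \<tau>0) powr \<alpha> = real n / \<tau>0 powr \<alpha>"
      using const n by (simp add: powr_divide powr_powr)
    ultimately have "G4 / 2 * (real n / \<tau>0 powr \<alpha>) \<le> G4 / 2 * (?t / \<tau>0) powr \<alpha>"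
      using const by (intro mult_left_mono) auto
    hence "exp (- (G4 / 2) * (?t / \<tau>0) powr \<alpha>) \<le> exp (- (G4 / 2 / \<tau>0 powr \<alpha> * real n))"
      by simp
    hence le: "G3 * exp (- (G4 / 2) * (?t / \<tau>0) powr \<alpha>) * ((2 * G2 / G4) powr (1 / \<alpha>) / G1)
        \<le> G3 * exp (- (G4 / 2 / \<tau>0 powr \<alpha> * real n)) * ((2 * G2 / G4) powr (1 / \<alpha>) / G1)"
      using const by (intro mult_right_mono mult_left_mono) auto
    have "(\<integral>\<^sup>+x. ennreal (g (x / \<tau> i) / \<tau> i) * indicator {x. ?t < \<bar>x\<bar>} x \<partial>lborel)
        \<le> ennreal (G3 * exp (- (G4 / 2) * (?t / \<tau>0) powr \<alpha>) * ((2 * G2 / G4) powr (1 / \<alpha>) / G1))"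
      using scaled_density_tail[OF g \<tau>(1) const(1-5) \<tau>(1,2) _ g_bounds, of ?t] by simp
    also have "\<dots> \<le> ennreal ?q" using le by (intro ennreal_leI) (simp add: mult_ac)
    finally show "(\<integral>\<^sup>+x. ennreal (g (x / \<tau> i) / \<tau> i) * indicator {x. ?t < \<bar>x\<bar>} x \<partial>lborel) \<le> ennreal ?q" .
  qed simp
  also have "\<dots> \<le> ennreal (real n * ?q)" using k q by (intro ennreal_leI mult_right_mono) auto
  finally show ?thesis .
qed

section \<open>Global tests from local tests\<close>

text \<open>
  Points in the same cell of a cubic grid of mesh \<open>h\<close> differ by at most \<open>h\<close> in each coordinate. One point of \<open>S\<close> is
  chosen in each cell that meets \<open>S\<close>, so the net stays inside \<open>S\<close>; for \<open>S\<close> away from the truth, the local tests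
  at its points have small errors.
\<close>

lemma sieve_ball_net:
  assumes "0 < h" "S \<subseteq> sieve_ball k Q n"
  obtains N where "finite N" "N \<subseteq> S" "real (card N) \<le> (2 * real n powr Q / h + 2) ^ k"
    "\<And>\<theta>. \<theta> \<in> S \<Longrightarrow> \<exists>\<theta>1\<in>N. L2_set (\<theta> - \<theta>1) {..<k} \<le> real k * h"
proof -
  define \<rho> where "\<rho> = real n powr Q"
  have \<rho>: "0 \<le> \<rho>" by (simp add: \<rho>_def)
  define cell where "cell \<theta> = restrict (\<lambda>i. \<lfloor>\<theta> i / h\<rfloor>) {..<k}" for \<theta> :: param
  define W where "W = PiE {..<k} (\<lambda>_. {\<lfloor>- \<rho> / h\<rfloor>..\<lfloor>\<rho> / h\<rfloor>})"
  have finW: "finite W" unfolding W_def by (intro finite_PiE) auto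
  have "cell ` S \<subseteq> W"
  proof
    fix c assume "c \<in> cell ` S"
    then obtain \<theta> where \<theta>: "\<theta> \<in> S" "c = cell \<theta>" by blast
    have "\<bar>\<theta> i\<bar> \<le> \<rho>" if "i < k" for i
    proof -
      have "\<bar>\<theta> i\<bar> \<le> L2_set (\<lambda>i. \<bar>\<theta> i\<bar>) {..<k}" using that by (intro member_le_L2_set) auto
      also have "\<dots> = L2_set \<theta> {..<k}" by (simp add: L2_set_def)
      also have "\<dots> \<le> \<rho>" using \<theta> assms by (auto simp: sieve_ball_def \<rho>_def)
      finally show ?thesis .
    qed
    hence "- \<rho> / h \<le> \<theta> i / h \<and> \<theta> i / h \<le> \<rho> / h" if "i < k" for i
      using assms(1) by (intro conjI divide_right_mono) (use that in \<open>force simp: abs_le_iff\<close>)+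
    thus "c \<in> W" unfolding \<theta> W_def cell_def by (auto intro!: floor_mono)
  qed
  hence fin: "finite (cell ` S)" and c1: "card (cell ` S) \<le> card W"
    using finW finite_subset card_mono by blast+
  have "real (card W) = (real (card {\<lfloor>- \<rho> / h\<rfloor>..\<lfloor>\<rho> / h\<rfloor>})) ^ k" by (simp add: W_def card_PiE)
  also have "\<dots> \<le> (2 * \<rho> / h + 2) ^ k"
  proof (rule power_mono)
    have "\<lfloor>- \<rho> / h\<rfloor> \<le> \<lfloor>\<rho> / h\<rfloor>" using \<rho> assms(1) by (intro floor_mono) (simp add: divide_simps)
    hence "real (card {\<lfloor>- \<rho> / h\<rfloor>..\<lfloor>\<rho> / h\<rfloor>}) = of_int \<lfloor>\<rho> / h\<rfloor> - of_int \<lfloor>- \<rho> / h\<rfloor> + 1" by simp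
    also have "\<dots> \<le> \<rho> / h - (- \<rho> / h - 1) + 1" by linarith
    finally show "real (card {\<lfloor>- \<rho> / h\<rfloor>..\<lfloor>\<rho> / h\<rfloor>}) \<le> 2 * \<rho> / h + 2" by simp
  qed simp
  finally have c2: "real (card W) \<le> (2 * \<rho> / h + 2) ^ k" .
  define N where "N = inv_into S cell ` (cell ` S)"
  show ?thesis
  proof (rule that[of N])
    show "finite N" using fin by (simp add: N_def)
    show "N \<subseteq> S" unfolding N_def by (auto intro: inv_into_into)
    have "card N \<le> card (cell ` S)" unfolding N_def by (rule card_image_le[OF fin])
    thus "real (card N) \<le> (2 * real n powr Q / h + 2) ^ k" using c1 c2 unfolding \<rho>_def by linarith
    fix \<theta> assume \<theta>: "\<theta> \<in> S"
    define \<theta>1 where "\<theta>1 = inv_into S cell (cell \<theta>)"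
    have "cell \<theta>1 = cell \<theta>" unfolding \<theta>1_def by (rule f_inv_into_f[OF imageI[OF \<theta>]])
    hence eq: "\<lfloor>\<theta>1 i / h\<rfloor> = \<lfloor>\<theta> i / h\<rfloor>" if "i < k" for i
      using that unfolding cell_def by (metis lessThan_iff restrict_apply')
    have "\<bar>(\<theta> - \<theta>1) i\<bar> \<le> h" if "i < k" for i
    proof -
      have "\<bar>\<theta> i / h - \<theta>1 i / h\<bar> \<le> 1" using eq[OF that] by linarith
      hence "\<bar>(\<theta> i - \<theta>1 i) / h\<bar> \<le> 1" by (simp add: diff_divide_distrib)
      thus ?thesis using assms(1) by (simp add: abs_divide)
    qed
    hence "(\<Sum>i<k. \<bar>(\<theta> - \<theta>1) i\<bar>) \<le> (\<Sum>i<k. h)" by (intro sum_mono) auto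
    hence "L2_set (\<theta> - \<theta>1) {..<k} \<le> real k * h"
      using L2_set_le_sum_abs[of "\<theta> - \<theta>1" "{..<k}"] by simp
    moreover have "\<theta>1 \<in> N" unfolding N_def \<theta>1_def by (rule imageI[OF imageI[OF \<theta>]])
    ultimately show "\<exists>\<theta>1\<in>N. L2_set (\<theta> - \<theta>1) {..<k} \<le> real k * h" by blast
  qed
qed

lemma sieve_subset_space:
  assumes "trunc k \<in> PiM {..<k} (\<lambda>_. lborel) \<rightarrow>\<^sub>M T"
  shows "sieve k \<subseteq> space T"
proof
  fix \<theta> assume "\<theta> \<in> sieve k"
  hence "\<theta> = trunc k (restrict \<theta> {..<k})" by (auto simp: sieve_def trunc_def)
  moreover have "restrict \<theta> {..<k} \<in> space (PiM {..<k} (\<lambda>_. lborel))" by (simp add: space_PiM)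
  ultimately show "\<theta> \<in> space T" using measurable_space[OF assms] by metis
qed

text \<open>
  The sum of the local tests over the net, capped at 1. A far parameter is closer than \<open>\<zeta> u\<close> to
  some point of the net, which is itself at distance at least \<open>u\<close> from the truth; so the local test at this point detects it.
\<close>

lemma global_test:
  fixes p :: "param \<Rightarrow> 'x \<Rightarrow> real"
  assumes p_meas: "\<And>\<theta>. \<theta> \<in> space T \<Longrightarrow> p \<theta> \<in> borel_measurable \<mu>"
    and p_prob: "\<And>\<theta>. \<theta> \<in> space T \<Longrightarrow> prob_space (law \<mu> p \<theta>)"
    and d: "semimetric_on (space T) d" and sieve: "sieve k \<subseteq> space T" and \<theta>0: "\<theta>0 \<in> space T"
    and A3: "condition_A3 d D0 D1 D2 Q n k" and A4: "condition_A4 (space T) \<mu> p d c1 \<zeta> Q n k \<theta>0"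
    and "0 \<le> D0" "0 < D2" "0 < c1" "0 < \<zeta>" "0 < h" "0 \<le> u"
    and radius: "D0 * real k powr D1 * (real k * h) powr D2 < \<zeta> * u"
  obtains \<Phi> where "\<Phi> \<in> borel_measurable \<mu>" "\<And>x. x \<in> space \<mu> \<Longrightarrow> 0 \<le> \<Phi> x \<and> \<Phi> x \<le> 1"
    "(\<integral>\<^sup>+x. ennreal (p \<theta>0 x) * ennreal (\<Phi> x) \<partial>\<mu>)
      \<le> ennreal ((2 * real n powr Q / h + 2) ^ k * exp (- c1 * real n * u\<^sup>2))"
    "\<And>\<theta>. \<lbrakk>\<theta> \<in> sieve_ball k Q n; u \<le> d \<theta> \<theta>0\<rbrakk> \<Longrightarrow>
      (\<integral>\<^sup>+x. ennreal (1 - \<Phi> x) * ennreal (p \<theta> x) \<partial>\<mu>) \<le> ennreal (exp (- c1 * real n * u\<^sup>2))"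
proof -
  let ?e = "exp (- c1 * real n * u\<^sup>2)"
  define S where "S = {\<theta> \<in> sieve_ball k Q n. u \<le> d \<theta> \<theta>0}"
  obtain N where N: "finite N" "N \<subseteq> S" "real (card N) \<le> (2 * real n powr Q / h + 2) ^ k"
    and net: "\<And>\<theta>. \<theta> \<in> S \<Longrightarrow> \<exists>\<theta>1\<in>N. L2_set (\<theta> - \<theta>1) {..<k} \<le> real k * h"
    using sieve_ball_net[of h S k Q n] \<open>0 < h\<close> unfolding S_def by blast
  have S_T: "\<theta> \<in> space T" if "\<theta> \<in> S" for \<theta> using that sieve by (auto simp: S_def sieve_ball_def)
  have far: "u \<le> d \<theta>0 \<theta>" if "\<theta> \<in> S" for \<theta>
    using that S_T[OF that] d \<theta>0 by (auto simp: S_def semimetric_on_def)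
  have le_e: "exp (- c1 * real n * (d \<theta>0 \<theta>)\<^sup>2) \<le> ?e" if "\<theta> \<in> S" for \<theta>
  proof -
    have "u\<^sup>2 \<le> (d \<theta>0 \<theta>)\<^sup>2" using far[OF that] \<open>0 \<le> u\<close> by (intro power_mono) auto
    hence "c1 * real n * u\<^sup>2 \<le> c1 * real n * (d \<theta>0 \<theta>)\<^sup>2" using \<open>0 < c1\<close> by (intro mult_left_mono) auto
    thus ?thesis by simp
  qed
  have "\<forall>\<theta>1\<in>N. \<exists>\<phi>. \<phi> \<in> borel_measurable \<mu> \<and> (\<forall>x\<in>space \<mu>. \<phi> x \<in> {0..1}) \<and>
        (\<integral>x. \<phi> x \<partial>law \<mu> p \<theta>0) \<le> exp (- c1 * real n * (d \<theta>0 \<theta>1)\<^sup>2) \<and>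
        (\<forall>\<theta>\<in>space T. d \<theta> \<theta>1 < \<zeta> * d \<theta>0 \<theta>1 \<longrightarrow>
           (\<integral>x. 1 - \<phi> x \<partial>law \<mu> p \<theta>) \<le> exp (- c1 * real n * (d \<theta>0 \<theta>1)\<^sup>2))"
    using A4 N(2) unfolding condition_A4_def S_def by blast
  from bchoice[OF this] obtain \<phi> where \<phi>': "\<forall>\<theta>1\<in>N. \<phi> \<theta>1 \<in> borel_measurable \<mu> \<and>
        (\<forall>x\<in>space \<mu>. \<phi> \<theta>1 x \<in> {0..1}) \<and>
        (\<integral>x. \<phi> \<theta>1 x \<partial>law \<mu> p \<theta>0) \<le> exp (- c1 * real n * (d \<theta>0 \<theta>1)\<^sup>2) \<and>
        (\<forall>\<theta>\<in>space T. d \<theta> \<theta>1 < \<zeta> * d \<theta>0 \<theta>1 \<longrightarrow>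
           (\<integral>x. 1 - \<phi> \<theta>1 x \<partial>law \<mu> p \<theta>) \<le> exp (- c1 * real n * (d \<theta>0 \<theta>1)\<^sup>2))"
    by blast
  have \<phi>: "\<And>\<theta>1. \<theta>1 \<in> N \<Longrightarrow> \<phi> \<theta>1 \<in> borel_measurable \<mu>"
    "\<And>\<theta>1 x. \<theta>1 \<in> N \<Longrightarrow> x \<in> space \<mu> \<Longrightarrow> 0 \<le> \<phi> \<theta>1 x \<and> \<phi> \<theta>1 x \<le> 1"
    and type1: "\<And>\<theta>1. \<theta>1 \<in> N \<Longrightarrow> (\<integral>x. \<phi> \<theta>1 x \<partial>law \<mu> p \<theta>0) \<le> exp (- c1 * real n * (d \<theta>0 \<theta>1)\<^sup>2)"
    and type2: "\<And>\<theta>1 \<theta>. \<theta>1 \<in> N \<Longrightarrow> \<theta> \<in> space T \<Longrightarrow> d \<theta> \<theta>1 < \<zeta> * d \<theta>0 \<theta>1 \<Longrightarrow>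
      (\<integral>x. 1 - \<phi> \<theta>1 x \<partial>law \<mu> p \<theta>) \<le> exp (- c1 * real n * (d \<theta>0 \<theta>1)\<^sup>2)"
    using \<phi>' by simp_all
  have convert: "(\<integral>\<^sup>+x. ennreal (p \<theta> x) * ennreal (f x) \<partial>\<mu>) \<le> ennreal e"
    if "\<theta> \<in> space T" "f \<in> borel_measurable \<mu>" "\<And>x. x \<in> space \<mu> \<Longrightarrow> 0 \<le> f x \<and> f x \<le> 1"
      "(\<integral>x. f x \<partial>law \<mu> p \<theta>) \<le> e" for \<theta> f e
  proof -
    interpret P: prob_space "law \<mu> p \<theta>" by (rule p_prob) fact
    have int: "integrable (law \<mu> p \<theta>) f"
      using that by (intro P.integrable_const_bound[of _ 1] AE_I2) (auto simp: law_def)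
    have "(\<integral>\<^sup>+x. ennreal (p \<theta> x) * ennreal (f x) \<partial>\<mu>) = (\<integral>\<^sup>+x. ennreal (f x) \<partial>law \<mu> p \<theta>)"
      unfolding law_def using that p_meas[OF that(1)] by (subst nn_integral_density) auto
    also have "\<dots> = ennreal (\<integral>x. f x \<partial>law \<mu> p \<theta>)"
      using that by (intro nn_integral_eq_integral int AE_I2) (auto simp: law_def)
    finally show ?thesis using that(4) by (simp add: ennreal_leI)
  qed
  define \<Phi> where "\<Phi> x = min 1 (\<Sum>\<theta>1\<in>N. \<phi> \<theta>1 x)" for x
  show ?thesis
  proof (rule that[of \<Phi>])
    show "\<Phi> \<in> borel_measurable \<mu>" unfolding \<Phi>_def
      using \<phi>(1) by (intro borel_measurable_min borel_measurable_sum) auto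
    show "0 \<le> \<Phi> x \<and> \<Phi> x \<le> 1" if "x \<in> space \<mu>" for x
      using \<phi>(2) that by (auto simp: \<Phi>_def intro!: sum_nonneg)
    have "(\<integral>\<^sup>+x. ennreal (p \<theta>0 x) * ennreal (\<Phi> x) \<partial>\<mu>)
      \<le> (\<integral>\<^sup>+x. (\<Sum>\<theta>1\<in>N. ennreal (p \<theta>0 x) * ennreal (\<phi> \<theta>1 x)) \<partial>\<mu>)"
    proof (intro nn_integral_mono)
      fix x assume x: "x \<in> space \<mu>"
      have "ennreal (\<Phi> x) \<le> ennreal (\<Sum>\<theta>1\<in>N. \<phi> \<theta>1 x)" by (intro ennreal_leI) (simp add: \<Phi>_def)
      also have "\<dots> = (\<Sum>\<theta>1\<in>N. ennreal (\<phi> \<theta>1 x))" using \<phi>(2) x by (intro sum_ennreal[symmetric]) auto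
      finally show "ennreal (p \<theta>0 x) * ennreal (\<Phi> x) \<le> (\<Sum>\<theta>1\<in>N. ennreal (p \<theta>0 x) * ennreal (\<phi> \<theta>1 x))"
        by (simp add: mult_left_mono flip: sum_distrib_left)
    qed
    also have "\<dots> = (\<Sum>\<theta>1\<in>N. \<integral>\<^sup>+x. ennreal (p \<theta>0 x) * ennreal (\<phi> \<theta>1 x) \<partial>\<mu>)"
      using \<phi>(1) p_meas[OF \<theta>0] by (intro nn_integral_sum) auto
    also have "\<dots> \<le> (\<Sum>\<theta>1\<in>N. ennreal ?e)"
    proof (intro sum_mono convert \<theta>0 \<phi>)
      fix \<theta>1 assume "\<theta>1 \<in> N"
      thus "(\<integral>x. \<phi> \<theta>1 x \<partial>law \<mu> p \<theta>0) \<le> ?e"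
        using type1 le_e N(2) by (meson order.trans subsetD)
    qed auto
    also have "\<dots> = ennreal (real (card N) * ?e)"
      by (simp add: ennreal_mult ennreal_of_nat_eq_real_of_nat)
    also have "\<dots> \<le> ennreal ((2 * real n powr Q / h + 2) ^ k * ?e)"
      using N(3) by (intro ennreal_leI mult_right_mono) auto
    finally show "(\<integral>\<^sup>+x. ennreal (p \<theta>0 x) * ennreal (\<Phi> x) \<partial>\<mu>) \<le> \<dots>" .
    fix \<theta> assume "\<theta> \<in> sieve_ball k Q n" "u \<le> d \<theta> \<theta>0"
    hence \<theta>: "\<theta> \<in> S" by (simp add: S_def)
    obtain \<theta>1 where \<theta>1: "\<theta>1 \<in> N" "L2_set (\<theta> - \<theta>1) {..<k} \<le> real k * h" using net[OF \<theta>] by blast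
    have \<theta>1S: "\<theta>1 \<in> S" using \<theta>1 N by blast
    have "d \<theta> \<theta>1 \<le> D0 * real k powr D1 * L2_set (\<theta> - \<theta>1) {..<k} powr D2"
      using A3 \<theta> \<theta>1S by (auto simp: condition_A3_def S_def)
    also have "\<dots> \<le> D0 * real k powr D1 * (real k * h) powr D2"
      using \<theta>1(2) \<open>0 \<le> D0\<close> \<open>0 < D2\<close> by (intro mult_left_mono powr_mono2) auto
    also have "\<dots> < \<zeta> * u" by (rule radius)
    also have "\<dots> \<le> \<zeta> * d \<theta>0 \<theta>1" using far[OF \<theta>1S] \<open>0 < \<zeta>\<close> by simp
    finally have close: "d \<theta> \<theta>1 < \<zeta> * d \<theta>0 \<theta>1" .
    have "(\<integral>\<^sup>+x. ennreal (1 - \<Phi> x) * ennreal (p \<theta> x) \<partial>\<mu>)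
      \<le> (\<integral>\<^sup>+x. ennreal (p \<theta> x) * ennreal (1 - \<phi> \<theta>1 x) \<partial>\<mu>)"
    proof (intro nn_integral_mono)
      fix x assume x: "x \<in> space \<mu>"
      have "\<phi> \<theta>1 x \<le> (\<Sum>\<theta>1\<in>N. \<phi> \<theta>1 x)" using \<phi>(2) x N(1) \<theta>1(1) by (intro member_le_sum) auto
      hence "1 - \<Phi> x \<le> 1 - \<phi> \<theta>1 x" using \<phi>(2)[OF \<theta>1(1) x] by (simp add: \<Phi>_def)
      thus "ennreal (1 - \<Phi> x) * ennreal (p \<theta> x) \<le> ennreal (p \<theta> x) * ennreal (1 - \<phi> \<theta>1 x)"
        by (subst mult.commute) (intro mult_left_mono ennreal_leI, auto)
    qed
    also have "\<dots> \<le> ennreal ?e"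
    proof (rule convert)
      show "(\<integral>x. 1 - \<phi> \<theta>1 x \<partial>law \<mu> p \<theta>) \<le> ?e"
        using type2[OF \<theta>1(1) S_T[OF \<theta>] close] le_e[OF \<theta>1S] by linarith
    qed (use S_T[OF \<theta>] \<phi> \<theta>1 in auto)
    finally show "(\<integral>\<^sup>+x. ennreal (1 - \<Phi> x) * ennreal (p \<theta> x) \<partial>\<mu>) \<le> ennreal ?e" .
  qed
qed

text \<open>
  With \<open>J\<close> in the role of \<open>j\<close> and \<open>\<Lambda>\<close> in that of \<open>L n\<close>: the logarithm of the number of cells is at most \<open>(Q + \<rho> + 2) k ln n\<close>,
  that is \<open>(Q + \<rho> + 2) M0\<close> times \<open>(ln n / \<Lambda>) J ln n\<close>, and \<open>c1 n u\<^sup>2\<close> is at least \<open>c1 M / j0\<close> times the same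
  quantity. The choice of \<open>M\<close> leaves \<open>cB + 1\<close> such units.
\<close>

lemma covering_exponent:
  assumes n: "4 \<le> n" and "0 \<le> \<rho>" "0 \<le> Q"
    and kJ: "real k \<le> M0 * J * (ln (real n) / \<Lambda>)"
    and nu: "real n * u\<^sup>2 = M * (ln (real n) / \<Lambda>) * R" and JR: "J * ln (real n) \<le> j0 * R"
    and \<Lambda>: "0 < \<Lambda>" "\<Lambda> \<le> ln (real n)" and const: "0 < c1" "0 < j0" "0 \<le> J" "0 \<le> cB" "0 \<le> M0"
    and M: "j0 / c1 * ((Q + \<rho> + 2) * M0 + cB + 1) \<le> M"
  shows "(2 * real n powr Q / real n powr (- (\<rho> + 1)) + 2) ^ k * exp (- c1 * real n * u\<^sup>2)
      \<le> exp (- (J * ln (real n)))"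
    and "exp (- c1 * real n * u\<^sup>2) \<le> exp (- ((cB + 1) * (J * ln (real n))))"
proof -
  define l where "l = ln (real n)"
  define f where "f = l / \<Lambda>"
  have l: "0 < l" using n by (simp add: l_def)
  have f: "1 \<le> f" using \<Lambda> by (simp add: f_def l_def)
  let ?c = "Q + \<rho> + 2"
  have c0: "0 \<le> ?c" using assms by simp
  have Jl: "0 \<le> J * l" using const l by simp
  \<comment> \<open>\<open>f * (J * l)\<close> is the common unit of the entropy and of \<open>n * u\<^sup>2\<close>\<close>
  have e: "f * (J * l) * (?c * M0 + cB + 1) \<le> c1 * real n * u\<^sup>2"
  proof -
    have "?c * M0 + cB + 1 \<le> c1 * M / j0" using M const by (simp add: field_simps)
    hence "f * (J * l) * (?c * M0 + cB + 1) \<le> f * (J * l) * (c1 * M / j0)"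
      using f Jl by (intro mult_left_mono) auto
    also have "\<dots> = c1 * M / j0 * f * (J * l)" by (simp add: mult_ac)
    also have "\<dots> \<le> c1 * M / j0 * f * (j0 * R)"
    proof (rule mult_left_mono)
      have "0 \<le> ?c * M0 + cB + 1" using c0 const by simp
      thus "0 \<le> c1 * M / j0 * f" using \<open>?c * M0 + cB + 1 \<le> c1 * M / j0\<close> f by (intro mult_nonneg_nonneg) linarith+
    qed (use JR in \<open>simp add: l_def\<close>)
    also have "\<dots> = c1 * (real n * u\<^sup>2)" unfolding nu f_def l_def using const by simp
    finally show ?thesis by (simp add: mult.assoc)
  qed
  have fJ: "J * l \<le> f * (J * l)" using mult_right_mono[OF f Jl] by simp
  have "(cB + 1) * (J * l) \<le> (cB + 1) * (f * (J * l))" using fJ const by (intro mult_left_mono) auto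
  also have "\<dots> \<le> (?c * M0 + cB + 1) * (f * (J * l))"
    using c0 const f Jl by (intro mult_right_mono) auto
  also have "\<dots> \<le> c1 * real n * u\<^sup>2" using e by (simp add: mult_ac)
  finally show "exp (- c1 * real n * u\<^sup>2) \<le> exp (- ((cB + 1) * (J * ln (real n))))"
    unfolding l_def by simp
  have "2 * real n powr Q / real n powr (- (\<rho> + 1)) + 2 \<le> 4 * real n powr (Q + \<rho> + 1)"
  proof -
    have "real n powr Q / real n powr (- (\<rho> + 1)) = real n powr (Q - - (\<rho> + 1))"
      by (rule powr_diff[symmetric])
    moreover have "Q - - (\<rho> + 1) = Q + \<rho> + 1" by simp
    ultimately have "2 * (real n powr Q / real n powr (- (\<rho> + 1))) = 2 * real n powr (Q + \<rho> + 1)"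
      by (simp only:)
    moreover have "1 \<le> real n powr (Q + \<rho> + 1)" using n assms by (intro ge_one_powr_ge_zero) auto
    ultimately show ?thesis unfolding times_divide_eq_right by linarith
  qed
  also have "\<dots> \<le> real n * real n powr (Q + \<rho> + 1)" using n by (intro mult_right_mono) auto
  also have "\<dots> = exp (?c * l)"
  proof -
    have "real n * real n powr (Q + \<rho> + 1) = real n powr (1 + (Q + \<rho> + 1))"
      unfolding powr_add[of _ 1] using n by simp
    thus ?thesis using n by (simp add: powr_def l_def algebra_simps)
  qed
  finally have "(2 * real n powr Q / real n powr (- (\<rho> + 1)) + 2) ^ k \<le> exp (?c * l) ^ k"
    by (intro power_mono) auto
  also have "\<dots> = exp (real k * (?c * l))" by (simp add: exp_of_nat_mult)
  also have "\<dots> \<le> exp (M0 * J * f * (?c * l))"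
  proof -
    have "real k * (?c * l) \<le> M0 * J * f * (?c * l)"
      using kJ c0 l by (intro mult_right_mono) (simp_all add: f_def l_def)
    thus ?thesis by simp
  qed
  finally have "(2 * real n powr Q / real n powr (- (\<rho> + 1)) + 2) ^ k * exp (- c1 * real n * u\<^sup>2)
      \<le> exp (M0 * J * f * (?c * l)) * exp (- (f * (J * l) * (?c * M0 + cB + 1)))"
    using e by (intro mult_mono) auto
  also have "\<dots> = exp (- (f * (J * l) * (cB + 1)))" by (simp flip: exp_add add: algebra_simps)
  also have "\<dots> \<le> exp (- (J * l))"
  proof -
    have "J * l * 1 \<le> f * (J * l) * (cB + 1)"
      using fJ Jl f const mult_mono[of "J * l" "f * (J * l)" 1 "cB + 1"] by simp
    thus ?thesis by simp
  qed
  finally show "(2 * real n powr Q / real n powr (- (\<rho> + 1)) + 2) ^ k * exp (- c1 * real n * u\<^sup>2)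
      \<le> exp (- (J * ln (real n)))" by (simp add: l_def)
qed

text \<open>
  The mesh \<open>n powr (- ((D1 + 1) / D2 + 1))\<close> makes the \<open>d\<close>-diameter of a cell at most \<open>D0 / n\<close>, while \<open>u\<close> is at
  least \<open>1 / sqrt n\<close>.
\<close>

lemma net_radius:
  assumes "1 \<le> n" "k \<le> n" "0 \<le> D0" "0 \<le> D1" "0 < D2" "0 < \<zeta>"
    and "D0 < \<zeta> * sqrt (real n)" "1 / real n \<le> u\<^sup>2" "0 \<le> u"
  shows "D0 * real k powr D1 * (real k * real n powr (- ((D1 + 1) / D2 + 1))) powr D2 < \<zeta> * u"
proof -
  let ?\<rho> = "(D1 + 1) / D2"
  have n: "0 < real n" "1 \<le> real n" using assms by auto
  have "real k * real n powr (- (?\<rho> + 1)) \<le> real n * real n powr (- (?\<rho> + 1))"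
    using assms by (intro mult_right_mono) auto
  also have "\<dots> = real n powr (1 + - (?\<rho> + 1))" unfolding powr_add[of _ 1] using n by simp
  finally have "(real k * real n powr (- (?\<rho> + 1))) powr D2 \<le> (real n powr (- ?\<rho>)) powr D2"
    using assms by (intro powr_mono2) auto
  also have "\<dots> = real n powr (- (D1 + 1))" using assms by (simp add: powr_powr)
  finally have 1: "(real k * real n powr (- (?\<rho> + 1))) powr D2 \<le> real n powr (- (D1 + 1))" .
  have 2: "real k powr D1 \<le> real n powr D1" using assms by (intro powr_mono2) auto
  have "D0 * real k powr D1 * (real k * real n powr (- (?\<rho> + 1))) powr D2
      \<le> D0 * real n powr D1 * real n powr (- (D1 + 1))"
    using 1 2 assms by (intro mult_mono) auto
  also have "\<dots> = D0 / real n" using n by (simp add: mult.assoc powr_minus flip: powr_add) (simp add: divide_inverse)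
  also have "\<dots> < \<zeta> * (1 / sqrt (real n))"
  proof -
    have "D0 / real n < \<zeta> * sqrt (real n) / real n" using assms n by (intro divide_strict_right_mono) auto
    also have "\<dots> = \<zeta> * (1 / sqrt (real n))"
      using n by (simp add: real_div_sqrt divide_simps)
    finally show ?thesis .
  qed
  also have "\<dots> \<le> \<zeta> * u"
  proof (intro mult_left_mono)
    have "sqrt (1 / real n) \<le> sqrt (u\<^sup>2)" using assms by (intro real_sqrt_le_mono) auto
    thus "1 / sqrt (real n) \<le> u" using assms by (simp add: real_sqrt_divide)
  qed (use assms in auto)
  finally show ?thesis .
qed

section \<open>The posterior at a fixed sample size\<close>

text \<open>
  The general bound for the expected posterior with the global test on the sieve \<open>K\<close>, and with the
  evidence coming from a box in the component \<open>j\<close> of the prior. The numbers \<open>v\<close> and \<open>w\<close> are lower bounds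
  for the two factors of the prior mass of the box, and \<open>q\<close> and \<open>s\<close> bound the prior mass outside
  the reach of the test.
\<close>

lemma posterior_mass_bound:
  fixes T :: "param measure" and p :: "param \<Rightarrow> 'x \<Rightarrow> real" and \<pi> :: "nat pmf"
  assumes trunc_meas: "\<And>k. trunc k \<in> PiM {..<k} (\<lambda>_. lborel) \<rightarrow>\<^sub>M T"
    and \<mu>: "sigma_finite_measure \<mu>"
    and p_meas[measurable]: "(\<lambda>(\<theta>, x). p \<theta> x) \<in> borel_measurable (T \<Otimes>\<^sub>M \<mu>)"
    and p_nonneg: "\<And>\<theta> x. \<theta> \<in> space T \<Longrightarrow> x \<in> space \<mu> \<Longrightarrow> 0 \<le> p \<theta> x"
    and p_prob: "\<And>\<theta>. \<theta> \<in> space T \<Longrightarrow> prob_space (law \<mu> p \<theta>)"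
    and d: "semimetric_on (space T) d" and d_meas: "(\<lambda>\<theta>. d \<theta> \<theta>0) \<in> borel_measurable T"
    and \<theta>0: "\<theta>0 \<in> space T"
    and R: "R = real n * \<epsilon>\<^sup>2" "2 < R" and m: "2 \<le> m"
    and KL0: "KL \<mu> (p \<theta>0) (p (trunc j \<theta>0)) \<le> ereal R"
    and V0: "V \<mu> m (p \<theta>0) (p (trunc j \<theta>0)) \<le> ennreal (R powr (m / 2))"
    and A2: "condition_A2 \<mu> p m H1 n \<epsilon> j \<theta>0"
    and A3: "condition_A3 d D0 D1 D2 Q n K" and A4: "condition_A4 (space T) \<mu> p d c1 \<zeta> Q n K \<theta>0"
    and const: "0 \<le> D0" "0 < D2" "0 < c1" "0 < \<zeta>" "0 < h" "0 \<le> u"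
    and radius: "D0 * real K powr D1 * (real K * h) powr D2 < \<zeta> * u"
    and \<delta>: "0 \<le> \<delta>" "real j * \<delta> \<le> real n powr (- H1)"
    and v: "0 < v" "ennreal v \<le> emeasure (coordinate_prior g \<tau> r j) (PiE {..<j} (\<lambda>i. {\<theta>0 i - \<delta>..\<theta>0 i + \<delta>}))"
    and w: "0 < w" "w \<le> pmf \<pi> j"
    and tail: "\<And>k. k \<le> K \<Longrightarrow> emeasure (coordinate_prior g \<tau> r k)
      {x \<in> space (coordinate_prior g \<tau> r k). real n powr Q < L2_set x {..<k}} \<le> ennreal q"
    and pmf_tail: "emeasure (measure_pmf \<pi>) {K<..} \<le> ennreal s"
    and nonneg: "0 \<le> q" "0 \<le> s"
  shows "(\<integral>\<^sup>+x. posterior (sieve_prior T \<pi> g \<tau> r) p {\<theta> \<in> space T. u\<^sup>2 \<le> (d \<theta> \<theta>0)\<^sup>2} x \<partial>law \<mu> p \<theta>0)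
    \<le> ennreal ((2 * real n powr Q / h + 2) ^ K * exp (- c1 * real n * u\<^sup>2)
        + 4 * R powr (- (m / 2))
        + 2 * exp (6 * R) / (w * v) * (exp (- c1 * real n * u\<^sup>2) + q + s))"
proof -
  let ?e = "exp (- c1 * real n * u\<^sup>2)"
  let ?Pr = "sieve_prior T \<pi> g \<tau> r"
  let ?\<nu> = "coordinate_prior g \<tau> r j"
  let ?A = "PiE {..<j} (\<lambda>i. {\<theta>0 i - \<delta>..\<theta>0 i + \<delta>})"
  let ?B = "{\<theta> \<in> space T. u\<^sup>2 \<le> (d \<theta> \<theta>0)\<^sup>2}"
  interpret mu: sigma_finite_measure \<mu> by (rule \<mu>)
  interpret Pr: subprob_space ?Pr by (rule subprob_space_sieve_prior[OF trunc_meas])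
  note setsPr[measurable_cong] = sets_sieve_prior[OF trunc_meas, of \<pi> g \<tau> r]
  have spacePr: "space ?Pr = space T" by (rule sets_eq_imp_space_eq[OF setsPr])
  have p_theta: "p \<theta> \<in> borel_measurable \<mu>" if "\<theta> \<in> space T" for \<theta>
    using measurable_Pair2[OF p_meas that] by simp
  have trunc_in: "trunc k \<theta> \<in> space T" for k \<theta>
    using sieve_subset_space[OF trunc_meas, of k] by (auto simp: trunc_def sieve_def)
  have sieveK: "sieve K \<subseteq> space T" by (rule sieve_subset_space[OF trunc_meas])
  have law_eq: "law \<mu> p \<theta>0 = density \<mu> (\<lambda>x. ennreal (p \<theta>0 x))" by (simp add: law_def)
  have fin_nu: "finite_measure ?\<nu>"
    using coordinate_prior_le_1[of g \<tau> r j] by (intro finite_measureI) (auto simp: top_unique)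
  have A: "?A \<in> sets ?\<nu>" unfolding sets_coordinate_prior by (intro sets_PiM_I_finite) auto
  have v_le: "v \<le> measure ?\<nu> A" if "A = ?A" for A
    using v finite_measure.emeasure_eq_measure[OF fin_nu, of ?A] that by (simp add: ennreal_le_iff)
  have B[measurable]: "?B \<in> sets T" using d_meas by measurable
  have B_ge: "u \<le> d \<theta> \<theta>0" if "\<theta> \<in> ?B" for \<theta>
  proof (rule power2_le_imp_le)
    show "0 \<le> d \<theta> \<theta>0" using that d \<theta>0 by (auto simp: semimetric_on_def)
  qed (use that in auto)
  obtain \<Phi> where \<Phi>[measurable]: "\<Phi> \<in> borel_measurable \<mu>"
    and \<Phi>01: "\<And>x. x \<in> space \<mu> \<Longrightarrow> 0 \<le> \<Phi> x \<and> \<Phi> x \<le> 1"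
    and type1: "(\<integral>\<^sup>+x. ennreal (p \<theta>0 x) * ennreal (\<Phi> x) \<partial>\<mu>) \<le> ennreal ((2 * real n powr Q / h + 2) ^ K * ?e)"
    and type2: "\<And>\<theta>. \<lbrakk>\<theta> \<in> sieve_ball K Q n; u \<le> d \<theta> \<theta>0\<rbrakk> \<Longrightarrow>
      (\<integral>\<^sup>+x. ennreal (1 - \<Phi> x) * ennreal (p \<theta> x) \<partial>\<mu>) \<le> ennreal ?e"
    using global_test[OF p_theta p_prob d sieveK \<theta>0 A3 A4 const radius] by blast
  have joint: "(\<lambda>(y, x). p (trunc j y) x) \<in> borel_measurable (?\<nu> \<Otimes>\<^sub>M \<mu>)"
  proof -
    have t[measurable]: "trunc j \<in> ?\<nu> \<rightarrow>\<^sub>M T"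
      using trunc_meas by (simp add: measurable_cong_sets[OF sets_coordinate_prior refl])
    have "(\<lambda>z. (trunc j (fst z), snd z)) \<in> ?\<nu> \<Otimes>\<^sub>M \<mu> \<rightarrow>\<^sub>M T \<Otimes>\<^sub>M \<mu>" by measurable
    from measurable_compose[OF this p_meas] show ?thesis by (simp add: case_prod_beta)
  qed
  have small: "emeasure (density \<mu> (\<lambda>x. ennreal (p \<theta>0 x))) {x \<in> space \<mu>. p (trunc j y) x < exp (- (6 * R)) * p \<theta>0 x}
      \<le> ennreal (2 * R powr (- (m / 2)))" if "y \<in> ?A" for y
  proof -
    have "(\<Sum>i<j. \<bar>(trunc j \<theta>0 - trunc j y) i\<bar>) \<le> (\<Sum>i<j. \<delta>)"
    proof (rule sum_mono)
      fix i assume "i \<in> {..<j}"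
      thus "\<bar>(trunc j \<theta>0 - trunc j y) i\<bar> \<le> \<delta>" using that by (force simp: trunc_def PiE_iff abs_le_iff)
    qed
    hence "L2_set (trunc j \<theta>0 - trunc j y) {..<j} \<le> real n powr (- H1)"
      using L2_set_le_sum_abs[of "trunc j \<theta>0 - trunc j y" "{..<j}"] \<delta>(2) by simp
    hence "trunc j y \<in> nbhd_A H1 n j \<theta>0" by (simp add: nbhd_A_def sieve_def trunc_def)
    hence nb: "trunc j y \<in> nbhd_B \<mu> p m n \<epsilon> j \<theta>0" using A2 by (auto simp: condition_A2_def)
    show ?thesis
    proof (rule small_likelihood_ratio_prob[OF p_theta p_theta p_theta _ _ m R(2) KL0 V0])
      show "prob_space (density \<mu> (\<lambda>x. ennreal (p \<theta>0 x)))" using p_prob[OF \<theta>0] by (simp add: law_def)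
    qed (use nb R p_nonneg \<theta>0 trunc_in in \<open>auto simp: nbhd_B_def\<close>)
  qed
  have "0 < measure ?\<nu> ?A" using v_le v(1) by (meson less_le_trans)
  then obtain E where E: "E \<in> sets \<mu>"
    "emeasure (density \<mu> (\<lambda>x. ennreal (p \<theta>0 x))) (space \<mu> - E) \<le> ennreal (2 * (2 * R powr (- (m / 2))))"
    "\<And>x. x \<in> E \<Longrightarrow> ennreal (exp (- (6 * R)) * p \<theta>0 x * measure ?\<nu> ?A / 2) \<le> (\<integral>\<^sup>+y\<in>?A. ennreal (p (trunc j y) x) \<partial>?\<nu>)"
    using evidence_lower_bound[OF \<mu> fin_nu A _ joint p_theta[OF \<theta>0], of "exp (- (6 * R))" "2 * R powr (- (m / 2))"]
      small p_nonneg[OF \<theta>0] by auto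
  define e where "e = w * exp (- (6 * R)) * v / 2"
  have e: "0 < e" using w v by (simp add: e_def)
  have evidence: "ennreal (e * p \<theta>0 x) \<le> (\<integral>\<^sup>+\<theta>. ennreal (p \<theta> x) \<partial>?Pr)" if x: "x \<in> E" for x
  proof -
    have xs: "x \<in> space \<mu>" using x E(1) sets.sets_into_space by auto
    have p0: "0 \<le> p \<theta>0 x" using p_nonneg \<theta>0 xs by blast
    have px: "(\<lambda>\<theta>. ennreal (p \<theta> x)) \<in> borel_measurable T"
      using measurable_Pair1[OF p_meas xs] by simp
    have "exp (- (6 * R)) * p \<theta>0 x * v / 2 \<le> exp (- (6 * R)) * p \<theta>0 x * measure ?\<nu> ?A / 2"
      using v_le[OF refl] p0 by (intro divide_right_mono mult_left_mono) auto
    hence "w * (exp (- (6 * R)) * p \<theta>0 x * v / 2) \<le> pmf \<pi> j * (exp (- (6 * R)) * p \<theta>0 x * measure ?\<nu> ?A / 2)"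
      using w v p0 by (intro mult_mono) auto
    hence "ennreal (e * p \<theta>0 x) \<le> ennreal (pmf \<pi> j) * ennreal (exp (- (6 * R)) * p \<theta>0 x * measure ?\<nu> ?A / 2)"
      using p0 by (simp add: e_def mult_ac ennreal_leI flip: ennreal_mult)
    also have "\<dots> \<le> ennreal (pmf \<pi> j) * (\<integral>\<^sup>+y\<in>?A. ennreal (p (trunc j y) x) \<partial>?\<nu>)"
      using E(3)[OF x] by (rule mult_left_mono) simp
    also have "\<dots> \<le> (\<integral>\<^sup>+\<theta>. ennreal (p \<theta> x) \<partial>?Pr)"
      by (rule sieve_prior_integral_ge[OF trunc_meas px])
    finally show ?thesis .
  qed
  let ?f = "\<lambda>\<theta>. (\<integral>\<^sup>+x. ennreal (1 - \<Phi> x) * ennreal (p \<theta> x) \<partial>\<mu>) * indicator ?B \<theta>"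
  have f[measurable]: "?f \<in> borel_measurable T" by measurable
  have f1: "?f \<theta> \<le> 1" if "\<theta> \<in> space T" for \<theta>
  proof -
    interpret P: prob_space "law \<mu> p \<theta>" by (rule p_prob[OF that])
    have "(\<integral>\<^sup>+x. ennreal (1 - \<Phi> x) * ennreal (p \<theta> x) \<partial>\<mu>) \<le> (\<integral>\<^sup>+x. 1 * ennreal (p \<theta> x) \<partial>\<mu>)"
      using \<Phi>01 by (intro nn_integral_mono mult_right_mono) auto
    also have "\<dots> = emeasure (law \<mu> p \<theta>) (space \<mu>)"
      unfolding law_def using p_theta[OF that] by (simp add: emeasure_density cong: nn_integral_cong)
    also have "\<dots> = 1" using P.emeasure_space_1 by (simp add: law_def)
    finally show ?thesis by (auto split: split_indicator)
  qed
  have f_small: "?f (trunc k x) \<le> ennreal ?e"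
    if "k \<le> K" "L2_set x {..<k} \<le> real n powr Q" for k x
  proof (cases "trunc k x \<in> ?B")
    case True
    have "L2_set (trunc k x) {..<K} = L2_set x {..<k}"
    proof -
      have "(\<Sum>i<K. (trunc k x i)\<^sup>2) = (\<Sum>i<k. (trunc k x i)\<^sup>2)"
        using that by (intro sum.mono_neutral_right) (auto simp: trunc_def)
      thus ?thesis by (simp add: L2_set_def trunc_def)
    qed
    hence "trunc k x \<in> sieve_ball K Q n" using that by (simp add: sieve_ball_def sieve_def trunc_def)
    from type2[OF this B_ge[OF True]] show ?thesis using True by simp
  qed simp
  have "(\<integral>\<^sup>+\<theta>. ?f \<theta> \<partial>?Pr) \<le> ennreal ?e + ennreal q + emeasure (measure_pmf \<pi>) {K<..}"
    by (rule sieve_prior_integral_le[OF trunc_meas f f1 f_small tail]) auto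
  also have "\<dots> \<le> ennreal ?e + ennreal q + ennreal s" using pmf_tail by (rule add_left_mono)
  finally have type2_int: "(\<integral>\<^sup>+\<theta>. ?f \<theta> \<partial>?Pr) \<le> ennreal (?e + q + s)" using nonneg by simp
  have "(\<integral>\<^sup>+x. posterior ?Pr p ?B x \<partial>law \<mu> p \<theta>0)
    \<le> (\<integral>\<^sup>+x. ennreal (p \<theta>0 x) * ennreal (\<Phi> x) \<partial>\<mu>)
      + emeasure (density \<mu> (\<lambda>x. ennreal (p \<theta>0 x))) (space \<mu> - E)
      + ennreal (1 / e) * (\<integral>\<^sup>+\<theta>. ?f \<theta> \<partial>?Pr)"
    unfolding law_eq
  proof (rule expected_posterior_le[OF \<mu> _ _ p_theta[OF \<theta>0] _ _ \<Phi> \<Phi>01 E(1) e evidence])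
    show "sigma_finite_measure ?Pr" by unfold_locales
    show "(\<lambda>(\<theta>, x). p \<theta> x) \<in> borel_measurable (?Pr \<Otimes>\<^sub>M \<mu>)" by measurable
    show "?B \<in> sets ?Pr" by (simp add: setsPr)
  qed (use p_nonneg \<theta>0 in auto)
  also have "\<dots> \<le> ennreal ((2 * real n powr Q / h + 2) ^ K * ?e) + ennreal (2 * (2 * R powr (- (m / 2))))
      + ennreal (1 / e) * ennreal (?e + q + s)"
    using type1 E(2) type2_int by (intro add_mono mult_left_mono) auto
  also have "\<dots> = ennreal ((2 * real n powr Q / h + 2) ^ K * ?e + 4 * R powr (- (m / 2)) + 1 / e * (?e + q + s))"
    using nonneg e const(5) by (simp flip: ennreal_plus ennreal_mult)
  also have "1 / e = 2 * exp (6 * R) / (w * v)" by (simp add: e_def exp_minus field_simps)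
  finally show ?thesis .
qed

text \<open>
  The numerical hypotheses hold for large \<open>n\<close>, uniformly in the smoothness. Since \<open>exp (- j ln n) \<le> 1 / n\<close>,
  the constants in the exponents make each error term at most a multiple of \<open>1 / n\<close>, even after division by the evidence. The exception
  is the probability of a small evidence: it is of order \<open>1 / R\<close>, and \<open>R\<close> is at least \<open>ln n / j0\<close>.
\<close>

lemma posterior_bound_at_sample_size:
  fixes T :: "param measure" and \<mu> :: "nat \<Rightarrow> 'x measure" and p :: "nat \<Rightarrow> param \<Rightarrow> 'x \<Rightarrow> real"
  assumes model: "statistical_model T \<mu> p d" and prior: "prior_data \<pi> g \<tau>"
    and L: "\<And>x. 1 \<le> x \<Longrightarrow> 0 < L x"
    and \<theta>0: "\<theta>0 \<in> sobolev (space T) \<beta> L0" and \<beta>: "1 / 2 < \<beta>" and r: "ereal (2 * (\<Sum>i. \<bar>\<theta>0 i\<bar>)) < r"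
    and const: "0 < L0" "2 \<le> m" "0 < j0" "0 < C0" "0 < H1" "0 \<le> D0" "0 \<le> D1" "0 < D2" "0 < c1" "0 < \<zeta>"
      "0 < a" "0 < b" "0 < C" "0 < G1" "0 < G2" "0 < G3" "0 < G4" "0 < H2" "0 < \<alpha>" "0 < \<tau>0"
    and \<epsilon>0: "0 < \<epsilon>0" "(C0 + C0\<^sup>2) * L0 \<le> \<epsilon>0\<^sup>2" "1 \<le> j0 * \<epsilon>0\<^sup>2"
    and defs: "\<epsilon> = rate \<epsilon>0 \<beta> n" "j = j_int j0 \<epsilon> n" "k = k_int M0 L j n"
      "R = real n * \<epsilon>\<^sup>2" "H = H1 + H2 + 1"
      "cB = 12 / j0 + a + (H + 1 + G2 * 2 powr \<alpha> * (C + 1))"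
      "u = sqrt (M * (ln (real n) / L (real n))) * \<epsilon>"
    and tuning: "0 < c" "1 \<le> M0" "(cB + 2) / (b * c) \<le> M0" "1 + 1 / \<alpha> \<le> Q" "1 \<le> M"
      "j0 / c1 * ((Q + (D1 + 1) / D2 + 2) * M0 + cB + 1) \<le> M"
    and approx: "approximation_condition (\<mu> n) (p n) m C0 n j \<theta>0"
    and A2: "condition_A2 (\<mu> n) (p n) m H1 n \<epsilon> j \<theta>0"
    and A3: "condition_A3 (d n) D0 D1 D2 Q n k"
    and A4: "condition_A4 (space T) (\<mu> n) (p n) (d n) c1 \<zeta> Q n k \<theta>0"
    and A5: "condition_A5 L (\<pi> n) (g n) (\<tau> n) a b C G1 G2 G3 G4 H2 \<alpha> \<tau>0 n j k \<theta>0"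
    and j: "real n powr \<gamma> \<le> real j" "real j \<le> sqrt (real n)"
      "real j * ln (real n) \<le> j0 * R" "j0 * R \<le> 2 * real j * ln (real n)"
      "j0 * R < (real j + 1) * ln (real n)"
    and \<gamma>: "0 < \<gamma>"
    and L_log: "L (real n) \<le> ln (real n)" "L (real j) \<le> ln (real j)"
    and L_power: "\<And>y. real n powr \<gamma> \<le> y \<Longrightarrow> y \<le> real n \<Longrightarrow> c * L (real n) \<le> L y"
    and L_lower: "\<And>y. real n \<le> y \<Longrightarrow> y powr (- (1 / 4)) \<le> L y"
    and n: "4 \<le> n" "M0 * (sqrt (real n) * ln (real n) * real n powr (1 / 4)) \<le> real n"
      "D0 < \<zeta> * sqrt (real n)" "1 / real n \<le> 2 * G1 / \<tau>0" "2 * j0 < ln (real n)"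
      "\<And>i. n < i \<Longrightarrow> exp (- (b / 2 * real i powr (3 / 4))) \<le> 1 / (real i)\<^sup>2"
      "exp (cB * (sqrt (real n) * ln (real n))) * exp (- (b / 2 * real n powr (3 / 4))) \<le> 1 / real n"
      "exp (cB * (sqrt (real n) * ln (real n))) *
        (real n * (G3 * (2 * G2 / G4) powr (1 / \<alpha>) / G1 * exp (- (G4 / 2 / \<tau>0 powr \<alpha> * real n)))) \<le> 1 / real n"
    and r_large: "r = \<infinity> \<or> r \<le> ereal (real n powr Q)" "ereal (2 * (sqrt (real n) * real n powr (- H))) \<le> r"
  shows "(\<integral>\<^sup>+x. posterior (sieve_prior T (\<pi> n) (g n) (\<tau> n) r) (p n)
      {\<theta> \<in> space T. u\<^sup>2 \<le> (d n \<theta> \<theta>0)\<^sup>2} x \<partial>law (\<mu> n) (p n) \<theta>0)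
    \<le> ennreal (13 / real n + 4 * j0 / ln (real n))"
proof -
  define l where "l = ln (real n)"
  define J where "J = real j * l"
  let ?cA = "H + 1 + G2 * 2 powr \<alpha> * (C + 1)"
  let ?\<rho> = "(D1 + 1) / D2"
  let ?\<Lambda> = "L (real n)"
  have n4: "4 \<le> real n" using n(1) by simp
  have l1: "1 \<le> l"
  proof -
    have "exp 1 \<le> real n" using exp_le n4 by linarith
    thus ?thesis using n4 unfolding l_def by (subst ln_ge_iff) auto
  qed
  have H: "H2 \<le> H" "0 \<le> H" "1 \<le> H" using const defs(5) by auto
  have cA: "0 \<le> ?cA" using H const by simp
  have cB: "0 < cB" using cA const unfolding defs(6) by (intro add_pos_nonneg add_pos_pos) auto
  have j1: "1 \<le> j"
  proof -
    have "1 \<le> real n powr \<gamma>" using n4 \<gamma> by (intro ge_one_powr_ge_zero) auto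
    thus ?thesis using j(1) by linarith
  qed
  have j_le_n: "real j \<le> real n"
  proof -
    have "sqrt (real n) * 1 \<le> sqrt (real n) * sqrt (real n)" using n4 by (intro mult_left_mono) auto
    thus ?thesis using j(2) n4 by simp
  qed
  have J1: "l \<le> J" using j1 l1 mult_right_mono[of 1 "real j" l] by (simp add: J_def)
  have J2: "J \<le> sqrt (real n) * l" unfolding J_def using j(2) l1 by (intro mult_right_mono) auto
  have J0: "0 \<le> J" using J1 l1 by linarith
  have expl: "exp (- l) = 1 / real n" using n4 by (simp add: l_def exp_minus inverse_eq_divide)
  have Rj: "J \<le> j0 * R" "j0 * R \<le> 2 * J" using j(3,4) by (simp_all add: J_def l_def)
  have R_ge: "l / j0 \<le> R" using Rj(1) J1 const(3) by (simp add: field_simps)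
  have R2: "2 < R"
  proof -
    have "2 < l / j0" using n(5) const(3) by (simp add: l_def field_simps)
    thus ?thesis using R_ge by linarith
  qed
  have \<Lambda>: "0 < ?\<Lambda>" using L n4 by simp
  have f1: "1 \<le> l / ?\<Lambda>" using L_log(1) \<Lambda> by (simp add: l_def)
  \<comment> \<open>\<open>x\<close> is the real number whose floor is \<open>k\<close>\<close>
  define x where "x = M0 * real j * l / ?\<Lambda>"
  have xj: "real j \<le> x"
  proof -
    have "1 * real j * 1 \<le> M0 * real j * (l / ?\<Lambda>)" using tuning(2) f1 by (intro mult_mono) auto
    thus ?thesis by (simp add: x_def)
  qed
  have kx: "real k = of_int \<lfloor>x\<rfloor>"
    unfolding defs(3) k_int_def l_def[symmetric] x_def[symmetric] using xj by simp
  have k_le: "real k \<le> x" "x < real k + 1" unfolding kx by linarith+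
  have jk: "j \<le> k"
  proof -
    have "int j \<le> \<lfloor>x\<rfloor>" using xj by (simp add: le_floor_iff)
    thus ?thesis using kx by linarith
  qed
  have kn: "k \<le> n"
  proof -
    have "1 / ?\<Lambda> \<le> real n powr (1 / 4)"
    proof -
      have "real n powr (- (1 / 4)) \<le> ?\<Lambda>" using L_lower by simp
      hence "real n powr (1 / 4) * real n powr (- (1 / 4)) \<le> real n powr (1 / 4) * ?\<Lambda>"
        by (rule mult_left_mono) simp
      hence "1 \<le> real n powr (1 / 4) * ?\<Lambda>" using n4 by (simp flip: powr_add)
      thus ?thesis using \<Lambda> by (simp add: field_simps)
    qed
    hence "M0 * (real j * l) * (1 / ?\<Lambda>) \<le> M0 * (sqrt (real n) * l) * real n powr (1 / 4)"
      using J2 J0 tuning(2) l1 less_imp_le[OF \<Lambda>] by (intro mult_mono) (auto simp: J_def)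
    hence "x \<le> M0 * (sqrt (real n) * l * real n powr (1 / 4))" by (simp add: x_def mult_ac)
    thus ?thesis using n(2) k_le(1) by (simp add: l_def)
  qed
  have trunc_meas: "\<And>k. trunc k \<in> PiM {..<k} (\<lambda>_. lborel) \<rightarrow>\<^sub>M T"
    and \<mu>: "sigma_finite_measure (\<mu> n)"
    and p_meas: "(\<lambda>(\<theta>, x). p n \<theta> x) \<in> borel_measurable (T \<Otimes>\<^sub>M \<mu> n)"
    and p_nonneg: "\<And>\<theta> x. \<theta> \<in> space T \<Longrightarrow> x \<in> space (\<mu> n) \<Longrightarrow> 0 \<le> p n \<theta> x"
    and p_prob: "\<And>\<theta>. \<theta> \<in> space T \<Longrightarrow> prob_space (law (\<mu> n) (p n) \<theta>)"
    and d: "semimetric_on (space T) (d n)"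
    and d_meas: "\<And>\<theta>'. \<theta>' \<in> space T \<Longrightarrow> (\<lambda>\<theta>. d n \<theta> \<theta>') \<in> borel_measurable T"
    using model by (auto simp: statistical_model_def)
  have g: "g n \<in> borel_measurable borel" "\<And>t. 0 \<le> g n t" "(\<integral>\<^sup>+t. ennreal (g n t) \<partial>lborel) = 1"
    and \<tau>: "\<And>i. 0 < \<tau> n i"
    using prior by (auto simp: prior_data_def)
  have \<theta>0T: "\<theta>0 \<in> space T" using \<theta>0 by (simp add: sobolev_def)
  have pmf: "\<And>i. 1 \<le> i \<Longrightarrow> exp (- a * real i * L (real i)) \<le> pmf (\<pi> n) i"
      "\<And>i. 1 \<le> i \<Longrightarrow> pmf (\<pi> n) i \<le> exp (- b * real i * L (real i))"
    and g_lower: "\<And>t. G1 * exp (- G2 * \<bar>t\<bar> powr \<alpha>) \<le> g n t"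
    and g_upper: "\<And>t. g n t \<le> G3 * exp (- G4 * \<bar>t\<bar> powr \<alpha>)"
    and \<tau>0: "\<And>i. \<tau> n i \<le> \<tau>0" and \<tau>_ge: "\<And>i. i < k \<Longrightarrow> real n powr (- H2) \<le> \<tau> n i"
    and scaled: "(\<Sum>i<j. \<bar>\<theta>0 i\<bar> powr \<alpha> / \<tau> n i powr \<alpha>) \<le> C * real j * ln (real n)"
    using A5 by (auto simp: condition_A5_def)
  have bias: "(C0 + C0\<^sup>2) * L0 * (real j + 1) powr (- (2 * \<beta>)) \<le> \<epsilon>\<^sup>2"
    unfolding defs(1)
  proof (rule bias_le_rate)
    show "j0 * (real n * (rate \<epsilon>0 \<beta> n)\<^sup>2) < (real j + 1) * ln (real n)"
      using j(5) defs(1,4) by simp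
  qed (use n(1) \<beta> const \<epsilon>0 in auto)
  have \<beta>0: "0 < \<beta>" "0 \<le> m" using \<beta> const by auto
  note KLV = approximation_divergences[OF approx \<theta>0 \<beta>0(1) bias const(4) \<beta>0(2), folded defs(4)]
  let ?\<delta> = "real n powr (- H)"
  have jd: "real j * ?\<delta> \<le> real n powr (- H1)"
  proof -
    have "real j * ?\<delta> \<le> real n powr 1 * ?\<delta>" using j_le_n n4 by (intro mult_right_mono) auto
    also have "\<dots> = real n powr (1 - H)" by (simp only: powr_add[symmetric]) simp
    also have "\<dots> \<le> real n powr (- H1)" using n4 const defs(5) by (intro powr_mono) auto
    finally show ?thesis .
  qed
  \<comment> \<open>half of the truncation level is left for the box, as \<open>r\<close> exceeds twice the sum for the truth\<close>
  have r_box: "ereal ((\<Sum>i<j. \<bar>\<theta>0 i\<bar>) + real j * ?\<delta>) \<le> r"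
  proof (cases "r = \<infinity>")
    case False
    have "(\<Sum>i<j. \<bar>\<theta>0 i\<bar>) \<le> (\<Sum>i. \<bar>\<theta>0 i\<bar>)"
      using sobolev_abs_summable[OF \<theta>0 \<beta>] by (intro sum_le_suminf) auto
    moreover have "real j * ?\<delta> \<le> sqrt (real n) * ?\<delta>" using j(2) by (intro mult_right_mono) auto
    moreover obtain r' where "r = ereal r'" using False r by (cases r) auto
    ultimately show ?thesis using r r_large(2) by simp
  qed simp
  have box: "ennreal (exp (- (?cA * real j * ln (real n))))
    \<le> emeasure (coordinate_prior (g n) (\<tau> n) r j) (PiE {..<j} (\<lambda>i. {\<theta>0 i - ?\<delta>..\<theta>0 i + ?\<delta>}))"
    by (rule coordinate_prior_box_exp[OF g \<tau> \<tau>0 _ g_lower scaled _ _ _ _ _ _ _ _ r_box])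
      (use \<tau>_ge jk const H n(1,4) in auto)
  have w: "exp (- a * J) \<le> pmf (\<pi> n) j"
  proof -
    have "L (real j) \<le> l" using L_log(2) j1 j_le_n l_def ln_le_cancel_iff[of "real j" "real n"] n4
      by linarith
    hence "a * (real j * L (real j)) \<le> a * (real j * l)" using const by (intro mult_left_mono) auto
    hence "exp (- a * J) \<le> exp (- a * real j * L (real j))" by (simp add: J_def mult.assoc)
    thus ?thesis using pmf(1)[OF j1] by linarith
  qed
  \<comment> \<open>up to \<open>n\<close> the exponent \<open>i L i\<close> is compared with \<open>k L n\<close>; beyond \<open>n\<close> half of the exponent
    \<open>b i powr (3 / 4)\<close> makes the sum converge and the other half makes it small\<close>
  let ?t = "exp (- (b / 2 * real n powr (3 / 4)))"
  have pmf_tail: "emeasure (measure_pmf (\<pi> n)) {k<..} \<le> ennreal (real n * exp (- ((cB + 2) * J)) + 3 * ?t)"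
  proof (rule emeasure_pmf_tail_le)
    fix i assume i: "k < i" "i \<le> n"
    have "real n powr \<gamma> \<le> real i" using j(1) jk i(1) by linarith
    hence cL: "c * ?\<Lambda> \<le> L (real i)" using L_power i(2) by simp
    have "x \<le> real i" using k_le(2) i(1) by linarith
    hence "x * (c * ?\<Lambda>) \<le> real i * L (real i)" using cL xj \<Lambda> tuning(1) by (intro mult_mono) auto
    moreover have "x * (c * ?\<Lambda>) = c * M0 * J" using \<Lambda> by (simp add: x_def J_def)
    moreover have "(cB + 2) * J \<le> b * (c * M0 * J)"
    proof -
      have "cB + 2 \<le> b * c * M0" using tuning(1,3) const by (simp add: field_simps)
      thus ?thesis using J0 mult_right_mono[of "cB + 2" "b * c * M0" J] by (simp add: mult.assoc)
    qed
    ultimately have "(cB + 2) * J \<le> b * (real i * L (real i))"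
      using const(12) mult_left_mono[of "c * M0 * J" "real i * L (real i)" b] by linarith
    hence "exp (- b * real i * L (real i)) \<le> exp (- ((cB + 2) * J))" by (simp add: mult.assoc)
    thus "pmf (\<pi> n) i \<le> exp (- ((cB + 2) * J))" using pmf(2)[of i] i by linarith
  next
    fix i assume i: "n < i"
    have ri: "real n \<le> real i" "0 < real i" using i by auto
    let ?y = "b / 2 * real i powr (3 / 4)"
    have "real i powr (3 / 4) = real i powr 1 * real i powr (- (1 / 4))"
      by (simp only: powr_add[symmetric]) simp
    also have "\<dots> \<le> real i * L (real i)" using L_lower[OF ri(1)] ri by (simp add: mult_left_mono)
    finally have "b * real i powr (3 / 4) \<le> b * (real i * L (real i))" using const by simp
    hence "exp (- b * real i * L (real i)) \<le> exp (- ?y) * exp (- ?y)" by (simp add: mult.assoc flip: exp_add)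
    also have "\<dots> \<le> ?t * (1 / (real i)\<^sup>2)"
    proof (rule mult_mono)
      have "b / 2 * real n powr (3 / 4) \<le> ?y" using ri const by (intro mult_left_mono powr_mono2) auto
      thus "exp (- ?y) \<le> ?t" by simp
    qed (use n(6)[OF i] in auto)
    finally show "pmf (\<pi> n) i \<le> ?t / (real i)\<^sup>2" using pmf(2)[of i] i by simp
  qed auto
  define q where "q = real n * (G3 * (2 * G2 / G4) powr (1 / \<alpha>) / G1 * exp (- (G4 / 2 / \<tau>0 powr \<alpha> * real n)))"
  have q0: "0 \<le> q" using const by (simp add: q_def)
  have tail: "emeasure (coordinate_prior (g n) (\<tau> n) r i)
      {x \<in> space (coordinate_prior (g n) (\<tau> n) r i). real n powr Q < L2_set x {..<i}} \<le> ennreal q" if "i \<le> k" for i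
    unfolding q_def using that kn
    by (intro sieve_truncation_tail[OF g \<tau> \<tau>0 g_lower g_upper const(14-17,19,20) r_large(1) tuning(4)]) auto
  have M: "0 \<le> M * (l / ?\<Lambda>)" using f1 tuning(5) by (intro mult_nonneg_nonneg) linarith+
  have usq: "u\<^sup>2 = M * (l / ?\<Lambda>) * \<epsilon>\<^sup>2" unfolding defs(7) l_def[symmetric] using M by (simp add: power_mult_distrib)
  have \<epsilon>_pos: "0 \<le> \<epsilon>" unfolding defs(1) rate_def using \<epsilon>0 by simp
  have u0: "0 \<le> u" unfolding defs(7) using \<epsilon>_pos M by (simp add: l_def)
  have nu: "real n * u\<^sup>2 = M * (ln (real n) / ?\<Lambda>) * R" unfolding usq defs(4) l_def by simp
  have u_ge: "1 / real n \<le> u\<^sup>2"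
  proof -
    have "1 * (1 * 1) \<le> M * (l / ?\<Lambda>) * R" unfolding mult.assoc
      using tuning(5) f1 R2 by (intro mult_mono) auto
    hence "1 \<le> real n * u\<^sup>2" using nu by (simp add: l_def)
    thus ?thesis using n4 by (simp add: field_simps)
  qed
  have radius: "D0 * real k powr D1 * (real k * real n powr (- (?\<rho> + 1))) powr D2 < \<zeta> * u"
    using n(1,3) kn const u_ge u0 by (intro net_radius) auto

  have kJ: "real k \<le> M0 * real j * (ln (real n) / ?\<Lambda>)" using k_le(1) by (simp add: x_def l_def)
  have \<rho>0: "0 \<le> ?\<rho>" using const by simp
  have Q0: "0 \<le> Q"
  proof -
    have "0 < 1 / \<alpha>" using const by simp
    thus ?thesis using tuning(4) by linarith
  qed
  note cov = covering_exponent[OF n(1) \<rho>0 Q0 kJ nu j(3) \<Lambda> L_log(1) const(9,3) of_nat_0_le_iff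
      less_imp_le[OF cB] order.trans[OF zero_le_one tuning(2)] tuning(6), folded l_def, folded J_def]
  have "(\<integral>\<^sup>+x. posterior (sieve_prior T (\<pi> n) (g n) (\<tau> n) r) (p n)
      {\<theta> \<in> space T. u\<^sup>2 \<le> (d n \<theta> \<theta>0)\<^sup>2} x \<partial>law (\<mu> n) (p n) \<theta>0)
    \<le> ennreal ((2 * real n powr Q / real n powr (- (?\<rho> + 1)) + 2) ^ k * exp (- c1 * real n * u\<^sup>2)
        + 4 * R powr (- (m / 2))
        + 2 * exp (6 * R) / (exp (- a * J) * exp (- (?cA * real j * ln (real n)))) *
          (exp (- c1 * real n * u\<^sup>2) + q + (real n * exp (- ((cB + 2) * J)) + 3 * ?t)))"
    by (rule posterior_mass_bound[OF trunc_meas \<mu> p_meas p_nonneg p_prob d d_meas[OF \<theta>0T] \<theta>0T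
          defs(4) R2 const(2) KLV A2 A3 A4 const(6,8,9,10) _ u0 radius _ jd _ box _ w tail pmf_tail q0])
      (use n4 in auto)
  also have "\<dots> \<le> ennreal (13 / real n + 4 * j0 / ln (real n))"
  proof (rule ennreal_leI)
    have t1: "(2 * real n powr Q / real n powr (- (?\<rho> + 1)) + 2) ^ k * exp (- c1 * real n * u\<^sup>2) \<le> 1 / real n"
      using cov(1) J1 unfolding expl[symmetric] by (meson exp_le_cancel_iff neg_le_iff_le order.trans)
    have t2: "4 * R powr (- (m / 2)) \<le> 4 * j0 / ln (real n)"
    proof -
      have "R powr (- (m / 2)) \<le> R powr (- 1)" using R2 const(2) by (intro powr_mono) auto
      also have "\<dots> = 1 / R" using R2 by (simp add: powr_minus inverse_eq_divide)
      also have "\<dots> \<le> 1 / (l / j0)"         using R_ge R2 l1 const(3) by (intro divide_left_mono mult_pos_pos divide_pos_pos) auto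
      finally show ?thesis by (simp add: l_def)
    qed
    have evidence: "exp (6 * R) / (exp (- a * J) * exp (- (?cA * real j * ln (real n)))) \<le> exp (cB * J)"
    proof -
      have "6 * R \<le> 12 / j0 * J" using Rj(2) const(3) by (simp add: field_simps)
      moreover have "exp (6 * R) / (exp (- a * J) * exp (- (?cA * real j * ln (real n)))) = exp (6 * R + a * J + ?cA * J)"
        by (simp add: J_def l_def exp_minus exp_add divide_inverse mult_ac)
      moreover have "cB * J = 12 / j0 * J + a * J + ?cA * J" unfolding defs(6) by (simp only: distrib_right)
      ultimately show ?thesis by simp
    qed
    have eJ: "exp (- J) \<le> 1 / real n" using J1 unfolding expl[symmetric] by simp
    have GJ: "exp (cB * J) \<le> exp (cB * (sqrt (real n) * ln (real n)))"
      using J2 cB by (simp add: l_def)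
    have e1: "exp (cB * J) * exp (- c1 * real n * u\<^sup>2) \<le> 1 / real n"
    proof -
      have "exp (cB * J) * exp (- c1 * real n * u\<^sup>2) \<le> exp (cB * J) * exp (- ((cB + 1) * J))"
        using cov(2) by (intro mult_left_mono) auto
      also have "\<dots> = exp (- J)" by (simp flip: exp_add add: algebra_simps)
      finally show ?thesis using eJ by linarith
    qed
    have e2: "exp (cB * J) * q \<le> 1 / real n"
      using mult_right_mono[OF GJ q0] n(8) unfolding q_def by linarith
    have e3: "exp (cB * J) * (real n * exp (- ((cB + 2) * J))) \<le> 1 / real n"
    proof -
      have "exp (cB * J) * (real n * exp (- ((cB + 2) * J))) = real n * (exp (- J) * exp (- J))"
        by (simp flip: exp_add add: algebra_simps)
      also have "\<dots> \<le> real n * (1 / real n * (1 / real n))"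
        using eJ by (intro mult_left_mono mult_mono) auto
      finally show ?thesis using n4 by simp
    qed
    have e4: "exp (cB * J) * ?t \<le> 1 / real n"
      by (rule order.trans[OF mult_right_mono[OF GJ] n(7)]) simp
    let ?S = "exp (- c1 * real n * u\<^sup>2) + q + (real n * exp (- ((cB + 2) * J)) + 3 * ?t)"
    have "exp (6 * R) / (exp (- a * J) * exp (- (?cA * real j * ln (real n)))) * ?S \<le> exp (cB * J) * ?S"
      using q0 by (intro mult_right_mono evidence) auto
    also have "\<dots> = exp (cB * J) * exp (- c1 * real n * u\<^sup>2) + exp (cB * J) * q
        + (exp (cB * J) * (real n * exp (- ((cB + 2) * J))) + 3 * (exp (cB * J) * ?t))"
      by (simp only: distrib_left mult.left_commute)
    also have "\<dots> \<le> 1 / real n + 1 / real n + (1 / real n + 3 * (1 / real n))"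
      using e1 e2 e3 e4 by linarith
    finally have t3: "exp (6 * R) / (exp (- a * J) * exp (- (?cA * real j * ln (real n)))) * ?S \<le> 6 / real n"
      by simp
    show "(2 * real n powr Q / real n powr (- (?\<rho> + 1)) + 2) ^ k * exp (- c1 * real n * u\<^sup>2)
        + 4 * R powr (- (m / 2))
        + 2 * exp (6 * R) / (exp (- a * J) * exp (- (?cA * real j * ln (real n)))) * ?S
      \<le> 13 / real n + 4 * j0 / ln (real n)"
      using t1 t2 t3 by simp
  qed
  finally show ?thesis .
qed

section \<open>Contraction of the posterior\<close>

theorem proposition1:
  fixes L :: "real \<Rightarrow> real"
    and L0 \<beta>1 \<beta>2 m j0 C0 H1 D0 D1 D2 c1 \<zeta> :: real
    and a b C G1 G2 G3 G4 H2 \<alpha> \<tau>0 :: real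
    and r :: ereal
  assumes L: "slowly_varying L" "\<forall>\<^sub>F x in at_top. L x \<le> ln x" "power_scale_stable L"
    and params: "0 < L0" "1 / 2 < \<beta>1" "\<beta>1 \<le> \<beta>2" "2 \<le> m" "0 < j0" "0 < C0"
    and A2_const: "0 < H1"
    and A3_const: "0 \<le> D0" "0 \<le> D1" "0 < D2"
    and A4_const: "0 < c1" "0 < \<zeta>" "\<zeta> < 1"
    and A5_const: "0 < a" "0 < b" "0 < C" "0 < G1" "0 < G2" "0 < G3" "0 < G4" "0 < H2"
      "0 < \<alpha>" "0 < \<tau>0"
  shows "\<exists>\<epsilon>0>0. \<exists>M0_min>1. \<exists>Q_min>0. \<forall>M0\<ge>M0_min. \<forall>Q\<ge>Q_min. \<exists>M_min>0. \<forall>M\<ge>M_min.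
    \<forall>(T :: param measure) (\<mu> :: nat \<Rightarrow> 'x measure) (p :: nat \<Rightarrow> param \<Rightarrow> 'x \<Rightarrow> real)
      (d :: nat \<Rightarrow> param \<Rightarrow> param \<Rightarrow> real)
      (\<pi> :: nat \<Rightarrow> nat pmf) (g :: nat \<Rightarrow> real \<Rightarrow> real) (\<tau> :: nat \<Rightarrow> nat \<Rightarrow> real).
      statistical_model T \<mu> p d \<longrightarrow>
      prior_data \<pi> g \<tau> \<longrightarrow>
      (\<forall>\<beta>\<in>{\<beta>1..\<beta>2}. \<forall>\<theta>0\<in>sobolev (space T) \<beta> L0. ereal (2 * (\<Sum>i. \<bar>\<theta>0 i\<bar>)) < r) \<longrightarrow>
      (\<forall>\<^sub>F n in sequentially. \<forall>\<beta>\<in>{\<beta>1..\<beta>2}. \<forall>\<theta>0\<in>sobolev (space T) \<beta> L0.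
         let \<epsilon> = rate \<epsilon>0 \<beta> n; j = j_int j0 \<epsilon> n; k = k_int M0 L j n in
           approximation_condition (\<mu> n) (p n) m C0 n j \<theta>0 \<and>
           condition_A2 (\<mu> n) (p n) m H1 n \<epsilon> j \<theta>0 \<and>
           condition_A3 (d n) D0 D1 D2 Q n k \<and>
           condition_A4 (space T) (\<mu> n) (p n) (d n) c1 \<zeta> Q n k \<theta>0 \<and>
           condition_A5 L (\<pi> n) (g n) (\<tau> n) a b C G1 G2 G3 G4 H2 \<alpha> \<tau>0 n j k \<theta>0) \<longrightarrow>
      ((\<lambda>n. SUP \<beta>\<in>{\<beta>1..\<beta>2}. SUP \<theta>0\<in>sobolev (space T) \<beta> L0.
          \<integral>\<^sup>+x. posterior (sieve_prior T (\<pi> n) (g n) (\<tau> n) r) (p n)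
                 {\<theta> \<in> space T. M * (ln (real n) / L (real n)) * (rate \<epsilon>0 \<beta> n)\<^sup>2 \<le> (d n \<theta> \<theta>0)\<^sup>2} x
            \<partial>law (\<mu> n) (p n) \<theta>0) \<longlonglongrightarrow> 0)"
proof -
  \<comment> \<open>half of the smallest exponent of \<open>n / ln n\<close> in \<open>j\<close>, so that \<open>j \<ge> n powr \<gamma>\<close>\<close>
  define \<gamma> where "\<gamma> = 1 / (2 * (2 * \<beta>2 + 1))"
  have \<gamma>: "0 < \<gamma>" "\<gamma> < 1" using params by (auto simp: \<gamma>_def field_simps)
  have "\<exists>c>0. \<forall>\<^sub>F x in at_top. \<forall>y\<in>{x powr \<gamma>..x}. c * L x \<le> L y"
    using L(3) \<gamma> unfolding power_scale_stable_def by auto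
  then obtain c where c: "0 < c" and c_L: "\<forall>\<^sub>F x in at_top. \<forall>y\<in>{x powr \<gamma>..x}. c * L x \<le> L y" by blast
  define H where "H = H1 + H2 + 1"
  \<comment> \<open>the evidence is at least \<open>exp (- cB j ln n)\<close> up to a factor: the summands come from the likelihood
    ratio, the prior probability of the index \<open>j\<close>, and the box\<close>
  define cB where "cB = 12 / j0 + a + (H + 1 + G2 * 2 powr \<alpha> * (C + 1))"
  have H1: "1 < H" using A2_const A5_const by (simp add: H_def)
  have cB: "0 < cB"
    using H1 A5_const params unfolding cB_def by (intro add_pos_pos mult_pos_pos) auto
  \<comment> \<open>as \<open>\<epsilon>0 \<ge> 1\<close>, its square dominates each of the three summands\<close>
  define \<epsilon>0 where "\<epsilon>0 = 1 + 1 / j0 + (C0 + C0\<^sup>2) * L0"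
  have nn: "0 < 1 / j0" "0 < (C0 + C0\<^sup>2) * L0"
    using params by (auto intro!: mult_pos_pos add_pos_pos)
  have \<epsilon>0_1: "1 \<le> \<epsilon>0" using nn by (simp add: \<epsilon>0_def)
  hence \<epsilon>0_sq: "\<epsilon>0 \<le> \<epsilon>0\<^sup>2" by (simp add: power2_eq_square)
  have \<epsilon>0: "0 < \<epsilon>0" "(C0 + C0\<^sup>2) * L0 \<le> \<epsilon>0\<^sup>2" "1 \<le> j0 * \<epsilon>0\<^sup>2"
  proof -
    show "0 < \<epsilon>0" using \<epsilon>0_1 by linarith
    show "(C0 + C0\<^sup>2) * L0 \<le> \<epsilon>0\<^sup>2" using \<epsilon>0_sq nn unfolding \<epsilon>0_def by linarith
    have "1 / j0 \<le> \<epsilon>0\<^sup>2" using \<epsilon>0_sq nn unfolding \<epsilon>0_def by linarith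
    thus "1 \<le> j0 * \<epsilon>0\<^sup>2" using params by (simp add: field_simps)
  qed
  \<comment> \<open>the lower bound for \<open>M\<close> in \<open>covering_exponent\<close>, with \<open>\<rho> = (D1 + 1) / D2\<close> from \<open>net_radius\<close>\<close>
  define Mmin where "Mmin M0 Q = max 1 (j0 / c1 * ((Q + (D1 + 1) / D2 + 2) * M0 + cB + 1))" for M0 Q
  have L_pos: "0 < L x" if "1 \<le> x" for x using L(1) that by (simp add: slowly_varying_def)
  have nat_real: "\<forall>\<^sub>F n in sequentially. P (real n)" if "\<forall>\<^sub>F x in at_top. P x" for P
    using that filterlim_real_sequentially by (simp add: filterlim_iff)
  have M0_min: "1 < 1 + (cB + 2) / (b * c)" using cB c A5_const by simp
  have Q_min: "0 < 1 + 1 / \<alpha>" using A5_const by (simp add: add_pos_pos)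
  show ?thesis
  proof (rule exI[of _ \<epsilon>0], rule conjI, rule \<epsilon>0(1), rule exI[of _ "1 + (cB + 2) / (b * c)"],
      rule conjI, rule M0_min, rule exI[of _ "1 + 1 / \<alpha>"], rule conjI, rule Q_min, intro allI impI)
    fix M0 Q :: real assume M0: "1 + (cB + 2) / (b * c) \<le> M0" and Q: "1 + 1 / \<alpha> \<le> Q"
    have M0': "1 \<le> M0" "(cB + 2) / (b * c) \<le> M0"
    proof -
      have "0 < (cB + 2) / (b * c)" using cB c A5_const by simp
      thus "1 \<le> M0" "(cB + 2) / (b * c) \<le> M0" using M0 by linarith+
    qed
    have Mmin_pos: "0 < Mmin M0 Q" by (simp add: Mmin_def)
    show "\<exists>M_min>0. \<forall>M\<ge>M_min.
    \<forall>(T :: param measure) (\<mu> :: nat \<Rightarrow> 'x measure) (p :: nat \<Rightarrow> param \<Rightarrow> 'x \<Rightarrow> real)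
      (d :: nat \<Rightarrow> param \<Rightarrow> param \<Rightarrow> real)
      (\<pi> :: nat \<Rightarrow> nat pmf) (g :: nat \<Rightarrow> real \<Rightarrow> real) (\<tau> :: nat \<Rightarrow> nat \<Rightarrow> real).
      statistical_model T \<mu> p d \<longrightarrow>
      prior_data \<pi> g \<tau> \<longrightarrow>
      (\<forall>\<beta>\<in>{\<beta>1..\<beta>2}. \<forall>\<theta>0\<in>sobolev (space T) \<beta> L0. ereal (2 * (\<Sum>i. \<bar>\<theta>0 i\<bar>)) < r) \<longrightarrow>
      (\<forall>\<^sub>F n in sequentially. \<forall>\<beta>\<in>{\<beta>1..\<beta>2}. \<forall>\<theta>0\<in>sobolev (space T) \<beta> L0.
         let \<epsilon> = rate \<epsilon>0 \<beta> n; j = j_int j0 \<epsilon> n; k = k_int M0 L j n in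
           approximation_condition (\<mu> n) (p n) m C0 n j \<theta>0 \<and>
           condition_A2 (\<mu> n) (p n) m H1 n \<epsilon> j \<theta>0 \<and>
           condition_A3 (d n) D0 D1 D2 Q n k \<and>
           condition_A4 (space T) (\<mu> n) (p n) (d n) c1 \<zeta> Q n k \<theta>0 \<and>
           condition_A5 L (\<pi> n) (g n) (\<tau> n) a b C G1 G2 G3 G4 H2 \<alpha> \<tau>0 n j k \<theta>0) \<longrightarrow>
      ((\<lambda>n. SUP \<beta>\<in>{\<beta>1..\<beta>2}. SUP \<theta>0\<in>sobolev (space T) \<beta> L0.
          \<integral>\<^sup>+x. posterior (sieve_prior T (\<pi> n) (g n) (\<tau> n) r) (p n)
                 {\<theta> \<in> space T. M * (ln (real n) / L (real n)) * (rate \<epsilon>0 \<beta> n)\<^sup>2 \<le> (d n \<theta> \<theta>0)\<^sup>2} x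
            \<partial>law (\<mu> n) (p n) \<theta>0) \<longlonglongrightarrow> 0)"
    proof (rule exI[of _ "Mmin M0 Q"], rule conjI, rule Mmin_pos, intro allI impI)
      fix M and T :: "param measure" and \<mu> :: "nat \<Rightarrow> 'x measure" and p :: "nat \<Rightarrow> param \<Rightarrow> 'x \<Rightarrow> real"
        and d :: "nat \<Rightarrow> param \<Rightarrow> param \<Rightarrow> real"
        and \<pi> :: "nat \<Rightarrow> nat pmf" and g :: "nat \<Rightarrow> real \<Rightarrow> real" and \<tau> :: "nat \<Rightarrow> nat \<Rightarrow> real"
      assume M: "Mmin M0 Q \<le> M" and model: "statistical_model T \<mu> p d" and prior: "prior_data \<pi> g \<tau>"
        and r: "\<forall>\<beta>\<in>{\<beta>1..\<beta>2}. \<forall>\<theta>0\<in>sobolev (space T) \<beta> L0. ereal (2 * (\<Sum>i. \<bar>\<theta>0 i\<bar>)) < r"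
        and conds: "\<forall>\<^sub>F n in sequentially. \<forall>\<beta>\<in>{\<beta>1..\<beta>2}. \<forall>\<theta>0\<in>sobolev (space T) \<beta> L0.
         let \<epsilon> = rate \<epsilon>0 \<beta> n; j = j_int j0 \<epsilon> n; k = k_int M0 L j n in
           approximation_condition (\<mu> n) (p n) m C0 n j \<theta>0 \<and>
           condition_A2 (\<mu> n) (p n) m H1 n \<epsilon> j \<theta>0 \<and>
           condition_A3 (d n) D0 D1 D2 Q n k \<and>
           condition_A4 (space T) (\<mu> n) (p n) (d n) c1 \<zeta> Q n k \<theta>0 \<and>
           condition_A5 L (\<pi> n) (g n) (\<tau> n) a b C G1 G2 G3 G4 H2 \<alpha> \<tau>0 n j k \<theta>0"
      have M': "1 \<le> M" "j0 / c1 * ((Q + (D1 + 1) / D2 + 2) * M0 + cB + 1) \<le> M"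
        using M by (auto simp: Mmin_def)
      let ?E = "\<lambda>n \<beta> \<theta>0. \<integral>\<^sup>+x. posterior (sieve_prior T (\<pi> n) (g n) (\<tau> n) r) (p n)
                 {\<theta> \<in> space T. M * (ln (real n) / L (real n)) * (rate \<epsilon>0 \<beta> n)\<^sup>2 \<le> (d n \<theta> \<theta>0)\<^sup>2} x
            \<partial>law (\<mu> n) (p n) \<theta>0"
      \<comment> \<open>the origin lies in every Sobolev ball, so the truncation level is positive\<close>
      have r0: "0 < r"
      proof -
        have "(\<lambda>_. 0) \<in> sieve 0" by (simp add: sieve_def)
        moreover have "sieve 0 \<subseteq> space T"
        proof (rule sieve_subset_space)
          show "trunc 0 \<in> PiM {..<0} (\<lambda>_. lborel) \<rightarrow>\<^sub>M T"
            using model unfolding statistical_model_def by blast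
        qed
        ultimately have "(\<lambda>_. 0) \<in> space T" by blast
        hence "(\<lambda>_. 0) \<in> sobolev (space T) \<beta>1 L0" using params by (simp add: sobolev_def)
        with r params have "ereal (2 * (\<Sum>i. \<bar>0::real\<bar>)) < r" by force
        thus ?thesis by (simp add: zero_ereal_def)
      qed
      have r_large1: "\<forall>\<^sub>F n in sequentially. r = \<infinity> \<or> r \<le> ereal (real n powr Q)"
      proof (cases r)
        case (real r')
        have Q0: "0 < Q" using Q A5_const add_pos_pos[of 1 "1 / \<alpha>"] by simp
        have "\<forall>\<^sub>F n::nat in sequentially. r' \<le> real n powr Q" using Q0 by real_asymp
        thus ?thesis by eventually_elim (simp add: real)
      qed (use r0 in auto)
      have r_large2: "\<forall>\<^sub>F n in sequentially. ereal (2 * (sqrt (real n) * real n powr (- H))) \<le> r"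
      proof (cases r)
        case (real r')
        have r': "0 < r'" using r0 by (simp add: real zero_ereal_def)
        have "\<forall>\<^sub>F n::nat in sequentially. 2 * (sqrt (real n) * real n powr (- H)) \<le> r'"
          using r' H1 by real_asymp
        thus ?thesis by eventually_elim (simp add: real)
      qed (use r0 in auto)
      obtain X where X: "\<And>x. X \<le> x \<Longrightarrow> L x \<le> ln x"
        using L(2) unfolding eventually_at_top_linorder by blast
      obtain Y where Y: "\<And>x. Y \<le> x \<Longrightarrow> x powr (- (1 / 4)) \<le> L x"
        using slowly_varying_lower_bound[OF L(1,3), of "1 / 4"] unfolding eventually_at_top_linorder by auto
      have "\<forall>\<^sub>F i::nat in sequentially. exp (- (b / 2 * real i powr (3 / 4))) \<le> 1 / (real i)\<^sup>2"
        using A5_const by real_asymp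
      then obtain Z where Z: "\<And>i. Z \<le> i \<Longrightarrow> exp (- (b / 2 * real i powr (3 / 4))) \<le> 1 / (real i)\<^sup>2"
        unfolding eventually_sequentially by blast
      define G where "G = G3 * (2 * G2 / G4) powr (1 / \<alpha>) / G1"
      define cq where "cq = G4 / 2 / \<tau>0 powr \<alpha>"
      have Gc: "0 < G" "0 < cq" using A5_const by (auto simp: G_def cq_def)
      have bound: "\<forall>\<^sub>F n in sequentially. \<forall>\<beta>\<in>{\<beta>1..\<beta>2}. \<forall>\<theta>0\<in>sobolev (space T) \<beta> L0.
          ?E n \<beta> \<theta>0 \<le> ennreal (13 / real n + 4 * j0 / ln (real n))"
      proof -
        have b: "\<forall>\<^sub>F n::nat in sequentially.
            exp (cB * (sqrt (real n) * ln (real n))) * exp (- (b / 2 * real n powr (3 / 4))) \<le> 1 / real n"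
          using A5_const cB by real_asymp
        have q: "\<forall>\<^sub>F n::nat in sequentially.
            exp (cB * (sqrt (real n) * ln (real n))) * (real n * (G * exp (- (cq * real n)))) \<le> 1 / real n"
          using Gc cB by real_asymp
        have s1: "\<forall>\<^sub>F n::nat in sequentially. M0 * (sqrt (real n) * ln (real n) * real n powr (1 / 4)) \<le> real n"
          using M0' by real_asymp
        have s2: "\<forall>\<^sub>F n::nat in sequentially. D0 < \<zeta> * sqrt (real n)" using A4_const by real_asymp
        have G1': "0 < 2 * G1 / \<tau>0" using A5_const by simp
        have s3: "\<forall>\<^sub>F n::nat in sequentially. 1 / real n \<le> 2 * G1 / \<tau>0" using G1' by real_asymp
        have s4: "\<forall>\<^sub>F n::nat in sequentially. 2 * j0 < ln (real n)" by real_asymp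
        have s5: "\<forall>\<^sub>F n::nat in sequentially. X \<le> real n powr \<gamma>" using \<gamma> by real_asymp
        note ev = eventually_j_int_bounds[OF params(2,3,5) \<epsilon>0(1), folded \<gamma>_def]
        show ?thesis
          using conds ev nat_real[OF L(2)] nat_real[OF c_L] b q s1 s2 s3 s4 s5 r_large1 r_large2
            eventually_ge_at_top[of "max 4 (max Z (nat \<lceil>Y\<rceil>))"]
        proof eventually_elim
          case (elim n)
          have n: "4 \<le> n" "Z \<le> n" "Y \<le> real n" using elim(14) by (auto simp: nat_le_iff ceiling_le_iff)
          show ?case
          proof (intro ballI)
            fix \<beta> \<theta>0 assume \<beta>: "\<beta> \<in> {\<beta>1..\<beta>2}" and \<theta>0: "\<theta>0 \<in> sobolev (space T) \<beta> L0"
            let ?\<epsilon> = "rate \<epsilon>0 \<beta> n"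
            let ?j = "j_int j0 ?\<epsilon> n"
            let ?k = "k_int M0 L ?j n"
            let ?R = "real n * ?\<epsilon>\<^sup>2"
            let ?u = "sqrt (M * (ln (real n) / L (real n))) * ?\<epsilon>"
            have A: "approximation_condition (\<mu> n) (p n) m C0 n ?j \<theta>0"
              "condition_A2 (\<mu> n) (p n) m H1 n ?\<epsilon> ?j \<theta>0"
              "condition_A3 (d n) D0 D1 D2 Q n ?k"
              "condition_A4 (space T) (\<mu> n) (p n) (d n) c1 \<zeta> Q n ?k \<theta>0"
              "condition_A5 L (\<pi> n) (g n) (\<tau> n) a b C G1 G2 G3 G4 H2 \<alpha> \<tau>0 n ?j ?k \<theta>0"
              using elim(1) \<beta> \<theta>0 unfolding Let_def by blast+
            have J: "real n powr \<gamma> \<le> real ?j" "real ?j \<le> sqrt (real n)"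
              "real ?j * ln (real n) \<le> j0 * ?R" "j0 * ?R \<le> 2 * real ?j * ln (real n)"
              "j0 * ?R < (real ?j + 1) * ln (real n)"
              using elim(2) \<beta> unfolding Let_def by blast+
            have \<beta>': "1 / 2 < \<beta>" using \<beta> params by auto
            have u: "?u\<^sup>2 = M * (ln (real n) / L (real n)) * ?\<epsilon>\<^sup>2"
            proof -
              have "0 < ln (real n) / L (real n)" using n L_pos[of "real n"] by simp
              hence "0 \<le> M * (ln (real n) / L (real n))"
                using M'(1) by (intro mult_nonneg_nonneg) auto
              thus ?thesis by (simp only: power_mult_distrib real_sqrt_pow2)
            qed
            have "(\<integral>\<^sup>+x. posterior (sieve_prior T (\<pi> n) (g n) (\<tau> n) r) (p n)
              {\<theta> \<in> space T. ?u\<^sup>2 \<le> (d n \<theta> \<theta>0)\<^sup>2} x \<partial>law (\<mu> n) (p n) \<theta>0)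
              \<le> ennreal (13 / real n + 4 * j0 / ln (real n))"
            proof (rule posterior_bound_at_sample_size[OF model prior L_pos \<theta>0 \<beta>' _
                  params(1,4,5,6) A2_const A3_const A4_const(1,2) A5_const \<epsilon>0 refl refl refl refl
                  H_def cB_def refl c M0' Q M' A J \<gamma>(1)])
              show "ereal (2 * (\<Sum>i. \<bar>\<theta>0 i\<bar>)) < r" using r \<beta> \<theta>0 by blast
              show "L (real n) \<le> ln (real n)" by (rule elim(3))
              show "L (real ?j) \<le> ln (real ?j)" using elim(11) J(1) by (intro X) linarith
              show "c * L (real n) \<le> L y" if "real n powr \<gamma> \<le> y" "y \<le> real n" for y
                using elim(4) that by auto
              show "y powr (- (1 / 4)) \<le> L y" if "real n \<le> y" for y
                using that n(3) by (intro Y) linarith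
              show "exp (- (b / 2 * real i powr (3 / 4))) \<le> 1 / (real i)\<^sup>2" if "n < i" for i
                using that n(2) by (intro Z) linarith
              show "exp (cB * (sqrt (real n) * ln (real n))) *
                (real n * (G3 * (2 * G2 / G4) powr (1 / \<alpha>) / G1 * exp (- (G4 / 2 / \<tau>0 powr \<alpha> * real n)))) \<le> 1 / real n"
                using elim(6) unfolding G_def cq_def .
            qed (assumption | fact elim n)+
            thus "?E n \<beta> \<theta>0 \<le> ennreal (13 / real n + 4 * j0 / ln (real n))" unfolding u .
          qed
        qed
      qed
      have "(\<lambda>n::nat. 13 / real n + 4 * j0 / ln (real n)) \<longlonglongrightarrow> 0" by real_asymp
      hence "(\<lambda>n. ennreal (13 / real n + 4 * j0 / ln (real n))) \<longlonglongrightarrow> ennreal 0"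
        by (intro tendsto_ennrealI)
      hence lim: "(\<lambda>n. ennreal (13 / real n + 4 * j0 / ln (real n))) \<longlonglongrightarrow> 0" by simp
      show "(\<lambda>n. SUP \<beta>\<in>{\<beta>1..\<beta>2}. SUP \<theta>0\<in>sobolev (space T) \<beta> L0. ?E n \<beta> \<theta>0) \<longlonglongrightarrow> 0"
      proof (rule tendsto_sandwich[OF _ _ tendsto_const lim])
        show "\<forall>\<^sub>F n in sequentially. (SUP \<beta>\<in>{\<beta>1..\<beta>2}. SUP \<theta>0\<in>sobolev (space T) \<beta> L0. ?E n \<beta> \<theta>0)
            \<le> ennreal (13 / real n + 4 * j0 / ln (real n))"
          using bound by eventually_elim (intro SUP_least, blast)
      qed simp
    qed
  qed
qed

end
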